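(* Let $C\subset\mathbb A^{n+2}$ be a non-degenerate cone (conical hypersurface) admitting a quadratic parametrization $$x_i=\frac12\sum_{j,k=0}^na_{i,j,k}u_ju_k,\qquad i=0,\dots,n+1,$$ where $a_{i,j,k}=a_{i,k,j}\in\mathbf k$ are constants. Then $C$ is admissible and its rank is at least $n+1$. Moreover, every (non-zero) homogeneous linear function $g(u_0,\dots,u_n)$ is admissible, i.e. the density $g(u)\,du_0\cdots du_n$ on $C$ is admissible.
   Context: $\mathbf k$ is an algebraically closed field of characteristic $0$; functions are germs of analytic functions (if $\mathbf k=\mathbb C$) or formal germs over $\mathbf k$. **Admissible pairs.** Let $f$ be a function of $x=(x_1,\dots,x_n)$ whose Hessian matrix $H=(\partial_i\partial_j f)$ has $\det H\not\equiv 0$, and $g$ another function. At points $t$ with $\det H(t)\neq0$ put $R_t(u)=f(t+u)-f(t)-\sum_i\partial_if(t)u_i-\frac12\sum_{i,j}H_{ij}(t)u_iu_j$, $\Delta_t=-\frac12\sum_{i,j}(H(t)^{-1})_{ij}\partial_{u_i}\partial_{u_j}$, and $$A_k(t)=\sum_{v=0}^{2k}\frac{1}{v!\,(k+v)!}\,\Delta_t^{\,k+v}\big[g(t+u)R_t(u)^v\big]\Big|_{u=0},\qquad k\ge0$$ (coefficients of the formal stationary phase expansion of $\int g\,e^{(f+x\cdot y)/\hbar}dx$). The pair $(f,g)$ is *admissible* if $\det H\not\equiv0$, $g\not\equiv 0$ and $A_k\equiv0$ for all $k\ge1$. $V_f=\{g: (f,g)\text{ admissible or }g=0\}$ is a vector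 space; the *rank* of $f$ is $\dim V_f$ and $f$ is admissible if its rank is $>0$. **Cones.** A cone $C\subset\mathbb A^{n+2}$ that is a hypersurface is *non-degenerate* if the Gauss map of its projectivization is an immersion at generic points. Near a generic point (after a linear change of coordinates if needed) it is given by $x_{n+1}=x_0f(x_1/x_0,\dots,x_n/x_0)$ with Hessian of $f$ not identically zero. $C$ is *admissible* if $f$ is, and the *rank* of $C$ is the rank of $f$ (as a germ at a generic point); this does not depend on the choice of linear coordinates. **Densities.** Near a generic $u$, a homogeneous function $g(u_0,\dots,u_n)$ of degree $1$ is called admissible if the function $\gamma$ of $n$ variables defined by $$\gamma\Big(\frac{x_1}{x_0},\dots,\frac{x_n}{x_0}\Big)=g(u)\,x_0^{\frac n2}\,\Big(\det\frac{\partial(x_0,\dots,x_n)}{\partial(u_0,\dots,u_n)}\Big)^{-1}$$ (i.e. $\gamma\,x_0^{-n/2}dx_0\cdots dx_n=g\,du_0\cdots du_n$) forms an admissible pair $(f,\gamma)$. *)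

theory Defs
  imports
    "HOL-Analysis.Analysis"
    "HOL-Library.Multiset_Order"
    "HOL-Library.Extended_Nat"
    "HOL-Computational_Algebra.Computational_Algebra"
begin

section \<open>Formal power series in several variables\<close>

text \<open>A monomial in the variables \<open>'v\<close> is a multiset \<open>M\<close> of variables: the exponent of \<open>i\<close> is
  \<open>count M i\<close> and the total degree is \<open>size M\<close>.\<close>

typedef ('v, 'k) mps = "UNIV :: ('v multiset \<Rightarrow> 'k) set"
  morphisms mps_coeff Abs_mps ..

lemma mps_coeff_Abs [simp]: "mps_coeff (Abs_mps c) = c"
  by (simp add: Abs_mps_inverse)

lemma mps_eqI: "(\<And>M. mps_coeff p M = mps_coeff q M) \<Longrightarrow> p = q"
  by (metis ext mps_coeff_inject)

lemma mps_eq_iff: "p = q \<longleftrightarrow> (\<forall>M. mps_coeff p M = mps_coeff q M)"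
  using mps_eqI by blast

lemma finite_submultisets [simp]: "finite {A. A \<subseteq># (M :: 'a multiset)}"
proof (induction M)
  case empty
  then show ?case by simp
next
  case (add x M)
  have "{A. A \<subseteq># add_mset x M} \<subseteq> {A. A \<subseteq># M} \<union> add_mset x ` {A. A \<subseteq># M}"
  proof
    fix A assume "A \<in> {A. A \<subseteq># add_mset x M}"
    then have A: "A \<subseteq># add_mset x M" by simp
    show "A \<in> {A. A \<subseteq># M} \<union> add_mset x ` {A. A \<subseteq># M}"
    proof (cases "x \<in># A")
      case True
      then obtain B where B: "A = add_mset x B" by (metis multi_member_split)
      with A show ?thesis by auto
    next
      case False
      then have "A \<subseteq># M"
        using A by (metis add_mset_remove_trivial diff_single_trivial subset_eq_diff_conv add_mset_add_single)
      then show ?thesis by simp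
    qed
  qed
  with add show ?case by (meson finite_Un finite_imageI finite_subset)
qed

instantiation mps :: (type, comm_monoid_add) comm_monoid_add
begin
definition "0 = Abs_mps (\<lambda>M. 0)"
definition "p + q = Abs_mps (\<lambda>M. mps_coeff p M + mps_coeff q M)"
instance
  by standard (auto simp: mps_eq_iff zero_mps_def plus_mps_def algebra_simps)
end

lemma mps_coeff_0 [simp]: "mps_coeff 0 M = 0"
  by (simp add: zero_mps_def)

lemma mps_coeff_add [simp]: "mps_coeff (p + q) M = mps_coeff p M + mps_coeff q M"
  by (simp add: plus_mps_def)

instantiation mps :: (type, ab_group_add) ab_group_add
begin
definition "- p = Abs_mps (\<lambda>M. - mps_coeff p M)"
definition "p - q = Abs_mps (\<lambda>M. mps_coeff p M - mps_coeff q M)"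
instance
  by standard (auto simp: mps_eq_iff uminus_mps_def minus_mps_def)
end

lemma mps_coeff_uminus [simp]: "mps_coeff (- p) M = - mps_coeff p M"
  by (simp add: uminus_mps_def)

lemma mps_coeff_diff [simp]: "mps_coeff (p - q) M = mps_coeff p M - mps_coeff q M"
  by (simp add: minus_mps_def)

instantiation mps :: (type, comm_semiring_1) "{one, times}"
begin
definition "1 = Abs_mps (\<lambda>M. if M = {#} then 1 else 0)"
definition "p * q = Abs_mps (\<lambda>M. \<Sum>A | A \<subseteq># M. mps_coeff p A * mps_coeff q (M - A))"
instance ..
end

lemma mps_coeff_1: "mps_coeff 1 M = (if M = {#} then 1 else 0)"
  by (simp add: one_mps_def)

lemma mps_coeff_mult:
  "mps_coeff (p * q) M = (\<Sum>A | A \<subseteq># M. mps_coeff p A * mps_coeff q (M - A))"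
  by (simp add: times_mps_def)

lemma mset_diff_diff: "A \<subseteq># M \<Longrightarrow> M - (M - A) = A"
  by (auto simp: multiset_eq_iff subseteq_mset_def)

lemma mps_mult_commute: "p * q = q * (p :: ('v, 'k :: comm_semiring_1) mps)"
proof (rule mps_eqI)
  fix M :: "'v multiset"
  show "mps_coeff (p * q) M = mps_coeff (q * p) M"
    unfolding mps_coeff_mult
    by (rule sum.reindex_bij_witness[of _ "\<lambda>A. M - A" "\<lambda>A. M - A"])
       (auto simp: mult.commute mset_diff_diff)
qed

lemma mps_mult_assoc: "(p * q) * r = p * (q * (r :: ('v, 'k :: comm_semiring_1) mps))"
proof (rule mps_eqI)
  fix M :: "'v multiset"
  have le: "A + B \<subseteq># M" if "A \<subseteq># M" "B \<subseteq># M - A" for A B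
    using that by (metis subset_mset.add_diff_inverse subset_mset.add_left_mono)
  have le': "B \<subseteq># M" "A - B \<subseteq># M - B" "B + (A - B) = A" "M - B - (A - B) = M - A"
    if "A \<subseteq># M" "B \<subseteq># A" for A B
    using that by (auto simp: multiset_eq_iff subseteq_mset_def intro: le_trans diff_le_mono)
  have "mps_coeff ((p * q) * r) M
      = (\<Sum>(A, B)\<in>(SIGMA A:{A. A \<subseteq># M}. {B. B \<subseteq># A}).
          mps_coeff p B * mps_coeff q (A - B) * mps_coeff r (M - A))"
    by (simp add: mps_coeff_mult sum_distrib_right sum.Sigma)
  also have "\<dots> = (\<Sum>(A, B)\<in>(SIGMA A:{A. A \<subseteq># M}. {B. B \<subseteq># M - A}).
          mps_coeff p A * (mps_coeff q B * mps_coeff r (M - A - B)))"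
    by (rule sum.reindex_bij_witness[of _ "\<lambda>(A, B). (A + B, A)" "\<lambda>(A, B). (B, A - B)"])
       (use le le' in \<open>auto simp: mult.assoc\<close>)
  also have "\<dots> = mps_coeff (p * (q * r)) M"
    by (simp add: mps_coeff_mult sum_distrib_left sum.Sigma)
  finally show "mps_coeff ((p * q) * r) M = mps_coeff (p * (q * r)) M" .
qed

instance mps :: (type, comm_ring_1) comm_ring_1
proof
  fix p q r :: "('a, 'b) mps"
  show "p * q = q * p" by (rule mps_mult_commute)
  show "p * q * r = p * (q * r)" by (rule mps_mult_assoc)
  show "(p + q) * r = p * r + q * r"
    by (simp add: mps_eq_iff mps_coeff_mult distrib_right sum.distrib)
  show "1 * p = p"
  proof (rule mps_eqI)
    fix M :: "'a multiset"
    have "mps_coeff (1 * p) M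
        = (\<Sum>A | A \<subseteq># M. if A = {#} then mps_coeff p M else 0)"
      unfolding mps_coeff_mult by (rule sum.cong) (auto simp: mps_coeff_1)
    then show "mps_coeff (1 * p) M = mps_coeff p M" by (simp add: sum.delta)
  qed
  show "(0 :: ('a, 'b) mps) \<noteq> 1"
    by (metis mps_coeff_0 mps_coeff_1 zero_neq_one)
qed

instance mps :: (countable, idom) idom
proof
  fix p q :: "('a, 'b) mps"
  assume "p \<noteq> 0" "q \<noteq> 0"
  define key where "key = (image_mset to_nat :: 'a multiset \<Rightarrow> nat multiset)"
  have inj: "inj key" unfolding key_def
    by (rule inj_on_inverseI[where g = "image_mset from_nat"]) (simp add: multiset.map_comp comp_def)
  have ex: "\<exists>A. mps_coeff s A \<noteq> 0 \<and> (\<forall>B. mps_coeff s B \<noteq> 0 \<longrightarrow> key A \<le> key B)"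
    if nz: "s \<noteq> 0" for s :: "('a, 'b) mps"
  proof -
    obtain A0 where "mps_coeff s A0 \<noteq> 0" using nz by (auto simp: mps_eq_iff)
    define P where "P n \<longleftrightarrow> (\<exists>A. key A = n \<and> mps_coeff s A \<noteq> 0)" for n
    have "P (key A0)" using \<open>mps_coeff s A0 \<noteq> 0\<close> by (auto simp: P_def)
    then have "P (LEAST n. P n)" by (rule LeastI)
    then obtain A where A: "key A = (LEAST n. P n)" "mps_coeff s A \<noteq> 0"
      unfolding P_def by blast
    have "key A \<le> key B" if "mps_coeff s B \<noteq> 0" for B
      unfolding A(1) by (rule Least_le) (use that in \<open>auto simp: P_def\<close>)
    with A(2) show ?thesis by blast
  qed
  obtain A where A: "mps_coeff p A \<noteq> 0" "\<And>B. mps_coeff p B \<noteq> 0 \<Longrightarrow> key A \<le> key B"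
    using ex[OF \<open>p \<noteq> 0\<close>] by blast
  obtain B where B: "mps_coeff q B \<noteq> 0" "\<And>C. mps_coeff q C \<noteq> 0 \<Longrightarrow> key B \<le> key C"
    using ex[OF \<open>q \<noteq> 0\<close>] by blast
  have "mps_coeff p C * mps_coeff q (A + B - C) = 0" if C: "C \<subseteq># A + B" "C \<noteq> A" for C
  proof (rule ccontr)
    assume "mps_coeff p C * mps_coeff q (A + B - C) \<noteq> 0"
    then have le: "key A \<le> key C" "key B \<le> key (A + B - C)" using A B by auto
    have "key C \<noteq> key A" using inj C by (auto simp: inj_eq)
    with le have "key A < key C" by simp
    then have "key A + key B < key C + key (A + B - C)"
      by (rule add_less_le_mono[OF _ le(2)])
    moreover have "key C + key (A + B - C) = key A + key B"
      using C(1) unfolding key_def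
      by (simp only: image_mset_union[symmetric] subset_mset.add_diff_inverse)
    ultimately show False by simp
  qed
  then have "mps_coeff (p * q) (A + B)
      = (\<Sum>C | C \<subseteq># A + B. if C = A then mps_coeff p A * mps_coeff q B else 0)"
    unfolding mps_coeff_mult by (intro sum.cong) auto
  also have "\<dots> = mps_coeff p A * mps_coeff q B" by (simp add: sum.delta)
  finally have "mps_coeff (p * q) (A + B) \<noteq> 0" using A(1) B(1) by simp
  then show "p * q \<noteq> 0" by auto
qed

definition mps_const :: "'k \<Rightarrow> ('v, 'k :: zero) mps" where
  "mps_const c = Abs_mps (\<lambda>M. if M = {#} then c else 0)"

definition mps_var :: "'v \<Rightarrow> ('v, 'k :: zero_neq_one) mps" where
  "mps_var i = Abs_mps (\<lambda>M. if M = {#i#} then 1 else 0)"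

definition mps_deriv :: "'v \<Rightarrow> ('v, 'k :: semiring_1) mps \<Rightarrow> ('v, 'k) mps" where
  "mps_deriv i p = Abs_mps (\<lambda>M. of_nat (Suc (count M i)) * mps_coeff p (add_mset i M))"

text \<open>Substitution \<open>p(T)\<close>, meaningful when every \<open>T i\<close> has zero constant term: a monomial \<open>A\<close> of \<open>p\<close>
  with \<open>size A > size M\<close> does not contribute to the coefficient at \<open>M\<close>.\<close>

definition mps_subst ::
  "('v \<Rightarrow> ('w, 'k :: comm_ring_1) mps) \<Rightarrow> ('v :: finite, 'k) mps \<Rightarrow> ('w, 'k) mps" where
  "mps_subst T p = Abs_mps (\<lambda>M.
     \<Sum>A | size A \<le> size M. mps_coeff p A * mps_coeff (\<Prod>i\<in>#A. T i) M)"

definition mps_scale :: "'k \<Rightarrow> ('v, 'k :: comm_ring_1) mps \<Rightarrow> ('v, 'k) mps" where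
  "mps_scale c p = mps_const c * p"

lemma mps_coeff_const_mult:
  "mps_coeff (mps_const c * p) M = c * mps_coeff p (M :: 'v multiset)"
  for p :: "('v, 'k :: comm_ring_1) mps"
proof -
  have "mps_coeff (mps_const c * p) M
      = (\<Sum>A | A \<subseteq># M. if A = {#} then c * mps_coeff p M else 0)"
    unfolding mps_coeff_mult by (rule sum.cong) (auto simp: mps_const_def)
  then show ?thesis by (simp add: sum.delta)
qed

lemma vector_space_mps: "vector_space (mps_scale :: 'k :: field \<Rightarrow> ('v, 'k) mps \<Rightarrow> ('v, 'k) mps)"
  by standard
     (simp_all add: mps_eq_iff mps_scale_def mps_coeff_const_mult distrib_left distrib_right mult.assoc)

lemma finite_bounded_size [simp]: "finite {A :: 'v :: finite multiset. size A \<le> d}"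
proof -
  have "{A :: 'v multiset. size A \<le> d} \<subseteq> mset ` {xs. set xs \<subseteq> UNIV \<and> length xs \<le> d}"
    by (auto simp: image_iff) (metis ex_mset size_mset)
  then show ?thesis
    by (rule finite_subset) (intro finite_imageI finite_lists_length_le finite)
qed


section \<open>Germs\<close>

text \<open>The two conventions for germs at a point: all formal power series, or, when \<open>'k\<close> is the field of
  complex numbers (via a field isomorphism \<open>\<phi>\<close>), the series that converge absolutely on some
  polydisc.\<close>

definition germ_space :: "('v :: finite, 'k :: field) mps set \<Rightarrow> bool" where
  "germ_space \<O> \<longleftrightarrow>
     \<O> = UNIV \<or>
     (\<exists>\<phi> :: 'k \<Rightarrow> complex. bij \<phi> \<and> (\<forall>x y. \<phi> (x + y) = \<phi> x + \<phi> y) \<and> (\<forall>x y. \<phi> (x * y) = \<phi> x * \<phi> y) \<and>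
        \<O> = {p. \<exists>r>0. (\<lambda>M. norm (\<phi> (mps_coeff p M)) * r ^ size M) summable_on UNIV})"


section \<open>Admissible pairs\<close>

definition hessian :: "('n :: finite, 'k :: field) mps \<Rightarrow> ('n, 'k) mps ^ 'n ^ 'n" where
  "hessian f = (\<chi> i j. mps_deriv i (mps_deriv j f))"

text \<open>Functions of \<open>t\<close> that are regular where the Hessian determinant does not vanish live in the
  fraction field of the power series in \<open>t\<close>. The expansion of \<open>p(t + u)\<close> is a power series in \<open>u\<close>
  over that field: the coefficient of \<open>t\<^sup>A u\<^sup>M\<close> is the coefficient of \<open>p\<close> at \<open>A + M\<close> times a product
  of binomial coefficients.\<close>

definition expand :: "('n :: finite, 'k :: field) mps \<Rightarrow> ('n, ('n, 'k) mps fract) mps" where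
  "expand p = Abs_mps (\<lambda>M. to_fract (Abs_mps (\<lambda>A.
     of_nat (\<Prod>i\<in>UNIV. count (A + M) i choose count M i) * mps_coeff p (A + M))))"

definition remainder :: "('n :: finite, 'k :: field) mps \<Rightarrow> ('n, ('n, 'k) mps fract) mps" where
  "remainder f = expand f - mps_const (to_fract f)
     - (\<Sum>i\<in>UNIV. mps_const (to_fract (mps_deriv i f)) * mps_var i)
     - mps_const (1 / 2) *
         (\<Sum>i\<in>UNIV. \<Sum>j\<in>UNIV. mps_const (to_fract (hessian f $ i $ j)) * mps_var i * mps_var j)"

definition inv_hessian :: "('n :: finite, 'k :: field) mps \<Rightarrow> ('n, 'k) mps fract ^ 'n ^ 'n" where
  "inv_hessian f = matrix_inv (\<chi> i j. to_fract (hessian f $ i $ j))"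

definition Lap :: "('n :: finite, 'k :: field) mps \<Rightarrow>
    ('n, ('n, 'k) mps fract) mps \<Rightarrow> ('n, ('n, 'k) mps fract) mps" where
  "Lap f p = mps_const (- (1 / 2)) *
     (\<Sum>i\<in>UNIV. \<Sum>j\<in>UNIV. mps_const (inv_hessian f $ i $ j) * mps_deriv i (mps_deriv j p))"

definition stat_phase_coeff ::
  "('n :: finite, 'k :: field) mps \<Rightarrow> ('n, 'k) mps \<Rightarrow> nat \<Rightarrow> ('n, 'k) mps fract" where
  "stat_phase_coeff f g k =
     (\<Sum>v = 0..2 * k. 1 / (of_nat (fact v) * of_nat (fact (k + v))) *
        mps_coeff ((Lap f ^^ (k + v)) (expand g * remainder f ^ v)) {#})"

definition admissible_pair :: "('n :: finite, 'k :: field) mps \<Rightarrow> ('n, 'k) mps \<Rightarrow> bool" where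
  "admissible_pair f g \<longleftrightarrow>
     det (hessian f) \<noteq> 0 \<and> g \<noteq> 0 \<and> (\<forall>k\<ge>1. stat_phase_coeff f g k = 0)"

definition admissible_space ::
  "('n :: finite, 'k :: field) mps set \<Rightarrow> ('n, 'k) mps \<Rightarrow> ('n, 'k) mps set" where
  "admissible_space \<O> f = {g \<in> \<O>. admissible_pair f g \<or> g = 0}"

text \<open>The dimension of \<open>admissible_space \<O> f\<close>, possibly infinite.\<close>

definition rank_of :: "('n :: finite, 'k :: field) mps set \<Rightarrow> ('n, 'k) mps \<Rightarrow> enat" where
  "rank_of \<O> f = (SUP B \<in> {B. finite B \<and> B \<subseteq> admissible_space \<O> f \<and>
     \<not> module.dependent mps_scale B}. enat (card B))"

definition admissible :: "('n :: finite, 'k :: field) mps set \<Rightarrow> ('n, 'k) mps \<Rightarrow> bool" where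
  "admissible \<O> f \<longleftrightarrow> rank_of \<O> f > 0"


section \<open>Polynomials and the Zariski topology\<close>

definition is_poly :: "('v, 'k :: zero) mps \<Rightarrow> bool" where
  "is_poly p \<longleftrightarrow> finite {M. mps_coeff p M \<noteq> 0}"

text \<open>The value at \<open>\<sigma>\<close> of a polynomial over \<open>'k\<close> in a commutative \<open>'k\<close>-algebra with structure
  map \<open>\<iota>\<close>.\<close>

definition poly_eval ::
  "('k \<Rightarrow> 'a :: comm_ring_1) \<Rightarrow> ('v \<Rightarrow> 'a) \<Rightarrow> ('v, 'k :: zero) mps \<Rightarrow> 'a" where
  "poly_eval \<iota> \<sigma> p = (\<Sum>M | mps_coeff p M \<noteq> 0. \<iota> (mps_coeff p M) * (\<Prod>i\<in>#M. \<sigma> i))"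

definition poly_at :: "('v, 'k :: field) mps \<Rightarrow> 'k ^ 'v :: finite \<Rightarrow> 'k" where
  "poly_at p x = poly_eval id (\<lambda>i. x $ i) p"

definition zariski_closure :: "('k :: field ^ 'v :: finite) set \<Rightarrow> ('k ^ 'v) set" where
  "zariski_closure S =
     {x. \<forall>P. is_poly P \<and> (\<forall>y\<in>S. poly_at P y = 0) \<longrightarrow> poly_at P x = 0}"

text \<open>\<open>Q\<close> holds at generic points of \<open>S\<close>: on a relatively open dense subset.\<close>

definition generically ::
  "('k :: field ^ 'v :: finite) set \<Rightarrow> ('k ^ 'v \<Rightarrow> bool) \<Rightarrow> bool" where
  "generically S Q \<longleftrightarrow>
     (\<exists>W. zariski_closure W = W \<and> S \<subseteq> zariski_closure (S - W) \<and> (\<forall>x\<in>S - W. Q x))"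


section \<open>Cones\<close>

text \<open>With \<open>'n\<close> indexing the coordinates \<open>1, \<dots>, n\<close>, the type \<open>'n option\<close> indexes \<open>0, \<dots>, n\<close>
  (\<open>None\<close> is \<open>0\<close>) and \<open>'n option option\<close> indexes \<open>0, \<dots>, n+1\<close>, where \<open>None\<close> is \<open>n+1\<close> and
  \<open>Some j\<close> is \<open>j\<close>.\<close>

text \<open>\<open>F\<close> generates the ideal of \<open>C\<close>.\<close>

definition reduced_equation ::
  "('k :: field ^ 'v :: finite) set \<Rightarrow> ('v, 'k) mps \<Rightarrow> bool" where
  "reduced_equation C F \<longleftrightarrow>
     is_poly F \<and> C = {x. poly_at F x = 0} \<and>
     (\<forall>P. is_poly P \<and> (\<forall>x\<in>C. poly_at P x = 0) \<longrightarrow> (\<exists>Q. is_poly Q \<and> P = F * Q))"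

definition conical_hypersurface :: "('k :: field ^ 'v :: finite) set \<Rightarrow> bool" where
  "conical_hypersurface C \<longleftrightarrow>
     (\<exists>F. reduced_equation C F) \<and> C \<noteq> {} \<and> C \<noteq> UNIV \<and> (\<forall>c. \<forall>x\<in>C. c *s x \<in> C)"

definition gradient_at :: "('v, 'k :: field) mps \<Rightarrow> 'k ^ 'v :: finite \<Rightarrow> 'k ^ 'v" where
  "gradient_at F x = (\<chi> i. poly_at (mps_deriv i F) x)"

definition hessian_at :: "('v, 'k :: field) mps \<Rightarrow> 'k ^ 'v :: finite \<Rightarrow> 'k ^ 'v ^ 'v" where
  "hessian_at F x = (\<chi> i j. poly_at (mps_deriv i (mps_deriv j F)) x)"

text \<open>The Gauss map of the projectivization sends \<open>[x]\<close> to \<open>[\<nabla>F(x)]\<close>. At a smooth point \<open>[p]\<close> its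
  differential is the map \<open>ker dF(p) / k p \<rightarrow> k\<^sup>v / k \<nabla>F(p)\<close> induced by the Hessian of \<open>F\<close>
  at \<open>p\<close>; the condition on \<open>w\<close> below is that this map is injective.\<close>

definition gauss_immersive ::
  "('k :: field ^ 'v :: finite) set \<Rightarrow> 'k ^ 'v \<Rightarrow> bool" where
  "gauss_immersive C p \<longleftrightarrow>
     (\<exists>F. reduced_equation C F \<and> p \<in> C \<and> p \<noteq> 0 \<and> gradient_at F p \<noteq> 0 \<and>
       (\<forall>w. (\<Sum>i\<in>UNIV. gradient_at F p $ i * w $ i) = 0 \<and>
            (\<exists>c. hessian_at F p *v w = c *s gradient_at F p) \<longrightarrow> (\<exists>c. w = c *s p)))"

definition nondegenerate_cone :: "('k :: field ^ 'v :: finite) set \<Rightarrow> bool" where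
  "nondegenerate_cone C \<longleftrightarrow> conical_hypersurface C \<and> generically C (gauss_immersive C)"

text \<open>\<open>cone_chart \<O> C L \<tau> f p\<close>: in the linear coordinates \<open>y = L x\<close>, the cone \<open>C\<close> is given near its
  point \<open>p\<close> by \<open>y\<^sub>n\<^sub>+\<^sub>1 = y\<^sub>0 f(y\<^sub>1/y\<^sub>0, \<dots>, y\<^sub>n/y\<^sub>0)\<close>. Here \<open>\<tau>\<close> is the point \<open>(y\<^sub>i/y\<^sub>0)\<close> belonging
  to \<open>p\<close>, and \<open>f\<close> is a germ at \<open>\<tau>\<close>, i.e. a power series in \<open>t - \<tau>\<close>. The last two conditions say
  that the reduced equation vanishes identically on \<open>(1, t, f(t))\<close> and has non-zero derivative
  at \<open>p\<close> in the direction \<open>y\<^sub>n\<^sub>+\<^sub>1\<close>, so that near \<open>p\<close> the cone is this graph and nothing else.\<close>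

definition graph_point ::
  "'k :: field ^ 'n :: finite \<Rightarrow> ('n, 'k) mps \<Rightarrow> ('n, 'k) mps ^ 'n option option" where
  "graph_point \<tau> f = (\<chi> j. case j of
       None \<Rightarrow> f
     | Some None \<Rightarrow> 1
     | Some (Some i) \<Rightarrow> mps_const (\<tau> $ i) + mps_var i)"

definition cone_chart ::
  "('n :: finite, 'k :: field) mps set \<Rightarrow> ('k ^ 'n option option) set \<Rightarrow>
   'k ^ 'n option option ^ 'n option option \<Rightarrow> 'k ^ 'n \<Rightarrow> ('n, 'k) mps \<Rightarrow>
   'k ^ 'n option option \<Rightarrow> bool" where
  "cone_chart \<O> C L \<tau> f p \<longleftrightarrow>
     f \<in> \<O> \<and> p \<in> C \<and> invertible L \<and>
     (let y = L *v p in
        y $ Some None \<noteq> 0 \<and>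
        (\<forall>i. y $ Some (Some i) = y $ Some None * \<tau> $ i) \<and>
        y $ None = y $ Some None * mps_coeff f {#}) \<and>
     (\<exists>F. reduced_equation C F \<and>
        poly_eval mps_const
          (\<lambda>j. \<Sum>i\<in>UNIV. mps_const (matrix_inv L $ j $ i) * graph_point \<tau> f $ i) F = 0 \<and>
        (\<Sum>j\<in>UNIV. gradient_at F p $ j * matrix_inv L $ j $ None) \<noteq> 0)"

definition has_cone_chart ::
  "('n :: finite, 'k :: field) mps set \<Rightarrow> ('k ^ 'n option option) set \<Rightarrow>
   'k ^ 'n option option \<Rightarrow> bool" where
  "has_cone_chart \<O> C p \<longleftrightarrow> (\<exists>L \<tau> f. cone_chart \<O> C L \<tau> f p)"

definition cone_admissible ::
  "('n :: finite, 'k :: field) mps set \<Rightarrow> ('k ^ 'n option option) set \<Rightarrow> bool" where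
  "cone_admissible \<O> C \<longleftrightarrow>
     generically C (\<lambda>p. has_cone_chart \<O> C p \<and>
       (\<forall>L \<tau> f. cone_chart \<O> C L \<tau> f p \<longrightarrow> admissible \<O> f))"

text \<open>The rank of the germ \<open>f\<close> at a generic point is independent of the chart, so it is the largest
  \<open>r\<close> that is a lower bound for the ranks at generic points.\<close>

definition cone_rank ::
  "('n :: finite, 'k :: field) mps set \<Rightarrow> ('k ^ 'n option option) set \<Rightarrow> enat" where
  "cone_rank \<O> C =
     Sup {r. generically C (\<lambda>p. has_cone_chart \<O> C p \<and>
       (\<forall>L \<tau> f. cone_chart \<O> C L \<tau> f p \<longrightarrow> r \<le> rank_of \<O> f))}"


section \<open>Quadratic parametrizations and densities\<close>

definition quad_map ::
  "('n :: finite option option \<Rightarrow> 'n option \<Rightarrow> 'n option \<Rightarrow> 'k :: field) \<Rightarrow>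
   ('k \<Rightarrow> 'a :: comm_ring_1) \<Rightarrow> 'a ^ 'n option \<Rightarrow> 'a ^ 'n option option" where
  "quad_map a \<iota> u =
     (\<chi> i. \<iota> (1 / 2) * (\<Sum>j\<in>UNIV. \<Sum>k\<in>UNIV. \<iota> (a i j k) * u $ j * u $ k))"

definition quadratic_parametrization ::
  "('k :: field ^ 'n :: finite option option) set \<Rightarrow>
   ('n option option \<Rightarrow> 'n option \<Rightarrow> 'n option \<Rightarrow> 'k) \<Rightarrow> bool" where
  "quadratic_parametrization C a \<longleftrightarrow>
     (\<forall>i j k. a i j k = a i k j) \<and>
     range (quad_map a id) \<subseteq> C \<and>
     generically C (\<lambda>p. p \<in> range (quad_map a id))"

text \<open>The coordinate functions \<open>u\<^sub>j\<close> as germs at the point \<open>b\<close>.\<close>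

definition coord_germs :: "'k :: field ^ 'w :: finite \<Rightarrow> ('w, 'k) mps ^ 'w" where
  "coord_germs b = (\<chi> j. mps_const (b $ j) + mps_var j)"

text \<open>\<open>density_in_chart \<O> a L \<tau> f b g\<close>: for the germ \<open>g\<close> at \<open>b\<close>, the density
  \<open>g du\<^sub>0 \<dots> du\<^sub>n\<close>, expressed in the coordinates \<open>y = L x(u)\<close> of a chart, is \<open>\<gamma> y\<^sub>0\<^sup>-\<^sup>n\<^sup>/\<^sup>2 dy\<^sub>0 \<dots> dy\<^sub>n\<close> for a
  function \<open>\<gamma>\<close> of the \<open>y\<^sub>i/y\<^sub>0\<close> such that \<open>(f, \<gamma>)\<close> is admissible. Here \<open>s\<close> is a square
  root of the germ \<open>y\<^sub>0\<close>, and \<open>\<tau> $ i + T i = y\<^sub>i/y\<^sub>0\<close>.\<close>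

definition density_in_chart ::
  "('n :: finite, 'k :: field) mps set \<Rightarrow>
   ('n option option \<Rightarrow> 'n option \<Rightarrow> 'n option \<Rightarrow> 'k) \<Rightarrow>
   'k ^ 'n option option ^ 'n option option \<Rightarrow> 'k ^ 'n \<Rightarrow> ('n, 'k) mps \<Rightarrow>
   'k ^ 'n option \<Rightarrow> ('n option, 'k) mps \<Rightarrow> bool" where
  "density_in_chart \<O> a L \<tau> f b g \<longleftrightarrow>
     (let y = (\<chi> i j. mps_const (L $ i $ j)) *v quad_map a mps_const (coord_germs b) in
      \<exists>s T \<gamma>.
        s ^ 2 = y $ Some None \<and>
        (\<forall>i. mps_coeff (T i) {#} = 0 \<and>
             (mps_const (\<tau> $ i) + T i) * y $ Some None = y $ Some (Some i)) \<and>
        \<gamma> \<in> \<O> \<and>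
        mps_subst T \<gamma> * det (\<chi> j k. mps_deriv k (y $ Some j)) = g * s ^ CARD('n) \<and>
        admissible_pair f \<gamma>)"

definition admissible_density ::
  "('n :: finite, 'k :: field) mps set \<Rightarrow> ('k ^ 'n option option) set \<Rightarrow>
   ('n option option \<Rightarrow> 'n option \<Rightarrow> 'n option \<Rightarrow> 'k) \<Rightarrow>
   'k ^ 'n option \<Rightarrow> ('n option, 'k) mps \<Rightarrow> bool" where
  "admissible_density \<O> C a b g \<longleftrightarrow>
     has_cone_chart \<O> C (quad_map a id b) \<and>
     (\<forall>L \<tau> f. cone_chart \<O> C L \<tau> f (quad_map a id b) \<longrightarrow> density_in_chart \<O> a L \<tau> f b g)"

definition linear_germ :: "'k :: field ^ 'w :: finite \<Rightarrow> 'k ^ 'w \<Rightarrow> ('w, 'k) mps" where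
  "linear_germ b c = (\<Sum>j\<in>UNIV. mps_const (c $ j) * coord_germs b $ j)"

end

theory Submission
  imports Defs
begin

text \<open>Normalize the parametrization over a chart by \<open>y\<^sub>0 = 1\<close>; this gives a section \<open>u(t)\<close> with
  \<open>f = y\<^sub>n\<^sub>+\<^sub>1(u)\<close>. At a generic point \<open>t\<close> the phase \<open>f(t + v) - f(t) - df(t) v\<close> is the value at
  \<open>u(t + v)\<close> of a quadratic form \<open>Q\<close> whose kernel is spanned by \<open>\<beta> = u(t)\<close>. Writing
  \<open>u(t + v) = \<zeta> \<beta> + \<Sum>\<^sub>i \<omega>\<^sub>i \<partial>\<^sub>iu(t)\<close>, where \<open>\<beta>\<close> is orthogonal to the \<open>\<partial>\<^sub>iu(t)\<close> with respect to \<open>y\<^sub>0\<close>, the phase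
  is exactly quadratic in the \<open>\<omega>\<^sub>i\<close>, \<open>\<zeta>\<^sup>2 + b(\<omega>, \<omega>) / 2 = 1\<close>, and a linear density \<open>g(u) du\<close> becomes
  \<open>(g(\<beta>) + odd(\<omega>)) d\<omega>\<close> up to a constant: its Gaussian expansion stops after the first term.
  Instead of changing variables in the formal integral, one uses that the expansion kills total
  derivatives and satisfies an Euler equation in \<open>\<hbar>\<close>.\<close>

text \<open>The form \<open>Q\<close> is the conormal of the cone at the point over
  \<open>t\<close>, pulled back by the parametrization. Conormals annihilate tangent vectors, so
  \<open>\<beta>\<close> lies in the kernel; that nothing else does is the non-vanishing of the
  Hessian of \<open>f\<close>, and this is where the immersive Gauss map enters. Orthogonality with
  respect to \<open>y\<^sub>0\<close> is the derivative of \<open>y\<^sub>0 = 1\<close>. The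
  coefficients live in the fraction field of the power series in \<open>t\<close>, so the
  computation is done at the tautological point over that field, where Taylor expansion is the ring
  homomorphism \<open>expand\<close>. On the algebraic side, genericity refers to \<open>C\<close>,
  whereas charts are built from a parameter \<open>b\<close>: elimination turns the non-vanishing
  Jacobian at \<open>b\<close> into a polynomial condition on the image. Admissibility quantifies
  over all charts at a point, so each one must be identified with the constructed one. For
  convergent germs the section has to converge, so it is obtained from a quadratic fixpoint equation
  that admits majorants. The bound \<open>n + 1\<close> counts the linear forms in the
  \<open>u\<^sub>j\<close>, whose densities are linearly independent.\<close>

no_notation fps_nth (infixl "$" 75)

section \<open>Power series\<close>

lemma mps_coeff_sum [simp]: "mps_coeff (sum f A) M = (\<Sum>x\<in>A. mps_coeff (f x) M)"
  by (induction A rule: infinite_finite_induct) auto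

lemma mps_coeff_mult_empty [simp]: "mps_coeff (p * q) {#} = mps_coeff p {#} * mps_coeff q {#}"
  by (simp add: mps_coeff_mult)

lemma mps_coeff_1_empty [simp]: "mps_coeff 1 {#} = 1"
  by (simp add: mps_coeff_1)

lemma mps_coeff_const: "mps_coeff (mps_const c) M = (if M = {#} then c else 0)"
  by (simp add: mps_const_def)

lemma mps_coeff_const_empty [simp]: "mps_coeff (mps_const c) {#} = c"
  by (simp add: mps_const_def)

lemma mps_coeff_var: "mps_coeff (mps_var i) M = (if M = {#i#} then 1 else 0)"
  by (simp add: mps_var_def)

lemma mps_coeff_var_empty [simp]: "mps_coeff (mps_var i) {#} = 0"
  by (simp add: mps_var_def)

lemma mps_const_0 [simp]: "mps_const 0 = 0"
  by (simp add: mps_eq_iff mps_coeff_const)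

lemma mps_const_1 [simp]: "mps_const 1 = 1"
  by (simp add: mps_eq_iff mps_coeff_const mps_coeff_1)

lemma mps_const_eq_iff [simp]: "mps_const a = mps_const b \<longleftrightarrow> a = b"
  by (metis mps_coeff_const_empty)

lemma mps_const_add: "mps_const (a + b) = mps_const a + mps_const (b :: 'k :: comm_monoid_add)"
  by (simp add: mps_eq_iff mps_coeff_const)

lemma mps_const_diff: "mps_const (a - b) = mps_const a - mps_const (b :: 'k :: ab_group_add)"
  by (simp add: mps_eq_iff mps_coeff_const)

lemma mps_const_uminus: "mps_const (- a) = - mps_const (a :: 'k :: ab_group_add)"
  by (simp add: mps_eq_iff mps_coeff_const)

lemma mps_const_mult: "mps_const (a * b) = mps_const a * mps_const (b :: 'k :: comm_ring_1)"
  by (rule mps_eqI) (simp add: mps_coeff_const_mult mps_coeff_const)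

lemma mps_const_sum: "mps_const (sum f A) = (\<Sum>x\<in>A. mps_const (f x))"
  by (rule mps_eqI) (simp add: mps_coeff_const)

lemma mps_of_nat: "of_nat n = mps_const (of_nat n :: 'k :: comm_ring_1)"
  by (induction n) (auto simp: mps_const_add)

lemma mps_of_int: "of_int n = mps_const (of_int n :: 'k :: comm_ring_1)"
  by (cases n) (auto simp: mps_of_nat mps_const_uminus mps_const_add mps_const_diff)

lemma mps_numeral: "numeral w = mps_const (numeral w :: 'k :: comm_ring_1)"
  by (metis mps_of_nat of_nat_numeral)

text \<open>Characteristic 0 must pass to power series and then to their fraction field, which is
  the base field of the stationary phase calculus below.\<close>

instance mps :: (type, "{comm_ring_1, ring_char_0}") ring_char_0
  by standard (auto simp: inj_def mps_of_nat)

instance fract :: ("{idom, ring_char_0}") field_char_0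
proof
  have "of_nat n = to_fract (of_nat n :: 'a)" for n
    by (induction n) (auto simp: to_fract_add)
  then show "inj (of_nat :: nat \<Rightarrow> 'a fract)"
    by (auto simp: inj_def)
qed

text \<open>The divisors of \<open>add_mset i M\<close> that contain \<open>i\<close> correspond to
  the divisors of \<open>M\<close>. This is the shift of summation behind the Leibniz rule.\<close>

lemma sum_submset_add_mset:
  assumes "\<And>A. i \<notin># A \<Longrightarrow> g A = 0"
  shows "(\<Sum>A | A \<subseteq># add_mset i M. g A) = (\<Sum>A | A \<subseteq># M. g (add_mset i A))"
proof -
  have "(\<Sum>A | A \<subseteq># add_mset i M. g A) = sum g (add_mset i ` {A. A \<subseteq># M})"
  proof (rule sum.mono_neutral_right)
    show "\<forall>A \<in> {A. A \<subseteq># add_mset i M} - add_mset i ` {A. A \<subseteq># M}. g A = 0"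
    proof
      fix A assume A: "A \<in> {A. A \<subseteq># add_mset i M} - add_mset i ` {A. A \<subseteq># M}"
      have "i \<notin># A"
      proof
        assume "i \<in># A"
        then obtain B where "A = add_mset i B" by (metis multi_member_split)
        with A show False by auto
      qed
      then show "g A = 0" using assms by blast
    qed
  qed auto
  also have "\<dots> = (\<Sum>A | A \<subseteq># M. g (add_mset i A))"
    by (subst sum.reindex) (auto simp: inj_on_def)
  finally show ?thesis .
qed

section \<open>Partial derivatives\<close>

lemma mps_coeff_deriv:
  "mps_coeff (mps_deriv i p) M = of_nat (Suc (count M i)) * mps_coeff p (add_mset i M)"
  by (simp add: mps_deriv_def)

lemma mps_deriv_add [simp]: "mps_deriv i (p + q) = mps_deriv i p + mps_deriv i q"
  by (rule mps_eqI) (simp add: mps_coeff_deriv distrib_left)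

lemma mps_deriv_0 [simp]: "mps_deriv i 0 = 0"
  by (rule mps_eqI) (simp add: mps_coeff_deriv)

lemma mps_deriv_const [simp]: "mps_deriv i (mps_const c) = 0"
  by (rule mps_eqI) (simp add: mps_coeff_deriv mps_coeff_const)

lemma mps_deriv_1 [simp]: "mps_deriv i 1 = 0"
  by (metis mps_const_1 mps_deriv_const)

lemma mps_deriv_var: "mps_deriv i (mps_var j) = (if i = j then 1 else 0)"
  by (rule mps_eqI) (auto simp: mps_coeff_deriv mps_coeff_var mps_coeff_1)

lemma mps_deriv_sum [simp]: "mps_deriv i (sum f A) = (\<Sum>x\<in>A. mps_deriv i (f x))"
  by (induction A rule: infinite_finite_induct) auto

text \<open>The exponent of \<open>i\<close> in a product is shared between the factors,
  \<open>Suc (count M i) = count A i + count (add_mset i M - A) i\<close>, and each share produces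
  the derivative of one factor.\<close>

lemma mps_deriv_mult:
  fixes p q :: "('v, 'k :: comm_ring_1) mps"
  shows "mps_deriv i (p * q) = mps_deriv i p * q + p * mps_deriv i q"
proof (rule mps_eqI)
  fix M :: "'v multiset"
  have *: "(\<Sum>A | A \<subseteq># add_mset i M. of_nat (count A i) * (mps_coeff p A * mps_coeff q (add_mset i M - A)))
     = mps_coeff (mps_deriv i p * q) M" for p q :: "('v, 'k) mps"
    by (subst sum_submset_add_mset)
       (auto simp: not_in_iff mps_coeff_mult mps_coeff_deriv mult.assoc)
  have "mps_coeff (mps_deriv i (p * q)) M =
    (\<Sum>A | A \<subseteq># add_mset i M. of_nat (Suc (count M i)) * (mps_coeff p A * mps_coeff q (add_mset i M - A)))"
    by (simp add: mps_coeff_deriv mps_coeff_mult sum_distrib_left)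
  also have "\<dots> = (\<Sum>A | A \<subseteq># add_mset i M. of_nat (count A i) * (mps_coeff p A * mps_coeff q (add_mset i M - A))
      + of_nat (count (add_mset i M - A) i) * (mps_coeff p A * mps_coeff q (add_mset i M - A)))"
  proof (rule sum.cong)
    fix A assume "A \<in> {A. A \<subseteq># add_mset i M}"
    then have "count A i \<le> Suc (count M i)"
      by (metis mem_Collect_eq count_add_mset mset_subset_eq_count)
    then have "Suc (count M i) = count A i + count (add_mset i M - A) i" by simp
    then show "of_nat (Suc (count M i)) * (mps_coeff p A * mps_coeff q (add_mset i M - A)) =
      of_nat (count A i) * (mps_coeff p A * mps_coeff q (add_mset i M - A))
      + of_nat (count (add_mset i M - A) i) * (mps_coeff p A * mps_coeff q (add_mset i M - A))"
      by (metis of_nat_add distrib_right)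
  qed simp
  also have "\<dots> = mps_coeff (mps_deriv i p * q) M +
     (\<Sum>A | A \<subseteq># add_mset i M. of_nat (count (add_mset i M - A) i) * (mps_coeff p A * mps_coeff q (add_mset i M - A)))"
    by (simp only: sum.distrib *)
  also have "(\<Sum>A | A \<subseteq># add_mset i M. of_nat (count (add_mset i M - A) i) * (mps_coeff p A * mps_coeff q (add_mset i M - A)))
    = (\<Sum>A | A \<subseteq># add_mset i M. of_nat (count A i) * (mps_coeff q A * mps_coeff p (add_mset i M - A)))"
    by (rule sum.reindex_bij_witness[of _ "\<lambda>A. add_mset i M - A" "\<lambda>A. add_mset i M - A"])
       (auto simp: mult.commute mset_diff_diff)
  finally show "mps_coeff (mps_deriv i (p * q)) M = mps_coeff (mps_deriv i p * q + p * mps_deriv i q) M"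
    by (simp add: * mult.commute)
qed

lemma mps_deriv_const_mult [simp]:
  fixes p :: "('v, 'k :: comm_ring_1) mps"
  shows "mps_deriv i (mps_const c * p) = mps_const c * mps_deriv i p"
  by (simp add: mps_deriv_mult)

lemma mps_deriv_uminus [simp]:
  fixes p :: "('v, 'k :: comm_ring_1) mps"
  shows "mps_deriv i (- p) = - mps_deriv i p"
  by (rule mps_eqI) (simp add: mps_coeff_deriv)

lemma mps_deriv_diff [simp]:
  fixes p :: "('v, 'k :: comm_ring_1) mps"
  shows "mps_deriv i (p - q) = mps_deriv i p - mps_deriv i q"
  by (simp add: diff_conv_add_uminus del: add_uminus_conv_diff)

lemma mps_deriv_commute:
  fixes p :: "('v, 'k :: comm_ring_1) mps"
  shows "mps_deriv i (mps_deriv j p) = mps_deriv j (mps_deriv i p)"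
  by (rule mps_eqI) (cases "i = j", auto simp: mps_coeff_deriv add_mset_commute algebra_simps)

lemma mps_deriv_power:
  fixes p :: "('v, 'k :: comm_ring_1) mps"
  shows "mps_deriv i (p ^ n) = of_nat n * p ^ (n - 1) * mps_deriv i p"
proof (induction n)
  case (Suc n)
  then show ?case
    by (cases n) (auto simp: mps_deriv_mult algebra_simps)
qed auto

text \<open>In characteristic 0 the iterated derivative along a list, taken at the origin, is a
  non-zero multiple of the coefficient at the multiset of that list.\<close>

lemma mps_eqI_deriv:
  fixes p q :: "('v, 'k :: {idom, ring_char_0}) mps"
  assumes "\<And>l. mps_coeff (foldr mps_deriv l p) {#} = mps_coeff (foldr mps_deriv l q) {#}"
  shows "p = q"
proof -
  have ex: "\<exists>c. c \<noteq> 0 \<and> (\<forall>p. mps_coeff (foldr mps_deriv l p) M = of_nat c * mps_coeff (p :: ('v,'k) mps) (mset l + M))"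
    for l :: "'v list" and M
  proof (induction l arbitrary: M)
    case Nil
    show ?case by (rule exI[of _ 1]) auto
  next
    case (Cons a l)
    from Cons[of "add_mset a M"] obtain c where "c \<noteq> 0"
      "\<And>p. mps_coeff (foldr mps_deriv l p) (add_mset a M) = of_nat c * mps_coeff (p :: ('v,'k) mps) (mset l + add_mset a M)"
      by blast
    then show ?case
      by (intro exI[of _ "Suc (count M a) * c"]) (auto simp: mps_coeff_deriv algebra_simps)
  qed
  show ?thesis
  proof (rule mps_eqI)
    fix M :: "'v multiset"
    obtain l where l: "mset l = M" using ex_mset by blast
    from ex[of l "{#}"] assms[of l] l show "mps_coeff p M = mps_coeff q M" by auto
  qed
qed

section \<open>Order of vanishing at the origin\<close>

definition mps_order_ge :: "nat \<Rightarrow> ('v, 'k :: zero) mps \<Rightarrow> bool" where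
  "mps_order_ge m p \<longleftrightarrow> (\<forall>M. size M < m \<longrightarrow> mps_coeff p M = 0)"

lemma mps_order_ge_0 [simp]: "mps_order_ge 0 p" "mps_order_ge m 0"
  by (auto simp: mps_order_ge_def)

lemma mps_order_ge_Suc_0: "mps_order_ge (Suc 0) p \<longleftrightarrow> mps_coeff p {#} = 0"
  by (auto simp: mps_order_ge_def)

lemma mps_order_ge_add: "mps_order_ge m p \<Longrightarrow> mps_order_ge m q \<Longrightarrow> mps_order_ge m (p + q)"
  by (auto simp: mps_order_ge_def)

lemma mps_order_ge_sum: "(\<And>x. x \<in> A \<Longrightarrow> mps_order_ge m (f x)) \<Longrightarrow> mps_order_ge m (sum f A)"
  by (auto simp: mps_order_ge_def)

lemma mps_order_ge_mono: "mps_order_ge m p \<Longrightarrow> l \<le> m \<Longrightarrow> mps_order_ge l p"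
  by (auto simp: mps_order_ge_def)

lemma mps_order_ge_mult:
  fixes p q :: "('v, 'k :: comm_ring_1) mps"
  assumes "mps_order_ge m p" "mps_order_ge l q"
  shows "mps_order_ge (m + l) (p * q)"
  unfolding mps_order_ge_def
proof (intro allI impI)
  fix M :: "'v multiset" assume M: "size M < m + l"
  have "mps_coeff p A * mps_coeff q (M - A) = 0" if "A \<subseteq># M" for A
  proof -
    have "size M = size A + size (M - A)" using that by (metis size_Diff_submset size_mset_mono le_add_diff_inverse)
    then have "size A < m \<or> size (M - A) < l" using M by linarith
    then show ?thesis using assms by (auto simp: mps_order_ge_def)
  qed
  then show "mps_coeff (p * q) M = 0" by (simp add: mps_coeff_mult)
qed

lemma mps_order_ge_mult_left:
  fixes p q :: "('v, 'k :: comm_ring_1) mps"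
  shows "mps_order_ge m p \<Longrightarrow> mps_order_ge m (q * p)"
  using mps_order_ge_mult[of 0 q m p] by simp

lemma mps_order_ge_power:
  fixes p :: "('v, 'k :: comm_ring_1) mps"
  shows "mps_order_ge m p \<Longrightarrow> mps_order_ge (m * n) (p ^ n)"
  by (induction n) (auto simp: mps_order_ge_mult)

lemma mps_order_ge_deriv:
  "mps_order_ge (Suc m) p \<Longrightarrow> mps_order_ge m (mps_deriv i p)"
  by (auto simp: mps_order_ge_def mps_coeff_deriv)

section \<open>Determinants\<close>

text \<open>Cramer's rule without division: expanding the new row multilinearly, every row other
  than \<open>A $ k\<close> produces two equal rows.\<close>

lemma det_replace_row_combination:
  fixes A :: "'a :: comm_ring_1 ^ 'n ^ 'n"
  shows "det (\<chi> i. if i = k then (\<Sum>j\<in>UNIV. x j *s A $ j) else A $ i) = x k * det A"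
proof -
  have "det (\<chi> i. if i = k then (\<Sum>j\<in>UNIV. x j *s A $ j) else A $ i)
    = (\<Sum>j\<in>UNIV. det (\<chi> i. if i = k then x j *s A $ j else A $ i))"
    by (rule det_linear_row_sum) simp
  also have "\<dots> = (\<Sum>j\<in>UNIV. if j = k then x k * det A else 0)"
  proof (rule sum.cong)
    fix j :: 'n
    have eq: "det (\<chi> i. if i = k then x j *s A $ j else A $ i) = x j * det (\<chi> i. if i = k then A $ j else A $ i)"
      by (rule det_row_mul)
    show "det (\<chi> i. if i = k then x j *s A $ j else A $ i) = (if j = k then x k * det A else 0)"
    proof (cases "j = k")
      case True
      have "(\<chi> i. if i = k then A $ j else A $ i) = A" using True by (simp add: vec_eq_iff)
      then show ?thesis using eq True by simp
    next
      case False
      then have "det (\<chi> i. if i = k then A $ j else A $ i) = 0"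
        by (intro det_identical_rows[of j k]) (auto simp: row_def vec_eq_iff)
      then show ?thesis using eq False by simp
    qed
  qed simp
  finally show ?thesis by simp
qed

text \<open>Meant for matrices of power series, where a non-zero determinant need not be a unit and
  no inverse matrix is available.\<close>

lemma det_nonzero_kernel:
  fixes A :: "'a :: idom ^ 'n ^ 'n"
  assumes "det A \<noteq> 0" "\<And>i. (\<Sum>j\<in>UNIV. A $ i $ j * x j) = 0"
  shows "x k = 0"
proof -
  have 1: "(\<Sum>j\<in>UNIV. x j *s transpose A $ j) = 0"
    using assms(2) by (simp add: vec_eq_iff transpose_def mult.commute)
  have "x k * det (transpose A) = 0"
    unfolding det_replace_row_combination[symmetric, where k = k] 1 by (rule det_row_0)
  then show ?thesis using assms(1) by (simp add: det_transpose)
qed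

text \<open>Kept abstract so that the divergence identity and the chain rule serve
  \<open>mps_deriv\<close>, its extension by a dummy variable, and \<open>pderiv\<close>.\<close>

definition derivation :: "('a :: comm_ring_1 \<Rightarrow> 'a) \<Rightarrow> bool" where
  "derivation d \<longleftrightarrow> (\<forall>x y. d (x + y) = d x + d y) \<and> (\<forall>x y. d (x * y) = d x * y + x * d y)"

lemma derivation_add: "derivation d \<Longrightarrow> d (x + y) = d x + d y"
  and derivation_mult: "derivation d \<Longrightarrow> d (x * y) = d x * y + x * d y"
  by (auto simp: derivation_def)

lemma derivation_0: "derivation d \<Longrightarrow> d 0 = 0"
  using derivation_add[of d 0 0] by simp

lemma derivation_1: "derivation d \<Longrightarrow> d 1 = 0"
  using derivation_mult[of d 1 1] by simp

lemma derivation_sum: "derivation d \<Longrightarrow> d (sum f A) = (\<Sum>x\<in>A. d (f x))"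
  by (induction A rule: infinite_finite_induct) (auto simp: derivation_add derivation_0)

lemma derivation_prod:
  assumes "derivation d" "finite A"
  shows "d (prod f A) = (\<Sum>k\<in>A. d (f k) * prod f (A - {k}))"
  using assms(2)
proof (induction A rule: finite_induct)
  case empty
  then show ?case using derivation_1[OF assms(1)] by simp
next
  case (insert x A)
  have "f x * prod f (A - {k}) = prod f (insert x A - {k})" if "k \<in> A" for k
  proof -
    have "insert x A - {k} = insert x (A - {k})" using that insert by auto
    then show ?thesis using insert by simp
  qed
  then have "(\<Sum>k\<in>A. f x * (d (f k) * prod f (A - {k}))) = (\<Sum>k\<in>A. d (f k) * prod f (insert x A - {k}))"
    by (intro sum.cong refl) (metis mult.left_commute)
  then show ?case
    using insert by (simp add: derivation_mult[OF assms(1)] sum_distrib_left)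
qed

text \<open>The rows of a Jacobian matrix are closed 1-forms, so a determinant with one exact row is a
  divergence: in the terms where a second derivative appears, swapping the two columns involved
  changes only the sign.\<close>

lemma det_exact_row_eq_divergence:
  fixes w :: "'m :: finite \<Rightarrow> 'm \<Rightarrow> 'a :: {idom, ring_char_0}"
  assumes d: "\<And>r. derivation (d r)"
    and closed: "\<And>i r s. i \<noteq> k \<Longrightarrow> d s (w i r) = d r (w i s)"
  shows "det (\<chi> i r. if i = k then d r h else w i r)
    = (\<Sum>\<sigma> | \<sigma> permutes UNIV. of_int (sign \<sigma>) * d (\<sigma> k) (h * (\<Prod>i\<in>UNIV - {k}. w i (\<sigma> i))))"
proof -
  have vanish: "(\<Sum>\<sigma> | \<sigma> permutes UNIV. of_int (sign \<sigma>) *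
      (d (\<sigma> k) (w l (\<sigma> l)) * (\<Prod>i\<in>UNIV - {k} - {l}. w i (\<sigma> i)))) = 0" (is "?S = 0")
    if l: "l \<noteq> k" for l
  proof -
    define g where "g \<sigma> = of_int (sign \<sigma>) *
      (d (\<sigma> k) (w l (\<sigma> l)) * (\<Prod>i\<in>UNIV - {k} - {l}. w i (\<sigma> i)))" for \<sigma>
    have sw: "g (\<sigma> \<circ> Transposition.transpose k l) = - g \<sigma>" if "\<sigma> permutes UNIV" for \<sigma>
    proof -
      have "sign (\<sigma> \<circ> Transposition.transpose k l) = - sign \<sigma>"
        using that l by (subst sign_compose[OF _ permutation_swap_id])
          (auto simp: sign_swap_id intro: permutes_imp_permutation)
      moreover have "d (\<sigma> l) (w l (\<sigma> k)) = d (\<sigma> k) (w l (\<sigma> l))" using closed[OF l] by blast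
      moreover have "(\<Prod>i\<in>UNIV - {k} - {l}. w i ((\<sigma> \<circ> Transposition.transpose k l) i)) = (\<Prod>i\<in>UNIV - {k} - {l}. w i (\<sigma> i))"
        by (rule prod.cong) (auto simp: Transposition.transpose_def)
      ultimately show ?thesis by (simp add: g_def)
    qed
    have "sum g {\<sigma>. \<sigma> permutes UNIV} = sum (\<lambda>\<sigma>. g (\<sigma> \<circ> Transposition.transpose k l)) {\<sigma>. \<sigma> permutes UNIV}"
      by (rule sum_permutations_compose_right) (simp add: permutes_swap_id)
    also have "\<dots> = - sum g {\<sigma>. \<sigma> permutes UNIV}"
      by (simp add: sw sum_negf)
    finally have "sum g {\<sigma>. \<sigma> permutes UNIV} = 0" by simp
    then show ?thesis by (simp add: g_def)
  qed
  have exp: "d (\<sigma> k) (h * (\<Prod>i\<in>UNIV - {k}. w i (\<sigma> i))) = d (\<sigma> k) h * (\<Prod>i\<in>UNIV - {k}. w i (\<sigma> i))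
      + h * (\<Sum>l\<in>UNIV - {k}. d (\<sigma> k) (w l (\<sigma> l)) * (\<Prod>i\<in>UNIV - {k} - {l}. w i (\<sigma> i)))" for \<sigma>
    by (simp add: derivation_mult[OF d] derivation_prod[OF d])
  have "(\<Sum>\<sigma> | \<sigma> permutes UNIV. of_int (sign \<sigma>) * d (\<sigma> k) (h * (\<Prod>i\<in>UNIV - {k}. w i (\<sigma> i))))
    = (\<Sum>\<sigma> | \<sigma> permutes UNIV. of_int (sign \<sigma>) * (d (\<sigma> k) h * (\<Prod>i\<in>UNIV - {k}. w i (\<sigma> i))))
    + (\<Sum>\<sigma> | \<sigma> permutes UNIV. \<Sum>l\<in>UNIV - {k}. h * (of_int (sign \<sigma>) * (d (\<sigma> k) (w l (\<sigma> l)) * (\<Prod>i\<in>UNIV - {k} - {l}. w i (\<sigma> i)))))"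
    unfolding exp by (simp add: sum.distrib[symmetric] algebra_simps sum_distrib_left)
  also have "(\<Sum>\<sigma> | \<sigma> permutes UNIV. \<Sum>l\<in>UNIV - {k}. h * (of_int (sign \<sigma>) * (d (\<sigma> k) (w l (\<sigma> l)) * (\<Prod>i\<in>UNIV - {k} - {l}. w i (\<sigma> i))))) = 0"
    by (subst sum.swap) (simp add: sum_distrib_left[symmetric] vanish)
  also have "(\<Sum>\<sigma> | \<sigma> permutes UNIV. of_int (sign \<sigma>) * (d (\<sigma> k) h * (\<Prod>i\<in>UNIV - {k}. w i (\<sigma> i))))
    = det (\<chi> i r. if i = k then d r h else w i r)"
    unfolding det_def
  proof (rule sum.cong)
    fix \<sigma> :: "'m \<Rightarrow> 'm"
    have "(\<Prod>i\<in>UNIV. (\<chi> i r. if i = k then d r h else w i r) $ i $ \<sigma> i)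
      = d (\<sigma> k) h * (\<Prod>i\<in>UNIV - {k}. w i (\<sigma> i))"
      by (subst prod.remove[of _ k]) (auto intro!: prod.cong)
    then show "of_int (sign \<sigma>) * (d (\<sigma> k) h * (\<Prod>i\<in>UNIV - {k}. w i (\<sigma> i))) =
      of_int (sign \<sigma>) * (\<Prod>i\<in>UNIV. (\<chi> i r. if i = k then d r h else w i r) $ i $ \<sigma> i)" by simp
  qed simp
  finally show ?thesis by simp
qed

section \<open>Formal stationary phase\<close>

text \<open>The operator \<open>Lap\<close> for an arbitrary matrix \<open>G\<close>, so that the
  calculus makes no reference to the generic point.\<close>

definition laplace :: "('n \<Rightarrow> 'n \<Rightarrow> 'k) \<Rightarrow> ('n :: finite, 'k :: field) mps \<Rightarrow> ('n, 'k) mps" where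
  "laplace G p = mps_const (- (1 / 2)) *
     (\<Sum>i\<in>UNIV. \<Sum>j\<in>UNIV. mps_const (G i j) * mps_deriv i (mps_deriv j p))"

definition euler :: "('n :: finite, 'k :: field) mps \<Rightarrow> ('n, 'k) mps" where
  "euler p = (\<Sum>i\<in>UNIV. mps_var i * mps_deriv i p)"

text \<open>The coefficients as linear functionals of the amplitude. Formally, the integral of p
  e^(phase/hbar) is a constant times hbar^(n/2) times the series with terms
  \<open>phase_coeff G R k p\<close> hbar^k; the rules below are what this reading predicts.\<close>

definition phase_coeff ::
  "('n \<Rightarrow> 'n \<Rightarrow> 'k) \<Rightarrow> ('n, 'k) mps \<Rightarrow> nat \<Rightarrow> ('n :: finite, 'k :: field) mps \<Rightarrow> 'k" where
  "phase_coeff G R k p = (\<Sum>v = 0..2 * k. 1 / (of_nat (fact v) * of_nat (fact (k + v))) *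
        mps_coeff ((laplace G ^^ (k + v)) (p * R ^ v)) {#})"

section \<open>Linearity and order properties of the Laplacian\<close>

lemma laplace_0 [simp]: "laplace G 0 = 0"
  by (simp add: laplace_def)

lemma laplace_add: "laplace G (p + q) = laplace G p + laplace G q"
  by (simp add: laplace_def distrib_left sum.distrib)

lemma laplace_const_mult: "laplace G (mps_const c * p) = mps_const c * laplace G p"
  by (simp add: laplace_def sum_distrib_left mult.left_commute)

lemma laplace_funpow_0 [simp]: "(laplace G ^^ m) 0 = 0"
  by (induction m) auto

lemma laplace_funpow_add: "(laplace G ^^ m) (p + q) = (laplace G ^^ m) p + (laplace G ^^ m) q"
  by (induction m) (auto simp: laplace_add)

lemma laplace_funpow_const_mult: "(laplace G ^^ m) (mps_const c * p) = mps_const c * (laplace G ^^ m) p"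
  by (induction m) (auto simp: laplace_const_mult)

lemma laplace_funpow_sum: "(laplace G ^^ m) (sum f A) = (\<Sum>x\<in>A. (laplace G ^^ m) (f x))"
  by (induction A rule: infinite_finite_induct) (auto simp: laplace_funpow_add)

lemma laplace_sum: "laplace G (sum f A) = (\<Sum>x\<in>A. laplace G (f x))"
  by (induction A rule: infinite_finite_induct) (auto simp: laplace_add)

lemma laplace_deriv: "laplace G (mps_deriv i p) = mps_deriv i (laplace G p)"
  by (simp add: laplace_def mps_deriv_commute[of i])

lemma laplace_order: "mps_order_ge (Suc (Suc m)) p \<Longrightarrow> mps_order_ge m (laplace G p)"
  unfolding laplace_def
  by (intro mps_order_ge_mult_left mps_order_ge_sum mps_order_ge_deriv)

lemma laplace_funpow_order: "mps_order_ge (2 * m + l) p \<Longrightarrow> mps_order_ge l ((laplace G ^^ m) p)"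
  by (induction m arbitrary: p) (auto simp: funpow_Suc_right laplace_order simp del: funpow.simps)

lemma laplace_funpow_empty:
  "mps_order_ge (2 * m + 1) p \<Longrightarrow> mps_coeff ((laplace G ^^ m) p) {#} = 0"
  using laplace_funpow_order[of m 1 p G] by (simp add: mps_order_ge_Suc_0)

locale stationary_phase =
  fixes H G :: "'n :: finite \<Rightarrow> 'n \<Rightarrow> 'k :: field_char_0" and R :: "('n, 'k) mps"
  assumes H_sym: "H i j = H j i"
    and G_sym: "G i j = G j i"
    and H_inverse: "(\<Sum>j\<in>UNIV. H i j * G j l) = (if i = l then 1 else 0)"
    and inverse_H: "(\<Sum>j\<in>UNIV. G i j * H j l) = (if i = l then 1 else 0)"
    and R_order: "mps_order_ge 3 R"
begin

abbreviation ev :: "('n, 'k) mps \<Rightarrow> 'k" where "ev p \<equiv> mps_coeff p {#}"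
abbreviation \<Delta> :: "('n, 'k) mps \<Rightarrow> ('n, 'k) mps" where "\<Delta> \<equiv> laplace G"
abbreviation A :: "nat \<Rightarrow> ('n, 'k) mps \<Rightarrow> 'k" where "A \<equiv> phase_coeff G R"

text \<open>The \<open>i\<close>-th partial derivative of the quadratic part of the phase.\<close>

definition Hv :: "'n \<Rightarrow> ('n, 'k) mps" where
  "Hv i = (\<Sum>j\<in>UNIV. mps_const (H i j) * mps_var j)"

definition phase :: "('n, 'k) mps" where
  "phase = mps_const (1 / 2) * (\<Sum>i\<in>UNIV. mps_var i * Hv i) + R"

lemma laplace_var_mult:
  "\<Delta> (mps_var i * p) = mps_var i * \<Delta> p - (\<Sum>j\<in>UNIV. mps_const (G i j) * mps_deriv j p)"
proof -
  have e: "mps_deriv a (mps_deriv b (mps_var i * p)) = (if a = i then mps_deriv b p else 0)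
     + (if b = i then mps_deriv a p else 0) + mps_var i * mps_deriv a (mps_deriv b p)" for a b
    by (auto simp: mps_deriv_mult mps_deriv_var)
  have "(\<Sum>a\<in>UNIV. \<Sum>b\<in>UNIV. mps_const (G a b) * mps_deriv a (mps_deriv b (mps_var i * p)))
    = (\<Sum>a\<in>UNIV. \<Sum>b\<in>UNIV. if a = i then mps_const (G i b) * mps_deriv b p else 0)
    + (\<Sum>a\<in>UNIV. \<Sum>b\<in>UNIV. if b = i then mps_const (G a i) * mps_deriv a p else 0)
    + mps_var i * (\<Sum>a\<in>UNIV. \<Sum>b\<in>UNIV. mps_const (G a b) * mps_deriv a (mps_deriv b p))"
    unfolding e sum_distrib_left sum.distrib[symmetric]
    by (intro sum.cong refl) (auto simp: distrib_left mult_ac)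
  also have "(\<Sum>a\<in>UNIV. \<Sum>b\<in>UNIV. if a = i then mps_const (G i b) * mps_deriv b p else 0)
    = (\<Sum>j\<in>UNIV. mps_const (G i j) * mps_deriv j p)"
    by (subst sum.swap) simp
  also have "(\<Sum>a\<in>UNIV. \<Sum>b\<in>UNIV. if b = i then mps_const (G a i) * mps_deriv a p else 0)
    = (\<Sum>j\<in>UNIV. mps_const (G i j) * mps_deriv j p)"
    by (simp add: G_sym[of _ i])
  finally have e2: "(\<Sum>a\<in>UNIV. \<Sum>b\<in>UNIV. mps_const (G a b) * mps_deriv a (mps_deriv b (mps_var i * p)))
    = mps_const 2 * (\<Sum>j\<in>UNIV. mps_const (G i j) * mps_deriv j p)
      + mps_var i * (\<Sum>a\<in>UNIV. \<Sum>b\<in>UNIV. mps_const (G a b) * mps_deriv a (mps_deriv b p))"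
    by (simp add: mps_of_nat[of 2, simplified, symmetric])
  have h: "mps_const (- (1/2)) * (mps_const 2 * x) = - x" for x :: "('n,'k) mps"
    by (simp add: mult.assoc[symmetric] mps_const_mult[symmetric] mps_const_uminus)
  show ?thesis
    unfolding laplace_def e2 distrib_left h by (simp add: mult.left_commute)
qed

text \<open>Because \<open>G\<close> inverts \<open>H\<close>, the commutator of the Laplacian with
  multiplication by \<open>Hv i\<close> is a single derivative. This canonical commutation relation
  is the source of integration by parts.\<close>

lemma laplace_Hv_mult: "\<Delta> (Hv i * p) = Hv i * \<Delta> p - mps_deriv i p"
proof -
  have "\<Delta> (Hv i * p) = (\<Sum>j\<in>UNIV. mps_const (H i j) * \<Delta> (mps_var j * p))"
    by (simp add: Hv_def sum_distrib_right mult.assoc laplace_const_mult laplace_sum)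
  also have "\<dots> = Hv i * \<Delta> p - (\<Sum>j\<in>UNIV. \<Sum>l\<in>UNIV. mps_const (H i j * G j l) * mps_deriv l p)"
    by (simp add: laplace_var_mult right_diff_distrib sum_subtractf Hv_def sum_distrib_right
        sum_distrib_left mult.assoc mps_const_mult)
  also have "(\<Sum>j\<in>UNIV. \<Sum>l\<in>UNIV. mps_const (H i j * G j l) * mps_deriv l p)
     = (\<Sum>l\<in>UNIV. mps_const (\<Sum>j\<in>UNIV. H i j * G j l) * mps_deriv l p)"
    by (subst sum.swap) (simp add: mps_const_sum sum_distrib_right)
  also have "\<dots> = (\<Sum>l\<in>UNIV. if i = l then mps_deriv l p else 0)"
    by (intro sum.cong refl) (auto simp: H_inverse)
  finally show ?thesis by simp
qed

lemma laplace_funpow_Hv_mult: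
  "(\<Delta> ^^ Suc m) (Hv i * p) = Hv i * (\<Delta> ^^ Suc m) p - of_nat (Suc m) * mps_deriv i ((\<Delta> ^^ m) p)"
proof (induction m arbitrary: p)
  case 0
  then show ?case by (simp add: laplace_Hv_mult)
next
  case (Suc m)
  have d: "mps_deriv i ((\<Delta> ^^ m) (\<Delta> p)) = mps_deriv i ((\<Delta> ^^ Suc m) p)"
    by (simp only: funpow_Suc_right comp_apply)
  have d2: "(\<Delta> ^^ Suc m) (mps_deriv i p) = mps_deriv i ((\<Delta> ^^ Suc m) p)" for m
    by (induction m) (auto simp: laplace_deriv)
  have minus: "(\<Delta> ^^ Suc m) (x - y) = (\<Delta> ^^ Suc m) x - (\<Delta> ^^ Suc m) y" for x y
    using laplace_funpow_add[of "Suc m" G "x - y" y] by simp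
  have "(\<Delta> ^^ Suc (Suc m)) (Hv i * p) = (\<Delta> ^^ Suc m) (\<Delta> (Hv i * p))"
    by (simp only: funpow_Suc_right comp_apply)
  also have "\<dots> = (\<Delta> ^^ Suc m) (Hv i * \<Delta> p) - (\<Delta> ^^ Suc m) (mps_deriv i p)"
    by (simp only: laplace_Hv_mult minus)
  also have "\<dots> = Hv i * (\<Delta> ^^ Suc m) (\<Delta> p) - of_nat (Suc m) * mps_deriv i ((\<Delta> ^^ Suc m) p)
      - mps_deriv i ((\<Delta> ^^ Suc m) p)"
    by (simp only: Suc d d2)
  also have "(\<Delta> ^^ Suc m) (\<Delta> p) = (\<Delta> ^^ Suc (Suc m)) p"
    by (simp only: funpow_Suc_right comp_apply)
  finally show ?case by (simp add: algebra_simps)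
qed

lemma ev_Hv [simp]: "ev (Hv i) = 0"
  by (simp add: Hv_def)

text \<open>Wick's rule: moving \<open>Hv i\<close> past \<open>Suc m\<close> Laplacians leaves that
  many copies of \<open>- mps_deriv i\<close>, and \<open>Hv i\<close> itself vanishes at the
  origin.\<close>

lemma ev_laplace_Hv_mult:
  "ev ((\<Delta> ^^ Suc m) (Hv i * p)) = - of_nat (Suc m) * ev ((\<Delta> ^^ m) (mps_deriv i p))"
proof -
  have d2: "(\<Delta> ^^ m) (mps_deriv i p) = mps_deriv i ((\<Delta> ^^ m) p)"
    by (induction m) (auto simp: laplace_deriv)
  show ?thesis
    unfolding laplace_funpow_Hv_mult d2 mps_of_nat mps_coeff_diff mps_coeff_mult_empty by (simp add: algebra_simps)
qed

lemma laplace_euler: "\<Delta> (euler p) = euler (\<Delta> p) + 2 * \<Delta> p"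
proof -
  have h: "mps_const 2 * (mps_const (- (1/2)) * x) = - x" for x :: "('n,'k) mps"
    by (simp add: mult.assoc[symmetric] mps_const_mult[symmetric] mps_const_uminus)
  have two: "2 = (mps_const 2 :: ('n,'k) mps)" using mps_of_nat[of 2] by simp
  have "\<Delta> (euler p) = (\<Sum>i\<in>UNIV. \<Delta> (mps_var i * mps_deriv i p))"
    by (simp add: euler_def laplace_sum)
  also have "\<dots> = euler (\<Delta> p) - (\<Sum>i\<in>UNIV. \<Sum>j\<in>UNIV. mps_const (G i j) * mps_deriv j (mps_deriv i p))"
    by (simp add: laplace_var_mult sum_subtractf euler_def laplace_deriv)
  also have "(\<Sum>i\<in>UNIV. \<Sum>j\<in>UNIV. mps_const (G i j) * mps_deriv j (mps_deriv i p)) = - 2 * \<Delta> p"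
    by (simp add: laplace_def two h mps_deriv_commute)
  finally show ?thesis by simp
qed

text \<open>The commutator of \<open>\<Delta>\<close> with the Euler field is
  \<open>2 * \<Delta>\<close>, as second derivatives lower degrees by 2, and the Euler field kills
  values at the origin.\<close>

lemma ev_laplace_euler: "ev ((\<Delta> ^^ m) (euler p)) = 2 * of_nat m * ev ((\<Delta> ^^ m) p)"
proof -
  have two: "2 = (mps_const 2 :: ('n,'k) mps)" using mps_of_nat[of 2] by simp
  have "(\<Delta> ^^ m) (euler p) = euler ((\<Delta> ^^ m) p) + mps_const (2 * of_nat m) * (\<Delta> ^^ m) p"
    by (induction m) (auto simp: laplace_euler laplace_add laplace_const_mult two mps_const_add mps_const_mult algebra_simps)
  then show ?thesis by (simp add: euler_def)
qed

lemma phase_coeff_0 [simp]: "A k 0 = 0"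
  by (simp add: phase_coeff_def)

lemma phase_coeff_add: "A k (p + q) = A k p + A k q"
  by (simp add: phase_coeff_def distrib_right laplace_funpow_add sum.distrib algebra_simps)

lemma phase_coeff_sum: "A k (sum f S) = (\<Sum>x\<in>S. A k (f x))"
  by (induction S rule: infinite_finite_induct) (auto simp: phase_coeff_add)

lemma phase_coeff_const_mult: "A k (mps_const c * p) = c * A k p"
  unfolding phase_coeff_def mult.assoc[of "mps_const c"] laplace_funpow_const_mult
  by (simp add: sum_distrib_left)

lemma phase_coeff_diff: "A k (p - q) = A k p - A k q"
  using phase_coeff_add[of k "p - q" q] by simp

text \<open>At the origin, \<open>k + v\<close> Laplacians see only degree
  \<open>2 * (k + v)\<close>, while \<open>p * R ^ v\<close> has order at least
  \<open>2 * k + 1 + 3 * v\<close>. Hence amplitudes may be truncated.\<close>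

lemma phase_coeff_order: 
  assumes "mps_order_ge (2 * k + 1) p"
  shows "A k p = 0"
  unfolding phase_coeff_def
proof (rule sum.neutral, rule ballI)
  fix v assume "v \<in> {0..2 * k}"
  have "mps_order_ge (2 * k + 1 + 3 * v) (p * R ^ v)"
    by (intro mps_order_ge_mult mps_order_ge_power assms R_order)
  then have "mps_order_ge (2 * (k + v) + 1) (p * R ^ v)"
    by (rule mps_order_ge_mono) simp
  from laplace_funpow_empty[OF this] show "1 / (of_nat (fact v) * of_nat (fact (k + v))) *
         ev ((\<Delta> ^^ (k + v)) (p * R ^ v)) = 0" by simp
qed

text \<open>For \<open>v > 2 * k\<close> the order \<open>3 * v\<close> of \<open>R ^ v\<close>
  exceeds \<open>2 * (k + v)\<close>. A free upper limit lets sums for different \<open>k\<close> be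
  compared term by term.\<close>

lemma phase_coeff_eq:
  assumes "2 * k \<le> N"
  shows "A k p = (\<Sum>v\<le>N. 1 / (fact v * fact (k + v)) * ev ((\<Delta> ^^ (k + v)) (p * R ^ v)))"
  unfolding phase_coeff_def of_nat_fact
proof (rule sum.mono_neutral_left)
  show "\<forall>v\<in>{..N} - {0..2 * k}. 1 / (fact v * fact (k + v)) * ev ((\<Delta> ^^ (k + v)) (p * R ^ v)) = 0"
  proof
    fix v assume v: "v \<in> {..N} - {0..2 * k}"
    have "mps_order_ge (0 + 3 * v) (p * R ^ v)"
      by (intro mps_order_ge_mult mps_order_ge_power R_order) simp
    then have "mps_order_ge (2 * (k + v) + 1) (p * R ^ v)"
      by (rule mps_order_ge_mono) (use v in auto)
    from laplace_funpow_empty[OF this] 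
    show "1 / (fact v * fact (k + v)) * ev ((\<Delta> ^^ (k + v)) (p * R ^ v)) = 0" by simp
  qed
qed (use assms in auto)

lemma phase_deriv: "mps_deriv i phase = Hv i + mps_deriv i R"
proof -
  have d: "mps_deriv i (Hv a) = mps_const (H a i)" for a
    by (simp add: Hv_def mps_deriv_var if_distrib cong: if_cong)
  have "mps_deriv i (\<Sum>a\<in>UNIV. mps_var a * Hv a) = (\<Sum>a\<in>UNIV. (if i = a then Hv a else 0)
        + mps_var a * mps_deriv i (Hv a))"
    by (simp add: mps_deriv_mult mps_deriv_var) (intro sum.cong refl, auto)
  then have "mps_deriv i (\<Sum>a\<in>UNIV. mps_var a * Hv a) = mps_const 2 * Hv i"
    by (simp add: d sum.distrib Hv_def[of i] mult.commute[of "mps_var _"] H_sym[of _ i] mps_of_nat[of 2, simplified, symmetric])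
  then show ?thesis
    by (simp add: phase_def mult.assoc[symmetric] mps_const_mult[symmetric])
qed

text \<open>Formally the integral of the total derivative of h e^(phase/hbar) vanishes, and the
  factor 1/hbar in front of the derivative of the phase shifts the index by one.\<close>

lemma phase_coeff_by_parts: "A k (mps_deriv i h) = - A (Suc k) (h * mps_deriv i phase)"
proof -
  \<comment> \<open>One term more than \<open>A (Suc k)\<close> has by definition, because
    \<open>g\<close> is going to enter with its index shifted by one.\<close>
  define N where "N = Suc (2 * Suc k)"
  define e where "e v = 1 / (fact v * fact (k + v)) * ev ((\<Delta> ^^ (k + v)) (mps_deriv i h * R ^ v))" for v
  define g where "g v = 1 / (fact v * fact (Suc k + v)) * ev ((\<Delta> ^^ (Suc k + v)) (h * mps_deriv i R * R ^ v))" for v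
  have 1: "A k (mps_deriv i h) = (\<Sum>v\<le>N. e v)"
    unfolding e_def by (rule phase_coeff_eq) (simp add: N_def)
  have 2: "A (Suc k) (h * mps_deriv i R) = (\<Sum>v\<le>2 * Suc k. g v)"
    unfolding g_def by (rule phase_coeff_eq) simp
  \<comment> \<open>Commuting \<open>Hv i\<close> out leaves the derivative of
    \<open>h * R ^ v\<close>. The Leibniz term that differentiates \<open>R ^ v\<close> is the
    summand of index \<open>v - 1\<close> for the amplitude \<open>h * mps_deriv i R\<close>; there
    is none for \<open>v = 0\<close>.\<close>
  have t: "1 / (fact v * fact (Suc k + v)) * ev ((\<Delta> ^^ (Suc k + v)) (h * Hv i * R ^ v))
      = - e v - (case v of 0 \<Rightarrow> 0 | Suc w \<Rightarrow> g w)" for v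
  proof -
    have "ev ((\<Delta> ^^ (Suc k + v)) (h * Hv i * R ^ v)) = ev ((\<Delta> ^^ Suc (k + v)) (Hv i * (h * R ^ v)))"
      by (simp add: mult_ac)
    also have "\<dots> = - of_nat (Suc (k + v)) * ev ((\<Delta> ^^ (k + v)) (mps_deriv i (h * R ^ v)))"
      by (rule ev_laplace_Hv_mult)
    finally have "1 / (fact v * fact (Suc k + v)) * ev ((\<Delta> ^^ (Suc k + v)) (h * Hv i * R ^ v))
      = - (1 / (fact v * fact (k + v)) * ev ((\<Delta> ^^ (k + v)) (mps_deriv i (h * R ^ v))))"
      using of_nat_neq_0[of "k + v", where 'a = 'k] by (simp add: divide_simps del: of_nat_Suc of_nat_add)
    also have "mps_deriv i (h * R ^ v) = mps_deriv i h * R ^ v + mps_const (of_nat v) * (h * mps_deriv i R * R ^ (v - 1))"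
      by (simp add: mps_deriv_mult mps_deriv_power mps_of_nat mult_ac)
    also have "- (1 / (fact v * fact (k + v)) * ev ((\<Delta> ^^ (k + v)) \<dots>))
      = - e v - (case v of 0 \<Rightarrow> 0 | Suc w \<Rightarrow> g w)"
    proof (cases v)
      case (Suc w)
      have "(fact v :: 'k) = of_nat v * fact w" "(of_nat v :: 'k) \<noteq> 0" "k + v = Suc k + w" "v - 1 = w"
        using Suc by (auto simp del: of_nat_Suc)
      then show ?thesis
        unfolding laplace_funpow_add laplace_funpow_const_mult e_def g_def
        using Suc by (simp add: distrib_left del: of_nat_Suc fact_Suc funpow.simps)
    qed (simp add: e_def)
    finally show ?thesis .
  qed
  have "A (Suc k) (h * Hv i) = (\<Sum>v\<le>N. - e v - (case v of 0 \<Rightarrow> 0 | Suc w \<Rightarrow> g w))"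
    unfolding t[symmetric] by (rule phase_coeff_eq) (simp add: N_def)
  also have "\<dots> = - (\<Sum>v\<le>N. e v) - (\<Sum>v\<le>2 * Suc k. g v)"
    unfolding sum_subtractf sum_negf N_def by (subst (2) sum.atMost_Suc_shift) simp
  finally have "A (Suc k) (h * Hv i) = - A k (mps_deriv i h) - A (Suc k) (h * mps_deriv i R)"
    unfolding 1 2 .
  then show ?thesis by (simp add: phase_deriv distrib_left phase_coeff_add)
qed

text \<open>The Euler equation in hbar: hbar d/dhbar inserts -phase/hbar under the integral, while
  it multiplies hbar^(k+n/2) by k + n/2.\<close>

lemma phase_coeff_phase_mult:
  "A (Suc k) (phase * g) = - (of_nat k + of_nat CARD('n) / 2) * A k g"
proof -
  define N where "N = Suc (2 * Suc k)"
  define e where "e v = 1 / (fact v * fact (k + v)) * ev ((\<Delta> ^^ (k + v)) (g * R ^ v))" for v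
  have 1: "A k g = (\<Sum>v\<le>N. e v)"
    unfolding e_def by (rule phase_coeff_eq) (simp add: N_def)
  have quad: "ev ((\<Delta> ^^ Suc m) (mps_const (1 / 2) * (\<Sum>i\<in>UNIV. mps_var i * Hv i) * p))
     = - (of_nat (Suc m) * (of_nat m + of_nat CARD('n) / 2)) * ev ((\<Delta> ^^ m) p)" for m p
  proof -
    have "mps_const (1 / 2) * (\<Sum>i\<in>UNIV. mps_var i * Hv i) * p = mps_const (1 / 2) * (\<Sum>i\<in>UNIV. Hv i * (mps_var i * p))"
      by (simp add: sum_distrib_right sum_distrib_left mult_ac)
    then have "ev ((\<Delta> ^^ Suc m) (mps_const (1 / 2) * (\<Sum>i\<in>UNIV. mps_var i * Hv i) * p))
      = 1 / 2 * (\<Sum>i\<in>UNIV. ev ((\<Delta> ^^ Suc m) (Hv i * (mps_var i * p))))"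
      unfolding laplace_funpow_const_mult laplace_funpow_sum by (simp only: mps_coeff_mult_empty mps_coeff_const_empty mps_coeff_sum laplace_funpow_sum laplace_funpow_const_mult)
    also have "\<dots> = 1 / 2 * (- of_nat (Suc m) * ev ((\<Delta> ^^ m) (\<Sum>i\<in>UNIV. mps_deriv i (mps_var i * p))))"
      by (simp only: ev_laplace_Hv_mult sum_distrib_left laplace_funpow_sum mps_coeff_sum)
    also have "(\<Sum>i\<in>UNIV. mps_deriv i (mps_var i * p)) = mps_const (of_nat CARD('n)) * p + euler p"
      by (simp add: mps_deriv_mult mps_deriv_var sum.distrib euler_def mps_of_nat)
    also have "ev ((\<Delta> ^^ m) (mps_const (of_nat CARD('n)) * p + euler p)) = (of_nat CARD('n) + 2 * of_nat m) * ev ((\<Delta> ^^ m) p)"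
      unfolding laplace_funpow_add laplace_funpow_const_mult by (simp add: ev_laplace_euler distrib_right)
    finally show ?thesis by (simp add: field_simps)
  qed
  have "A (Suc k) (mps_const (1 / 2) * (\<Sum>i\<in>UNIV. mps_var i * Hv i) * g)
     = (\<Sum>v\<le>N. 1 / (fact v * fact (Suc k + v)) * ev ((\<Delta> ^^ (Suc k + v)) (mps_const (1 / 2) * (\<Sum>i\<in>UNIV. mps_var i * Hv i) * g * R ^ v)))"
    by (rule phase_coeff_eq) (simp add: N_def)
  also have "\<dots> = (\<Sum>v\<le>N. - (of_nat (k + v) + of_nat CARD('n) / 2) * e v)"
  proof (intro sum.cong refl)
    fix v
    have "ev ((\<Delta> ^^ (Suc k + v)) (mps_const (1 / 2) * (\<Sum>i\<in>UNIV. mps_var i * Hv i) * g * R ^ v))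
      = - (of_nat (Suc (k + v)) * (of_nat (k + v) + of_nat CARD('n) / 2)) * ev ((\<Delta> ^^ (k + v)) (g * R ^ v))"
      unfolding quad[symmetric] by (simp add: mult.assoc)
    moreover have "(fact (Suc k + v) :: 'k) = of_nat (Suc (k + v)) * fact (k + v)" by simp
    moreover have "(of_nat (Suc (k + v)) :: 'k) \<noteq> 0" by (rule of_nat_neq_0)
    ultimately show "1 / (fact v * fact (Suc k + v)) * ev ((\<Delta> ^^ (Suc k + v)) (mps_const (1 / 2) * (\<Sum>i\<in>UNIV. mps_var i * Hv i) * g * R ^ v))
      = - (of_nat (k + v) + of_nat CARD('n) / 2) * e v"
      unfolding e_def by (simp add: divide_simps del: of_nat_Suc of_nat_add)
  qed
  finally have Q: "A (Suc k) (mps_const (1 / 2) * (\<Sum>i\<in>UNIV. mps_var i * Hv i) * g)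
      = (\<Sum>v\<le>N. - (of_nat (k + v) + of_nat CARD('n) / 2) * e v)" .
  \<comment> \<open>Since 1/v! = (v+1)/(v+1)!, the factor \<open>R\<close> reproduces the terms
    \<open>e v\<close> with weight \<open>v\<close>, which cancels the \<open>v\<close> in the
    weights of the quadratic part.\<close>
  have "A (Suc k) (R * g) = (\<Sum>v\<le>2 * Suc k. 1 / (fact v * fact (Suc k + v)) * ev ((\<Delta> ^^ (Suc k + v)) (R * g * R ^ v)))"
    by (rule phase_coeff_eq) simp
  also have "\<dots> = (\<Sum>v\<le>2 * Suc k. of_nat (Suc v) * e (Suc v))"
  proof (intro sum.cong refl)
    fix v
    have eq: "R * g * R ^ v = g * R ^ Suc v" "Suc k + v = k + Suc v" "(fact (Suc v) :: 'k) = of_nat (Suc v) * fact v"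
      by (simp_all add: mult_ac)
    have "(of_nat (Suc v) :: 'k) \<noteq> 0" by (rule of_nat_neq_0)
    then show "1 / (fact v * fact (Suc k + v)) * ev ((\<Delta> ^^ (Suc k + v)) (R * g * R ^ v)) = of_nat (Suc v) * e (Suc v)"
      unfolding e_def eq by (simp del: of_nat_Suc power_Suc funpow.simps fact_Suc add_Suc add_Suc_right)
  qed
  also have "\<dots> = (\<Sum>v\<le>N. of_nat v * e v)"
    unfolding N_def by (subst sum.atMost_Suc_shift) simp
  finally have RQ: "A (Suc k) (R * g) = (\<Sum>v\<le>N. of_nat v * e v)" .
  show ?thesis
    unfolding phase_def distrib_right phase_coeff_add Q RQ 1
    unfolding sum_distrib_left sum.distrib[symmetric]
    by (intro sum.cong refl) (simp add: algebra_simps)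
qed


end

subsection \<open>Morse coordinates\<close>

text \<open>The index \<open>None\<close> adds a dummy variable on which nothing depends, so that the determinants below
  can be compared with those of the homogeneous coordinates.\<close>

definition ext_deriv :: "'n option \<Rightarrow> ('n, 'k :: comm_ring_1) mps \<Rightarrow> ('n, 'k) mps" where
  "ext_deriv r p = (case r of None \<Rightarrow> 0 | Some i \<Rightarrow> mps_deriv i p)"

definition ext_jacobian :: "('n \<Rightarrow> ('n, 'k :: comm_ring_1) mps) \<Rightarrow> ('n, 'k) mps ^ 'n option ^ 'n :: finite option" where
  "ext_jacobian \<omega> = (\<chi> i r. case i of None \<Rightarrow> if r = None then 1 else 0 | Some j \<Rightarrow> ext_deriv r (\<omega> j))"

lemma ext_deriv_simps [simp]: "ext_deriv None p = 0" "ext_deriv (Some i) p = mps_deriv i p"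
  by (simp_all add: ext_deriv_def)

lemma derivation_mps_deriv: "derivation (mps_deriv i :: ('n, 'k :: comm_ring_1) mps \<Rightarrow> _)"
  by (simp add: derivation_def mps_deriv_mult)

lemma derivation_ext_deriv: "derivation (ext_deriv r :: ('n, 'k :: comm_ring_1) mps \<Rightarrow> _)"
  by (cases r) (auto simp: derivation_def mps_deriv_mult)

lemma ext_deriv_commute: "ext_deriv r (ext_deriv s p) = ext_deriv s (ext_deriv r (p :: ('n, 'k :: comm_ring_1) mps))"
  by (cases r; cases s) (auto simp: mps_deriv_commute)

lemma ext_deriv_const [simp]: "ext_deriv r (mps_const c) = 0" "ext_deriv r 1 = 0" "ext_deriv r 0 = 0"
  by (cases r; simp)+

text \<open>With dh = sum of g_a d\<open>\<omega>\<close>_a, putting dh in place of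
  d\<open>\<omega>\<close>_j in the volume form multiplies it by g_j.\<close>

lemma det_ext_jacobian_exact_row:
  fixes \<omega> :: "'n :: finite \<Rightarrow> ('n, 'k :: {idom, ring_char_0}) mps"
  assumes "\<And>r. ext_deriv r h = (\<Sum>a\<in>UNIV. g a * ext_deriv r (\<omega> a))"
  shows "det (\<chi> i r. if i = Some j then ext_deriv r h else ext_jacobian \<omega> $ i $ r) = g j * det (ext_jacobian \<omega>)"
proof -
  have "(\<chi> i r. if i = Some j then ext_deriv r h else ext_jacobian \<omega> $ i $ r)
    = (\<chi> i. if i = Some j then (\<Sum>a\<in>UNIV. (case a of None \<Rightarrow> 0 | Some b \<Rightarrow> g b) *s ext_jacobian \<omega> $ a) else ext_jacobian \<omega> $ i)"
    by (auto simp: vec_eq_iff assms UNIV_option_conv sum.reindex ext_jacobian_def)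
  then show ?thesis by (simp add: det_replace_row_combination)
qed

context stationary_phase
begin

lemma phase_coeff_by_parts_ext: "A k (ext_deriv r h) = - A (Suc k) (h * ext_deriv r phase)"
  by (cases r) (auto simp: phase_coeff_by_parts)

end

text \<open>In the functions \<open>\<omega>\<close> the phase equals its own quadratic part, with
  the same matrix \<open>H\<close>. They will come from the parametrization, so no Morse lemma is
  invoked.\<close>

locale morse_coordinates = stationary_phase H G R
  for H G :: "'n :: finite \<Rightarrow> 'n \<Rightarrow> 'k :: field_char_0" and R :: "('n, 'k) mps" +
  fixes \<omega> :: "'n \<Rightarrow> ('n, 'k) mps"
  assumes \<omega>_0 [simp]: "mps_coeff (\<omega> i) {#} = 0"
    and phase_eq: "phase = mps_const (1 / 2) * (\<Sum>i\<in>UNIV. \<Sum>j\<in>UNIV. mps_const (H i j) * \<omega> i * \<omega> j)"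
begin

section \<open>Amplitudes times the volume form in Morse coordinates: the constant and the odd
  ones\<close>

definition J where "J = det (ext_jacobian \<omega>)"

definition H\<omega> where "H\<omega> i = (\<Sum>j\<in>UNIV. mps_const (H i j) * \<omega> j)"

definition W :: "'n multiset \<Rightarrow> ('n, 'k) mps" where "W M = (\<Prod>i\<in>#M. \<omega> i)"

lemma W_simps [simp]: "W {#} = 1" "W (add_mset i M) = \<omega> i * W M"
  by (simp_all add: W_def)

lemma ext_deriv_phase: "ext_deriv r phase = (\<Sum>a\<in>UNIV. H\<omega> a * ext_deriv r (\<omega> a))"
proof (cases r)
  case (Some i)
  have two: "2 = (mps_const 2 :: ('n,'k) mps)" using mps_of_nat[of 2] by simp
  have "mps_deriv i (\<Sum>a\<in>UNIV. \<Sum>b\<in>UNIV. mps_const (H a b) * \<omega> a * \<omega> b)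
    = (\<Sum>a\<in>UNIV. \<Sum>b\<in>UNIV. mps_const (H a b) * \<omega> b * mps_deriv i (\<omega> a))
    + (\<Sum>a\<in>UNIV. \<Sum>b\<in>UNIV. mps_const (H a b) * \<omega> a * mps_deriv i (\<omega> b))"
    by (simp add: mps_deriv_mult sum.distrib algebra_simps)
  also have "(\<Sum>a\<in>UNIV. \<Sum>b\<in>UNIV. mps_const (H a b) * \<omega> a * mps_deriv i (\<omega> b))
     = (\<Sum>a\<in>UNIV. \<Sum>b\<in>UNIV. mps_const (H a b) * \<omega> b * mps_deriv i (\<omega> a))"
    by (subst sum.swap) (simp add: H_sym)
  also have "(\<Sum>a\<in>UNIV. \<Sum>b\<in>UNIV. mps_const (H a b) * \<omega> b * mps_deriv i (\<omega> a))
     = (\<Sum>a\<in>UNIV. H\<omega> a * mps_deriv i (\<omega> a))"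
    by (simp add: H\<omega>_def sum_distrib_right)
  finally have "mps_deriv i phase = mps_const (1 / 2) * (2 * (\<Sum>a\<in>UNIV. H\<omega> a * mps_deriv i (\<omega> a)))"
    by (simp add: phase_eq)
  also have "\<dots> = (\<Sum>a\<in>UNIV. H\<omega> a * mps_deriv i (\<omega> a))"
    by (simp add: two mult.assoc[symmetric] mps_const_mult[symmetric])
  finally show ?thesis using Some by simp
qed simp

text \<open>Integration by parts along the vector field dual to \<open>d\<omega>\<^sub>j\<close>.\<close>

lemma phase_coeff_by_parts_morse:
  assumes "\<And>r. ext_deriv r h = (\<Sum>a\<in>UNIV. g a * ext_deriv r (\<omega> a))"
  shows "A k (g j * J) = - A (Suc k) (h * H\<omega> j * J)"
proof -
  define w where "w i r = ext_jacobian \<omega> $ i $ r" for i r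
  have closed: "ext_deriv s (w i r) = ext_deriv r (w i s)" for i r s
    by (cases i) (auto simp: w_def ext_jacobian_def ext_deriv_commute)
  define P where "P \<sigma> = (\<Prod>i\<in>UNIV - {Some j}. w i (\<sigma> i))" for \<sigma> :: "'n option \<Rightarrow> 'n option"
  have "g j * J = det (\<chi> i r. if i = Some j then ext_deriv r h else w i r)"
    unfolding J_def w_def using det_ext_jacobian_exact_row[OF assms] by simp
  also have "\<dots> = (\<Sum>\<sigma> | \<sigma> permutes UNIV. of_int (sign \<sigma>) * ext_deriv (\<sigma> (Some j)) (h * P \<sigma>))"
    unfolding P_def by (rule det_exact_row_eq_divergence[OF derivation_ext_deriv closed])
  finally have "A k (g j * J) = (\<Sum>\<sigma> | \<sigma> permutes UNIV. of_int (sign \<sigma>) * A k (ext_deriv (\<sigma> (Some j)) (h * P \<sigma>)))"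
    by (simp add: phase_coeff_sum mps_of_int phase_coeff_const_mult)
  also have "\<dots> = - A (Suc k) (h * (\<Sum>\<sigma> | \<sigma> permutes UNIV. of_int (sign \<sigma>) * (P \<sigma> * ext_deriv (\<sigma> (Some j)) phase)))"
    unfolding phase_coeff_by_parts_ext sum_distrib_left phase_coeff_sum
    by (simp add: mps_of_int phase_coeff_const_mult mult.left_commute[of h] sum_negf mult.assoc)
  also have "(\<Sum>\<sigma> | \<sigma> permutes UNIV. of_int (sign \<sigma>) * (P \<sigma> * ext_deriv (\<sigma> (Some j)) phase))
     = det (\<chi> i r. if i = Some j then ext_deriv r phase else w i r)"
    unfolding det_def P_def
    by (intro sum.cong refl arg_cong2[where f = "(*)"], subst prod.remove[of _ "Some j"]) (auto simp: mult.commute)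
  also have "\<dots> = H\<omega> j * J"
    unfolding J_def w_def using det_ext_jacobian_exact_row[OF ext_deriv_phase] by simp
  finally show ?thesis by (simp add: mult.assoc)
qed

text \<open>Integration by parts with \<open>h = \<omega> j\<close>, summed over \<open>j\<close>,
  gives \<open>2 * A (Suc k) (phase * J) = - n * A k J\<close>, where the Euler equation gives
  \<open>- (2 * k + n) * A k J\<close>. The difference is a multiple of \<open>k\<close>.\<close>

lemma phase_coeff_J: 
  assumes "k \<ge> 1"
  shows "A k J = 0"
proof -
  have two: "2 = (mps_const 2 :: ('n,'k) mps)" using mps_of_nat[of 2] by simp
  have "A (Suc k) (\<omega> j * H\<omega> j * J) = - A k J" for j
    using phase_coeff_by_parts_morse[of "\<omega> j" "\<lambda>a. if a = j then 1 else 0" k j] by (simp add: if_distrib if_distribR cong: if_cong)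
  then have "(\<Sum>j\<in>UNIV. A (Suc k) (\<omega> j * H\<omega> j * J)) = - (of_nat CARD('n) * A k J)"
    by simp
  moreover have "(\<Sum>j\<in>UNIV. \<omega> j * H\<omega> j * J) = mps_const 2 * (phase * J)"
  proof -
    have "(\<Sum>i\<in>UNIV. \<Sum>j\<in>UNIV. mps_const (H i j) * \<omega> i * \<omega> j) = (\<Sum>i\<in>UNIV. \<omega> i * H\<omega> i)"
      by (simp add: H\<omega>_def sum_distrib_left mult.assoc mult.left_commute[of "\<omega> _"])
    then show ?thesis
      by (simp add: phase_eq mult.assoc[symmetric] mps_const_mult[symmetric] sum_distrib_right)
  qed
  ultimately have "2 * A (Suc k) (phase * J) = - (of_nat CARD('n) * A k J)"
    by (metis phase_coeff_sum phase_coeff_const_mult)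
  then have "of_nat k * A k J = 0"
    unfolding phase_coeff_phase_mult by (simp add: field_simps)
  then show ?thesis using assms by simp
qed

lemma ext_deriv_W:
  "ext_deriv r (W M) = (\<Sum>a\<in>UNIV. of_nat (count M a) * W (M - {#a#}) * ext_deriv r (\<omega> a))"
proof (induction M)
  case empty
  then show ?case by simp
next
  case (add b M)
  have e: "of_nat (count (add_mset b M) a) * W (add_mset b M - {#a#})
     = (if a = b then W M else 0) + \<omega> b * (of_nat (count M a) * W (M - {#a#}))" for a
  proof (cases "a \<in># M")
    case True
    then obtain N where "M = add_mset a N" by (metis multi_member_split)
    then show ?thesis by (auto simp: algebra_simps)
  next
    case False
    then show ?thesis by (auto simp: not_in_iff)
  qed
  have d: "(\<Sum>a\<in>UNIV. (if a = b then W M else 0) * ext_deriv r (\<omega> a)) = W M * ext_deriv r (\<omega> b)"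
    by (subst sum.remove[of _ b]) auto
  show ?case
    unfolding e by (simp add: d derivation_mult[OF derivation_ext_deriv] add distrib_right sum.distrib sum_distrib_left mult.assoc mult.commute[of "ext_deriv r (\<omega> b)"])
qed

lemma \<omega>_eq: "\<omega> i = (\<Sum>j\<in>UNIV. mps_const (G i j) * H\<omega> j)"
proof -
  have "(\<Sum>j\<in>UNIV. mps_const (G i j) * H\<omega> j) = (\<Sum>l\<in>UNIV. mps_const (\<Sum>j\<in>UNIV. G i j * H j l) * \<omega> l)"
    unfolding H\<omega>_def sum_distrib_left mps_const_sum sum_distrib_right
    by (subst sum.swap) (simp add: mps_const_mult mult.assoc)
  also have "\<dots> = \<omega> i"
    by (simp add: inverse_H if_distrib if_distribR cong: if_cong)
  finally show ?thesis by simp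
qed

lemma phase_coeff_0_eq: "A 0 p = ev p"
  by (simp add: phase_coeff_def)

text \<open>One factor \<open>\<omega> b\<close> is a combination of the \<open>H\<omega> j\<close>.
  Integration by parts trades it for a derivative of the rest, which lowers both the degree by 2 and
  \<open>k\<close> by 1; for \<open>k = 0\<close> the monomial is evaluated at the origin.\<close>

lemma phase_coeff_W_odd:
  assumes "odd (size M)"
  shows "A k (W M * J) = 0"
  using assms
proof (induction "size M" arbitrary: M k rule: less_induct)
  case less
  then obtain b M' where M: "M = add_mset b M'" by (cases M) auto
  have "A k (W M' * H\<omega> j * J) = 0" for j
  proof (cases k)
    case 0
    then show ?thesis by (simp add: phase_coeff_0_eq H\<omega>_def)
  next
    case (Suc l)
    have "A l (of_nat (count M' j) * W (M' - {#j#}) * J) = 0"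
    proof (cases "j \<in># M'")
      case True
      then have "size M' = Suc (size (M' - {#j#}))" by (metis size_Suc_Diff1)
      then have "A l (W (M' - {#j#}) * J) = 0" using less M by auto
      then show ?thesis by (simp add: mps_of_nat mult.assoc phase_coeff_const_mult)
    qed (simp add: not_in_iff)
    then show ?thesis
      using phase_coeff_by_parts_morse[OF ext_deriv_W, of l M' j] Suc by simp
  qed
  moreover have "W M * J = (\<Sum>j\<in>UNIV. mps_const (G b j) * (W M' * H\<omega> j * J))"
    by (simp add: M \<omega>_eq[of b] sum_distrib_right sum_distrib_left mult_ac)
  ultimately show ?case by (simp add: phase_coeff_sum phase_coeff_const_mult)
qed

text \<open>The span of the monomials of even degree in the \<open>\<omega> i\<close>. Adding one
  monomial at a time gives an induction principle; the set is a subring, as the Newton iterates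
  below require.\<close>

inductive_set even_polys :: "('n, 'k) mps set" where
  even_0: "0 \<in> even_polys"
| even_step: "x \<in> even_polys \<Longrightarrow> even (size M) \<Longrightarrow> x + mps_const c * W M \<in> even_polys"

lemma even_polys_monom: "even (size M) \<Longrightarrow> mps_const c * W M \<in> even_polys"
  using even_step[OF even_0] by simp

lemma even_polys_const: "mps_const c \<in> even_polys"
  using even_polys_monom[of "{#}" c] by simp

lemma even_polys_add: 
  assumes "x \<in> even_polys" "y \<in> even_polys"
  shows "x + y \<in> even_polys"
  using assms(2) by induction (auto simp: add.assoc[symmetric] assms(1) intro: even_step)

lemma even_polys_sum: "(\<And>i. i \<in> I \<Longrightarrow> f i \<in> even_polys) \<Longrightarrow> sum f I \<in> even_polys"
  by (induction I rule: infinite_finite_induct) (auto intro: even_polys_add even_0)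

lemma even_polys_mult_monom:
  assumes "x \<in> even_polys" "even (size M)"
  shows "x * (mps_const c * W M) \<in> even_polys"
  using assms(1)
proof induction
  case (even_step x N d)
  have "mps_const d * W N * (mps_const c * W M) = mps_const (d * c) * W (N + M)"
    by (simp add: W_def mps_const_mult mult_ac)
  then show ?case
    using even_step assms(2) by (auto simp: distrib_right intro!: even_polys_add even_polys_monom)
qed (simp add: even_0)

lemma even_polys_mult: 
  assumes "x \<in> even_polys" "y \<in> even_polys"
  shows "x * y \<in> even_polys"
  using assms(2)
  by induction (simp_all add: distrib_left even_0 even_polys_add even_polys_mult_monom[OF assms(1)])

lemma even_polys_diff: "x \<in> even_polys \<Longrightarrow> y \<in> even_polys \<Longrightarrow> x - y \<in> even_polys"
  using even_polys_add[of x "mps_const (-1) * y"] even_polys_mult[OF even_polys_const[of "-1"]]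
  by (simp add: mps_const_uminus)

lemma phase_coeff_odd:
  assumes "x \<in> even_polys"
  shows "A k (x * \<omega> i * J) = 0"
  using assms
proof induction
  case (even_step x M c)
  have "(x + mps_const c * W M) * \<omega> i * J = x * \<omega> i * J + mps_const c * (W (add_mset i M) * J)"
    by (simp add: algebra_simps)
  moreover have "A k (W (add_mset i M) * J) = 0"
    by (rule phase_coeff_W_odd) (use even_step in simp)
  ultimately show ?case
    using even_step by (simp only: phase_coeff_add phase_coeff_const_mult) simp
qed simp

text \<open>\<open>1 / \<zeta>\<close> is a power series in \<open>\<zeta>\<^sup>2\<close>, hence even in \<open>\<omega>\<close>; it is
  approximated by Newton's iteration \<open>z \<mapsto> z + z (1 - \<zeta>\<^sup>2 z\<^sup>2) / 2\<close>.\<close>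

lemma phase_coeff_odd_density:
  assumes \<zeta>: "mps_coeff \<zeta> {#} = 1" "\<zeta>\<^sup>2 \<in> even_polys"
    and \<theta>: "\<zeta> * \<theta> = (\<Sum>i\<in>UNIV. mps_const (c i) * \<omega> i) * J"
  shows "A k \<theta> = 0"
proof -
  have one: "1 \<in> even_polys" using even_polys_const[of 1] by simp
  have ex: "\<exists>z. z \<in> even_polys \<and> mps_order_ge (Suc m) (1 - \<zeta> * z)" for m
  proof (induction m)
    case 0
    show ?case
      by (rule exI[of _ 1]) (use one \<zeta>(1) in \<open>auto simp: mps_order_ge_Suc_0\<close>)
  next
    case (Suc m)
    then obtain z where z: "z \<in> even_polys" "mps_order_ge (Suc m) (1 - \<zeta> * z)" by blast
    define h where "h = (mps_const (1 / 2) :: ('n, 'k) mps)"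
    have h: "2 * h = 1"
      by (simp add: h_def mps_numeral mps_const_mult[symmetric])
    define z' where "z' = z + h * z * (1 - \<zeta>\<^sup>2 * z\<^sup>2)"
    have "z' \<in> even_polys"
      unfolding z'_def h_def power2_eq_square[of z]
      by (intro even_polys_add even_polys_mult even_polys_diff z \<zeta> even_polys_const one)
    \<comment> \<open>The error is squared up to a factor, so its order doubles; the induction only
      records a gain of one.\<close>
    moreover have "1 - \<zeta> * z' = (1 - \<zeta> * z) * (1 - \<zeta> * z) * (h * (2 + \<zeta> * z))"
    proof -
      have "1 - \<zeta> * z' = (1 - \<zeta> * z) * (1 - \<zeta> * z) * (h * (2 + \<zeta> * z)) + (1 - 2 * h) * (1 - \<zeta> * z)"
        unfolding z'_def by (simp add: algebra_simps power2_eq_square)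
      then show ?thesis by (simp add: h)
    qed
    moreover have "mps_order_ge (Suc m + Suc m) ((1 - \<zeta> * z) * (1 - \<zeta> * z))"
      by (intro mps_order_ge_mult z)
    then have "mps_order_ge (Suc m + Suc m) ((1 - \<zeta> * z) * (1 - \<zeta> * z) * (h * (2 + \<zeta> * z)))"
      by (subst mult.commute) (rule mps_order_ge_mult_left)
    then have "mps_order_ge (Suc (Suc m)) ((1 - \<zeta> * z) * (1 - \<zeta> * z) * (h * (2 + \<zeta> * z)))"
      by (rule mps_order_ge_mono) simp
    ultimately show ?case by (intro exI[of _ z']) simp
  qed
  \<comment> \<open>\<open>A k\<close> ignores amplitudes of order \<open>2 * k + 1\<close>, so
    \<open>z\<close> may replace the inverse of \<open>\<zeta>\<close> at this precision.\<close>
  obtain z where z: "z \<in> even_polys" "mps_order_ge (Suc (2 * k)) (1 - \<zeta> * z)" using ex by blast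
  have "A k (z * (\<zeta> * \<theta>)) = 0"
  proof -
    have "z * (\<zeta> * \<theta>) = (\<Sum>i\<in>UNIV. mps_const (c i) * (z * \<omega> i * J))"
      unfolding \<theta> sum_distrib_left sum_distrib_right
      by (intro sum.cong refl) (simp only: mult_ac)
    then show ?thesis
      by (simp add: phase_coeff_sum phase_coeff_const_mult phase_coeff_odd[OF z(1)])
  qed
  moreover have "A k (\<theta> * (1 - \<zeta> * z)) = 0"
    by (rule phase_coeff_order, rule mps_order_ge_mult_left) (use z in simp)
  ultimately have "A k (z * (\<zeta> * \<theta>) + \<theta> * (1 - \<zeta> * z)) = 0"
    by (simp only: phase_coeff_add) simp
  also have "z * (\<zeta> * \<theta>) + \<theta> * (1 - \<zeta> * z) = \<theta>" by (simp add: algebra_simps)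
  finally show ?thesis .
qed

end

lemma matrix_inv_mult:
  fixes A :: "'a :: field ^ 'n ^ 'n"
  assumes "invertible A"
  shows "A ** matrix_inv A = mat 1" "matrix_inv A ** A = mat 1"
  using assms unfolding invertible_def matrix_inv_def by (metis (mono_tags, lifting) someI_ex)+

section \<open>Taylor expansion at the generic point\<close>

text \<open>A predicate shared by constants, the value at the origin, \<open>to_fract\<close>,
  \<open>expand\<close>, substitution and evaluation, so that polar forms and determinants are
  transported uniformly.\<close>

definition ring_map :: "('a :: comm_ring_1 \<Rightarrow> 'b :: comm_ring_1) \<Rightarrow> bool" where
  "ring_map h \<longleftrightarrow> h 1 = 1 \<and> (\<forall>x y. h (x + y) = h x + h y) \<and> (\<forall>x y. h (x * y) = h x * h y)"

lemma ring_map_1: "ring_map h \<Longrightarrow> h 1 = 1"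
  and ring_map_add: "ring_map h \<Longrightarrow> h (x + y) = h x + h y"
  and ring_map_mult: "ring_map h \<Longrightarrow> h (x * y) = h x * h y"
  by (auto simp: ring_map_def)

lemma ring_map_0: "ring_map h \<Longrightarrow> h 0 = 0"
  using ring_map_add[of h 0 0] by simp

lemma ring_map_diff: "ring_map h \<Longrightarrow> h (x - y) = h x - h y"
  using ring_map_add[of h "x - y" y] by simp

lemma ring_map_uminus: "ring_map h \<Longrightarrow> h (- x) = - h x"
  using ring_map_diff[of h 0 x] by (simp add: ring_map_0)

lemma ring_map_sum: "ring_map h \<Longrightarrow> h (sum f A) = (\<Sum>x\<in>A. h (f x))"
  by (induction A rule: infinite_finite_induct) (auto simp: ring_map_0 ring_map_add)

lemma ring_map_prod: "ring_map h \<Longrightarrow> h (prod f A) = (\<Prod>x\<in>A. h (f x))"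
  by (induction A rule: infinite_finite_induct) (auto simp: ring_map_1 ring_map_mult)

lemma ring_map_prod_mset: "ring_map h \<Longrightarrow> h (\<Prod>i\<in>#M. f i) = (\<Prod>i\<in>#M. h (f i))"
  by (induction M) (auto simp: ring_map_1 ring_map_mult)

lemma ring_map_of_nat: "ring_map h \<Longrightarrow> h (of_nat n) = of_nat n"
  by (induction n) (auto simp: ring_map_0 ring_map_1 ring_map_add)

lemma ring_map_of_int: "ring_map h \<Longrightarrow> h (of_int n) = of_int n"
  by (cases n) (auto simp: ring_map_of_nat ring_map_uminus ring_map_diff ring_map_1 ring_map_add)

lemma ring_map_det:
  assumes "ring_map h"
  shows "h (det A) = det (\<chi> i j. h (A $ i $ j))"
  by (simp add: det_def ring_map_sum[OF assms] ring_map_prod[OF assms] ring_map_mult[OF assms] ring_map_of_int[OF assms])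

lemma ring_map_comp: "ring_map g \<Longrightarrow> ring_map h \<Longrightarrow> ring_map (\<lambda>x. g (h x))"
  by (simp add: ring_map_def)

lemma ring_map_mps_const: "ring_map mps_const"
  by (simp add: ring_map_def mps_const_add mps_const_mult)

lemma ring_map_to_fract: "ring_map to_fract"
  by (simp add: ring_map_def to_fract_add to_fract_mult)

lemma to_fract_numeral: "to_fract (numeral w :: 'a :: idom) = numeral w"
  using ring_map_of_nat[OF ring_map_to_fract[where 'a = 'a], of "numeral w"] by simp

lemma ring_map_const_term: "ring_map (\<lambda>p. mps_coeff p {#})"
  by (simp add: ring_map_def)

lemma mps_eqI_deriv1:
  fixes p q :: "('v, 'k :: {idom, ring_char_0}) mps"
  assumes "mps_coeff p {#} = mps_coeff q {#}" "\<And>i. mps_deriv i p = mps_deriv i q"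
  shows "p = q"
proof (rule mps_eqI)
  fix M :: "'v multiset"
  show "mps_coeff p M = mps_coeff q M"
  proof (cases M)
    case (add i N)
    have "mps_coeff (mps_deriv i p) N = mps_coeff (mps_deriv i q) N" by (simp add: assms)
    then show ?thesis using add by (simp add: mps_coeff_deriv del: of_nat_Suc)
  qed (simp add: assms)
qed

lemma mps_order_ge_SucI:
  fixes p :: "('v, 'k :: {idom, ring_char_0}) mps"
  assumes "mps_coeff p {#} = 0" "\<And>i. mps_order_ge m (mps_deriv i p)"
  shows "mps_order_ge (Suc m) p"
  unfolding mps_order_ge_def
proof (intro allI impI)
  fix M :: "'v multiset" assume M: "size M < Suc m"
  show "mps_coeff p M = 0"
  proof (cases M)
    case (add i N)
    have "mps_coeff (mps_deriv i p) N = 0" using assms(2)[of i] M add by (auto simp: mps_order_ge_def)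
    then show ?thesis using add by (simp add: mps_coeff_deriv del: of_nat_Suc)
  qed (simp add: assms)
qed

section \<open>The expansion map is a differential ring homomorphism\<close>

lemma mps_coeff_expand:
  "mps_coeff (expand p) M = to_fract (Abs_mps (\<lambda>A.
     of_nat (\<Prod>i\<in>UNIV. count (A + M) i choose count M i) * mps_coeff p (A + M)))"
  by (simp add: expand_def)

lemma expand_const_term [simp]: "mps_coeff (expand p) {#} = to_fract p"
  by (simp add: mps_coeff_expand mps_coeff_inverse)

lemma expand_add: "expand (p + q) = expand p + expand q"
  unfolding mps_eq_iff mps_coeff_add mps_coeff_expand to_fract_add[symmetric] to_fract_eq_iff
  by (simp add: distrib_left)

text \<open>The derivatives of p(t+u) in \<open>t\<close> and in \<open>u\<close> agree. On
  coefficients this is the absorption identity for binomials, applied to the exponent of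
  \<open>j\<close>.\<close>

lemma expand_deriv: "expand (mps_deriv j p) = mps_deriv j (expand p)"
proof (rule mps_eqI)
  fix M
  have e: "of_nat n * to_fract (X :: ('a, 'b) mps) = to_fract (of_nat n * X)" for n X
    by (simp add: to_fract_mult ring_map_of_nat[OF ring_map_to_fract])
  have b: "Suc (count M j) * (\<Prod>i\<in>UNIV. count (A + add_mset j M) i choose count (add_mset j M) i)
     = (\<Prod>i\<in>UNIV. count (A + M) i choose count M i) * Suc (count (A + M) j)" for A
  proof -
    have "(\<Prod>i\<in>UNIV. count (A + add_mset j M) i choose count (add_mset j M) i)
      = (Suc (count (A + M) j) choose Suc (count M j)) * (\<Prod>i\<in>UNIV - {j}. count (A + M) i choose count M i)"
      by (subst prod.remove[of _ j]) (auto intro!: prod.cong)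
    moreover have "(\<Prod>i\<in>UNIV. count (A + M) i choose count M i)
      = (count (A + M) j choose count M j) * (\<Prod>i\<in>UNIV - {j}. count (A + M) i choose count M i)"
      by (subst prod.remove[of _ j]) auto
    ultimately show ?thesis
      by (simp only: mult.assoc[symmetric] Suc_times_binomial) (simp only: mult_ac)
  qed
  have "mps_coeff (mps_deriv j (expand p)) M = to_fract (of_nat (Suc (count M j)) * Abs_mps (\<lambda>A.
     of_nat (\<Prod>i\<in>UNIV. count (A + add_mset j M) i choose count (add_mset j M) i) * mps_coeff p (A + add_mset j M)))"
    unfolding mps_coeff_deriv mps_coeff_expand e ..
  also have "of_nat (Suc (count M j)) * Abs_mps (\<lambda>A.
     of_nat (\<Prod>i\<in>UNIV. count (A + add_mset j M) i choose count (add_mset j M) i) * mps_coeff p (A + add_mset j M))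
    = Abs_mps (\<lambda>A. of_nat (\<Prod>i\<in>UNIV. count (A + M) i choose count M i) * mps_coeff (mps_deriv j p) (A + M))"
    unfolding mps_of_nat mps_eq_iff mps_coeff_const_mult mps_coeff_Abs mps_coeff_deriv mult.assoc[symmetric] of_nat_mult[symmetric] b
    by simp
  finally show "mps_coeff (expand (mps_deriv j p)) M = mps_coeff (mps_deriv j (expand p)) M"
    by (simp add: mps_coeff_expand)
qed

lemma expand_const: "expand (mps_const c) = mps_const (to_fract (mps_const c))"
proof (rule mps_eqI)
  fix M :: "'a multiset"
  show "mps_coeff (expand (mps_const c)) M = mps_coeff (mps_const (to_fract (mps_const c :: ('a, 'b) mps))) M"
  proof (cases "M = {#}")
    case False
    have "(Abs_mps (\<lambda>A. of_nat (\<Prod>i\<in>UNIV. count (A + M) i choose count M i) * mps_coeff (mps_const c) (A + M)) :: ('a, 'b) mps) = 0"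
      using False by (simp add: mps_eq_iff mps_coeff_const)
    with False show ?thesis by (simp add: mps_coeff_expand mps_coeff_const)
  qed (simp add: mps_coeff_const)
qed

lemma expand_0 [simp]: "expand 0 = 0" and expand_1 [simp]: "expand 1 = 1"
  using expand_const[of 0] expand_const[of 1] by simp_all

lemma expand_var:
  "expand (mps_var i :: ('n :: finite, 'k :: field_char_0) mps) = mps_const (to_fract (mps_var i)) + mps_var i"
  by (rule mps_eqI_deriv1) (auto simp: expand_deriv[symmetric] mps_deriv_var)

text \<open>Both sides obey the Leibniz rule and agree at u = 0, hence all their derivatives in
  \<open>u\<close> agree there. This avoids a convolution identity for products of
  binomials.\<close>

lemma expand_mult: "expand (p * q) = expand p * expand (q :: ('n :: finite, 'k :: field_char_0) mps)"
proof (rule mps_eqI_deriv)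
  have add: "foldr mps_deriv l (p + q) = foldr mps_deriv l p + foldr mps_deriv l q"
    for l and p q :: "('n, ('n, 'k) mps fract) mps"
    by (induction l) auto
  fix l :: "'n list"
  show "mps_coeff (foldr mps_deriv l (expand (p * q))) {#} = mps_coeff (foldr mps_deriv l (expand p * expand q)) {#}"
  proof (induction l arbitrary: p q rule: rev_induct)
    case (snoc j l)
    have 1: "mps_deriv j (expand (p * q)) = expand (mps_deriv j p * q) + expand (p * mps_deriv j q)"
      by (simp only: expand_deriv[symmetric] mps_deriv_mult expand_add)
    have 2: "mps_deriv j (expand p * expand q) = expand (mps_deriv j p) * expand q + expand p * expand (mps_deriv j q)"
      by (simp only: mps_deriv_mult expand_deriv)
    have 3: "foldr mps_deriv (l @ [j]) x = foldr mps_deriv l (mps_deriv j x)" for x :: "('n, ('n, 'k) mps fract) mps"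
      by simp
    show ?case by (simp only: 1 2 3 add mps_coeff_add snoc)
  qed (simp add: to_fract_mult)
qed

lemma ring_map_expand: "ring_map (expand :: ('n :: finite, 'k :: field_char_0) mps \<Rightarrow> _)"
  by (simp add: ring_map_def expand_add expand_mult)

section \<open>Polar forms\<close>

text \<open>The structure map \<open>\<iota>\<close> lets one form be evaluated over the constants,
  over power series, and at the generic point.\<close>

definition polar :: "('k \<Rightarrow> 'a :: comm_ring_1) \<Rightarrow> ('w :: finite \<Rightarrow> 'w \<Rightarrow> 'k) \<Rightarrow> ('w \<Rightarrow> 'a) \<Rightarrow> ('w \<Rightarrow> 'a) \<Rightarrow> 'a" where
  "polar \<iota> Q v w = (\<Sum>j\<in>UNIV. \<Sum>k\<in>UNIV. \<iota> (Q j k) * v j * w k)"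

lemma polar_commute: "(\<And>j k. Q j k = Q k j) \<Longrightarrow> polar \<iota> Q v w = polar \<iota> Q w v"
  unfolding polar_def by (subst sum.swap) (simp add: mult_ac)

lemma polar_sum_right: "polar \<iota> Q v (\<lambda>k. \<Sum>x\<in>A. c x * w x k) = (\<Sum>x\<in>A. c x * polar \<iota> Q v (w x))"
proof -
  have "polar \<iota> Q v (\<lambda>k. \<Sum>x\<in>A. c x * w x k) = (\<Sum>j\<in>UNIV. \<Sum>k\<in>UNIV. \<Sum>x\<in>A. \<iota> (Q j k) * v j * (c x * w x k))"
    by (simp add: polar_def sum_distrib_left)
  also have "\<dots> = (\<Sum>j\<in>UNIV. \<Sum>x\<in>A. \<Sum>k\<in>UNIV. \<iota> (Q j k) * v j * (c x * w x k))"
    by (intro sum.cong refl sum.swap)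
  also have "\<dots> = (\<Sum>x\<in>A. \<Sum>j\<in>UNIV. \<Sum>k\<in>UNIV. \<iota> (Q j k) * v j * (c x * w x k))"
    by (rule sum.swap)
  finally show ?thesis by (simp add: polar_def sum_distrib_left mult_ac)
qed

lemma polar_sum_left: "polar \<iota> Q (\<lambda>j. \<Sum>x\<in>A. c x * v x j) w = (\<Sum>x\<in>A. c x * polar \<iota> Q (v x) w)"
proof -
  have "polar \<iota> Q (\<lambda>j. \<Sum>x\<in>A. c x * v x j) w = (\<Sum>j\<in>UNIV. \<Sum>k\<in>UNIV. \<Sum>x\<in>A. \<iota> (Q j k) * (c x * v x j) * w k)"
    by (simp add: polar_def sum_distrib_left sum_distrib_right)
  also have "\<dots> = (\<Sum>j\<in>UNIV. \<Sum>x\<in>A. \<Sum>k\<in>UNIV. \<iota> (Q j k) * (c x * v x j) * w k)"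
    by (intro sum.cong refl sum.swap)
  also have "\<dots> = (\<Sum>x\<in>A. \<Sum>j\<in>UNIV. \<Sum>k\<in>UNIV. \<iota> (Q j k) * (c x * v x j) * w k)"
    by (rule sum.swap)
  finally show ?thesis by (simp add: polar_def sum_distrib_left mult_ac)
qed

lemma polar_add_right: "polar \<iota> Q v (\<lambda>k. w k + w' k) = polar \<iota> Q v w + polar \<iota> Q v w'"
  by (simp add: polar_def distrib_left sum.distrib)

lemma polar_add_left: "polar \<iota> Q (\<lambda>k. w k + w' k) v = polar \<iota> Q w v + polar \<iota> Q w' v"
  by (simp add: polar_def distrib_left distrib_right sum.distrib)

lemma polar_diff_right: "polar \<iota> Q v (\<lambda>k. w k - w' k) = polar \<iota> Q v w - polar \<iota> Q v w'"
  by (simp add: polar_def right_diff_distrib sum_subtractf)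

lemma polar_mult_right: "polar \<iota> Q v (\<lambda>k. c * w k) = c * polar \<iota> Q v w"
  by (simp add: polar_def sum_distrib_left mult_ac)

lemma polar_mult_left: "polar \<iota> Q (\<lambda>k. c * w k) v = c * polar \<iota> Q w v"
  by (simp add: polar_def sum_distrib_left mult_ac)

lemma polar_ring_map: "ring_map h \<Longrightarrow> h (polar \<iota> Q v w) = polar (\<lambda>c. h (\<iota> c)) Q (\<lambda>j. h (v j)) (\<lambda>k. h (w k))"
  by (simp add: polar_def ring_map_sum ring_map_mult)

lemma polar_derivation:
  assumes "derivation d" "\<And>c. d (\<iota> c) = 0"
  shows "d (polar \<iota> Q v w) = polar \<iota> Q (\<lambda>j. d (v j)) w + polar \<iota> Q v (\<lambda>k. d (w k))"
  unfolding polar_def derivation_sum[OF assms(1)] derivation_mult[OF assms(1)] assms(2) sum.distrib[symmetric]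
  by (simp add: algebra_simps)

lemma quad_map_nth:
  "quad_map a \<iota> u $ i = \<iota> (1 / 2) * polar \<iota> (a i) (($) u) (($) u)"
  by (simp add: quad_map_def polar_def)

lemma polar_form_diff: "polar mps_const (\<lambda>r s. P r s - Q r s) v w = polar mps_const P v w - polar mps_const Q v w"
  by (simp add: polar_def mps_const_diff left_diff_distrib sum_subtractf)

lemma polar_form_mult: "polar mps_const (\<lambda>r s. c * P r s) v w = mps_const c * polar mps_const P v w"
  by (simp add: polar_def mps_const_mult sum_distrib_left mult.assoc)

lemma polar_form_sum: "polar mps_const (\<lambda>r s. \<Sum>x\<in>A. P x r s) v w = (\<Sum>x\<in>A. polar mps_const (P x) v w)"
proof (induction A rule: infinite_finite_induct)
  case (insert x A)
  then show ?case by (simp add: polar_def mps_const_add distrib_right sum.distrib)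
qed (simp_all add: polar_def)

text \<open>As the \<open>\<omega> a\<close> vanish at the origin, the second-order jet of the form
  only involves their first derivatives.\<close>

lemma quadratic_form_derivatives:
  fixes \<omega> :: "'w :: finite \<Rightarrow> ('n, 'k :: field_char_0) mps"
  assumes P: "P = mps_const (1 / 2) * polar mps_const h \<omega> \<omega>"
    and \<omega>: "\<And>a. mps_coeff (\<omega> a) {#} = 0" and h: "\<And>a b. h a b = h b a"
  shows "mps_coeff P {#} = 0" "mps_coeff (mps_deriv i P) {#} = 0"
    "mps_coeff (mps_deriv i (mps_deriv j P)) {#}
      = (\<Sum>a\<in>UNIV. \<Sum>b\<in>UNIV. h a b * mps_coeff (mps_deriv i (\<omega> a)) {#} * mps_coeff (mps_deriv j (\<omega> b)) {#})"
proof -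
  have ev: "mps_coeff (polar mps_const h v w) {#} = polar (\<lambda>c. c) h (\<lambda>a. mps_coeff (v a) {#}) (\<lambda>a. mps_coeff (w a) {#})"
    for v w :: "'w \<Rightarrow> ('n, 'k) mps"
    using polar_ring_map[OF ring_map_const_term, of mps_const h v w] by simp
  have 0: "polar (\<lambda>c. c) h (\<lambda>a. 0) w = 0" "polar (\<lambda>c. c) h w (\<lambda>a. 0) = 0" for w
    by (simp_all add: polar_def)
  have d: "mps_deriv i (polar mps_const h v w) = polar mps_const h (\<lambda>a. mps_deriv i (v a)) w + polar mps_const h v (\<lambda>a. mps_deriv i (w a))"
    for i and v w :: "'w \<Rightarrow> ('n, 'k) mps"
    by (rule polar_derivation[OF derivation_mps_deriv]) simp
  show "mps_coeff P {#} = 0" "mps_coeff (mps_deriv i P) {#} = 0"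
    by (simp_all add: P d ev \<omega> 0)
  have "mps_coeff (mps_deriv i (mps_deriv j P)) {#} = 
    polar (\<lambda>c. c) h (\<lambda>a. mps_coeff (mps_deriv i (\<omega> a)) {#}) (\<lambda>a. mps_coeff (mps_deriv j (\<omega> a)) {#})"
  proof -
    have "mps_coeff (mps_deriv i (mps_deriv j P)) {#} = 1 / 2 * (
        polar (\<lambda>c. c) h (\<lambda>a. mps_coeff (mps_deriv j (\<omega> a)) {#}) (\<lambda>a. mps_coeff (mps_deriv i (\<omega> a)) {#})
      + polar (\<lambda>c. c) h (\<lambda>a. mps_coeff (mps_deriv i (\<omega> a)) {#}) (\<lambda>a. mps_coeff (mps_deriv j (\<omega> a)) {#}))"
      by (simp add: P d ev \<omega> 0)
    also have "polar (\<lambda>c. c) h (\<lambda>a. mps_coeff (mps_deriv j (\<omega> a)) {#}) (\<lambda>a. mps_coeff (mps_deriv i (\<omega> a)) {#})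
      = polar (\<lambda>c. c) h (\<lambda>a. mps_coeff (mps_deriv i (\<omega> a)) {#}) (\<lambda>a. mps_coeff (mps_deriv j (\<omega> a)) {#})"
      by (rule polar_commute[OF h])
    finally show ?thesis by simp
  qed
  then show "mps_coeff (mps_deriv i (mps_deriv j P)) {#}
      = (\<Sum>a\<in>UNIV. \<Sum>b\<in>UNIV. h a b * mps_coeff (mps_deriv i (\<omega> a)) {#} * mps_coeff (mps_deriv j (\<omega> b)) {#})"
    by (simp add: polar_def)
qed

lemma sum_delta_delta:
  "(\<Sum>a\<in>(UNIV :: 'w :: finite set). \<Sum>b\<in>(UNIV :: 'w set). c a b * (if a = i then 1 else 0) * (if b = j then 1 else 0)) = (c i j :: 'a :: comm_ring_1)"
proof -
  have "(\<Sum>b\<in>UNIV. c a b * (if a = i then 1 else 0) * (if b = j then 1 else 0)) = (if a = i then c i j else 0)" for a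
    by (subst sum.remove[of _ j]) auto
  then show ?thesis by simp
qed

lemma sum_option: "(\<Sum>r\<in>(UNIV :: 'n :: finite option set). g r) = g None + (\<Sum>i\<in>UNIV. g (Some i))"
  by (simp add: UNIV_option_conv sum.reindex)

text \<open>\<open>None\<close> stands for the radial direction of the cone and
  \<open>Some i\<close> for a direction along the chart.\<close>

definition jet :: "'n option \<Rightarrow> ('n, 'k :: comm_ring_1) mps \<Rightarrow> ('n, 'k) mps" where
  "jet r p = (case r of None \<Rightarrow> p | Some i \<Rightarrow> mps_deriv i p)"

lemma jet_simps [simp]: "jet None p = p" "jet (Some i) p = mps_deriv i p"
  by (simp_all add: jet_def)

lemma jet_sum: "jet r (\<Sum>x\<in>A. mps_const (c x) * p x) = (\<Sum>x\<in>A. mps_const (c x) * jet r (p x))"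
  by (cases r) auto

text \<open>On the cone over the quadric \<open>\<zeta>\<^sup>2 + b(\<omega>, \<omega>) / 2 = 1\<close> the density \<open>d\<omega>\<close> is that of the projective
  volume form divided by \<open>\<zeta>\<close>.\<close>

lemma homogeneous_jacobian:
  fixes w :: "'n :: finite option \<Rightarrow> ('n, 'k :: field_char_0) mps"
  assumes b: "\<And>i j. b i j = b j i"
    and quadric: "(w None)\<^sup>2 + mps_const (1 / 2) * polar mps_const b (\<lambda>i. w (Some i)) (\<lambda>i. w (Some i)) = 1"
  shows "w None * det (\<chi> s r. jet r (w s)) = det (ext_jacobian (\<lambda>i. w (Some i)))"
proof -
  define \<omega> where "\<omega> i = w (Some i)" for i
  define Z where "Z = (\<chi> s r. jet r (w s))"
  define x where "x c = (case c of None \<Rightarrow> w None | Some i \<Rightarrow> mps_const (1 / 2) * (\<Sum>j\<in>UNIV. mps_const (b i j) * \<omega> j))" for c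
  have pc: "polar mps_const b v v' = polar mps_const b v' v" for v v' :: "'n \<Rightarrow> ('n, 'k) mps"
    by (rule polar_commute[OF b])
  have pol: "(\<Sum>i\<in>UNIV. mps_const (1 / 2) * (\<Sum>j\<in>UNIV. mps_const (b i j) * \<omega> j) * v i) = mps_const (1 / 2) * polar mps_const b \<omega> v" for v
    unfolding pc[of \<omega>] by (simp add: polar_def sum_distrib_left sum_distrib_right mult_ac)
  \<comment> \<open>The combination of rows is half the differential of the quadric equation: the
    radial entry is the equation itself, with value 1, and the others are half the derivatives of
    the constant 1.\<close>
  have row: "(\<Sum>c\<in>UNIV. x c *s Z $ c) $ r = (if r = None then 1 else 0)" for r
  proof -
    have e: "(\<Sum>c\<in>UNIV. x c *s Z $ c) $ r = w None * jet r (w None) + mps_const (1 / 2) * polar mps_const b \<omega> (\<lambda>i. jet r (\<omega> i))"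
      by (simp add: sum_option x_def Z_def \<omega>_def[symmetric] pol)
    show ?thesis
    proof (cases r)
      case None
      then show ?thesis using quadric e by (simp add: \<omega>_def[abs_def] power2_eq_square)
    next
      case (Some l)
      have "mps_deriv l ((w None)\<^sup>2 + mps_const (1 / 2) * polar mps_const b \<omega> \<omega>) = 0"
        using quadric by (simp add: \<omega>_def[abs_def])
      moreover have "mps_deriv l (polar mps_const b \<omega> \<omega>) = 2 * polar mps_const b \<omega> (\<lambda>i. mps_deriv l (\<omega> i))"
        by (subst polar_derivation[OF derivation_mps_deriv]) (simp_all add: pc[of _ \<omega>])
      ultimately have "2 * (w None * mps_deriv l (w None) + mps_const (1 / 2) * polar mps_const b \<omega> (\<lambda>i. mps_deriv l (\<omega> i))) = 0"
        by (simp add: power2_eq_square mps_deriv_mult algebra_simps)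
      then have "w None * mps_deriv l (w None) + mps_const (1 / 2) * polar mps_const b \<omega> (\<lambda>i. mps_deriv l (\<omega> i)) = 0"
        by (simp only: mult_eq_0_iff) simp
      then show ?thesis using e Some by simp
    qed
  qed
  have "w None * det Z = x None * det Z" by (simp add: x_def)
  also have "\<dots> = det (\<chi> i. if i = None then (\<Sum>c\<in>UNIV. x c *s Z $ c) else Z $ i)"
    by (rule det_replace_row_combination[symmetric])
  also have "\<dots> = det (ext_jacobian \<omega>)"
    unfolding det_def
  proof (intro sum.cong refl arg_cong2[where f = "(*)"])
    \<comment> \<open>Both matrices have row \<open>None\<close> equal to (1, 0, ..., 0). They
      differ in column \<open>None\<close> below it, which a permutation reaches only by taking a
      zero in row \<open>None\<close>.\<close>
    fix p :: "'n option \<Rightarrow> 'n option" assume p: "p \<in> {p. p permutes UNIV}"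
    define M where "M = (\<chi> i. if i = None then (\<Sum>c\<in>UNIV. x c *s Z $ c) else Z $ i)"
    have MN: "M $ None $ r = (if r = None then 1 else 0)" for r
      unfolding M_def vec_lambda_beta if_P[OF refl] by (rule row)
    show "(\<Prod>i\<in>UNIV. M $ i $ p i) = (\<Prod>i\<in>UNIV. ext_jacobian \<omega> $ i $ p i)"
    proof (cases "p None = None")
      case True
      then have "p (Some i) \<noteq> None" for i
        using p by (metis mem_Collect_eq option.distinct(1) permutes_def)
      then show ?thesis
      proof (intro prod.cong refl)
        fix i :: "'n option"
        show "M $ i $ p i = ext_jacobian \<omega> $ i $ p i"
        proof (cases i)
          case (Some j)
          then obtain l where "p i = Some l" using \<open>\<And>i. p (Some i) \<noteq> None\<close> by blast
          then show ?thesis using Some by (simp add: M_def ext_jacobian_def Z_def \<omega>_def)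
        qed (use True in \<open>simp add: MN ext_jacobian_def\<close>)
      qed
    next
      case False
      then have "M $ None $ p None = 0" "ext_jacobian \<omega> $ None $ p None = 0"
        by (simp_all add: MN ext_jacobian_def)
      then show ?thesis by (simp add: prod.remove[of UNIV None])
    qed
  qed
  finally show ?thesis by (simp add: Z_def \<omega>_def[abs_def])
qed

section \<open>Cones with a quadratic parametrization\<close>

text \<open>\<open>u\<close> is the section of the parametrization over the chart, normalized by \<open>y\<^sub>0 = 1\<close>.\<close>

locale quadratic_chart =
  fixes q :: "'n :: finite option option \<Rightarrow> 'n option \<Rightarrow> 'n option \<Rightarrow> 'k :: field_char_0"
    and \<tau> :: "'n \<Rightarrow> 'k" and u :: "'n option \<Rightarrow> ('n, 'k) mps"
  assumes q_sym: "q m j l = q m l j"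
    and chart_0: "mps_const (1 / 2) * polar mps_const (q (Some None)) u u = 1"
    and chart_Some: "mps_const (1 / 2) * polar mps_const (q (Some (Some i))) u u = mps_const (\<tau> i) + mps_var i"
begin

definition f where "f = mps_const (1 / 2) * polar mps_const (q None) u u"

definition frame :: "'n option \<Rightarrow> 'n option \<Rightarrow> ('n, 'k) mps" where
  "frame r j = (case r of None \<Rightarrow> u j | Some i \<Rightarrow> mps_deriv i (u j))"

definition frame_det where "frame_det = det (\<chi> j r. frame r j)"

text \<open>This is the linear form divided by the Jacobian of
  \<open>y\<^sub>0, ..., y\<^sub>n\<close> along the section: by \<open>jacobian_frame_det\<close>
  the inverse of that Jacobian is half of \<open>frame_det\<close>, which is a power series.\<close>

definition density :: "('n option \<Rightarrow> 'k) \<Rightarrow> ('n, 'k) mps" where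
  "density c = mps_const (1 / 2) * (\<Sum>j\<in>UNIV. mps_const (c j) * u j) * frame_det"

abbreviation Y :: "'n option option \<Rightarrow> ('n option \<Rightarrow> ('n, 'k) mps) \<Rightarrow> ('n option \<Rightarrow> ('n, 'k) mps) \<Rightarrow> ('n, 'k) mps" where
  "Y i \<equiv> polar mps_const (q i)"

definition y :: "'n option option \<Rightarrow> ('n, 'k) mps" where
  "y i = (case i of None \<Rightarrow> f | Some None \<Rightarrow> 1 | Some (Some i) \<Rightarrow> mps_const (\<tau> i) + mps_var i)"

lemma y_eq: "y i = mps_const (1 / 2) * Y i u u"
  by (auto simp: y_def f_def chart_0 chart_Some split: option.splits)

lemma Y_self: "Y i u u = 2 * y i"
  by (simp add: y_eq mult.assoc[symmetric] mps_numeral mps_const_mult[symmetric])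

lemma Y_deriv: "Y i u (\<lambda>j. mps_deriv l (u j)) = mps_deriv l (y i)"
proof -
  have "mps_deriv l (Y i u u) = 2 * Y i u (\<lambda>j. mps_deriv l (u j))"
    by (subst polar_derivation[OF derivation_mps_deriv])
       (auto simp: polar_commute[of "q i" mps_const u] q_sym)
  then show ?thesis unfolding Y_self
    by (simp add: mps_deriv_mult mps_numeral)
       (metis mps_const_eq_iff mps_const_0 mult_cancel_left zero_neq_numeral)
qed

lemma Y_frame: "Y i u (frame r) = (case r of None \<Rightarrow> 2 * y i | Some l \<Rightarrow> mps_deriv l (y i))"
  by (cases r) (auto simp: frame_def[abs_def] Y_self Y_deriv)

text \<open>On the frame, the differential of the \<open>y\<^sub>i\<close> takes \<open>u\<close> to
  \<open>2 * y\<close> by Euler's relation for degree 2, and the derivatives of \<open>u\<close> to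
  unit vectors. Only the entry \<open>2 * y (Some None) = 2\<close> contributes to the
  determinant.\<close>

lemma jacobian_frame_det:
  "det (\<chi> i k. \<Sum>j\<in>UNIV. mps_const (q (Some i) j k) * u j) * frame_det = 2"
proof -
  define v :: "('n, 'k) mps ^ 'n option" where "v = (\<chi> i. 2 * y (Some i))"
  have v_eq: "v = (\<Sum>i\<in>UNIV. (2 * y (Some i)) *s (mat 1 :: ('n, 'k) mps ^ 'n option ^ 'n option) $ i)"
    by (simp add: v_def vec_eq_iff mat_def if_distrib cong: if_cong)
  have "(\<chi> i k. \<Sum>j\<in>UNIV. mps_const (q (Some i) j k) * u j) ** (\<chi> j r. frame r j) = (\<chi> i r. Y (Some i) u (frame r))"
  proof -
    have "(\<Sum>k\<in>UNIV. (\<Sum>j\<in>UNIV. mps_const (q (Some i) j k) * u j) * frame r k) = Y (Some i) u (frame r)" for i r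
      unfolding polar_def sum_distrib_right by (rule sum.swap)
    then show ?thesis by (simp add: matrix_matrix_mult_def vec_eq_iff)
  qed
  then have "det (\<chi> i k. \<Sum>j\<in>UNIV. mps_const (q (Some i) j k) * u j) * frame_det = det (\<chi> i r. Y (Some i) u (frame r))"
    by (simp only: det_mul[symmetric] frame_det_def)
  also have "(\<chi> i r. Y (Some i) u (frame r)) = transpose (\<chi> r. if r = None then v else mat 1 $ r)"
  proof -
    have "Y (Some i) u (frame r) = (if r = None then v else mat 1 $ r) $ i" for i r
      by (cases i; cases r) (simp_all add: Y_frame mat_def y_def v_def mps_deriv_var)
    then show ?thesis by (simp add: vec_eq_iff transpose_def)
  qed
  also have "det \<dots> = 2 * y (Some None) * det (mat 1 :: ('n, 'k) mps ^ 'n option ^ 'n option)"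
    unfolding det_transpose v_eq by (rule det_replace_row_combination)
  also have "\<dots> = 2" by (simp add: y_def)
  finally show ?thesis .
qed

lemma frame_det_nonzero: "frame_det \<noteq> 0"
  using jacobian_frame_det by auto


section \<open>Vanishing of the expansion coefficients for linear densities\<close>

lemma to_fract_const_half: "to_fract (mps_const (1 / 2) :: ('n, 'k) mps) = 1 / 2"
proof -
  have "2 * to_fract (mps_const (1 / 2) :: ('n, 'k) mps) = to_fract (2 * mps_const (1 / 2))"
    by (simp add: to_fract_mult to_fract_numeral)
  also have "2 * mps_const (1 / 2) = (1 :: ('n, 'k) mps)"
    by (simp add: mps_numeral mps_const_mult[symmetric])
  finally show ?thesis by (simp add: field_simps)
qed

lemma jet_expand: "jet r (expand p) = expand (jet r p)"
  by (cases r) (auto simp: expand_deriv)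

lemma frame_jet: "frame r j = jet r (u j)"
  by (simp add: frame_def jet_def)

lemma Y_commute: "Y m v w = Y m w v"
  by (rule polar_commute) (rule q_sym)

theorem stat_phase_coeff_density:
  assumes det_hessian: "det (hessian f) \<noteq> 0" and k: "k \<ge> 1"
  shows "stat_phase_coeff f (density c) k = 0"
proof -
  define H where "H i j = to_fract (mps_deriv i (mps_deriv j f))" for i j
  define Hm where "Hm = (\<chi> i j. to_fract (hessian f $ i $ j))"
  define G where "G i j = inv_hessian f $ i $ j" for i j
  have Hm_H: "Hm $ i $ j = H i j" for i j by (simp add: Hm_def hessian_def H_def)
  have "det Hm = to_fract (det (hessian f))"
    unfolding Hm_def by (rule ring_map_det[OF ring_map_to_fract, symmetric])
  then have invH: "invertible Hm" using det_hessian by (simp add: invertible_det_nz)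
  have HG: "Hm ** inv_hessian f = mat 1" "inv_hessian f ** Hm = mat 1"
    using matrix_inv_mult[OF invH] by (simp_all add: inv_hessian_def Hm_def)
  have H_sym: "H i j = H j i" for i j
    by (simp add: H_def mps_deriv_commute)
  have "transpose Hm = Hm" by (simp add: vec_eq_iff transpose_def Hm_H H_sym)
  then have "transpose (inv_hessian f) ** Hm = mat 1"
    using HG(1) by (metis matrix_transpose_mul transpose_mat)
  then have "transpose (inv_hessian f) = inv_hessian f"
    using HG by (metis matrix_mul_assoc matrix_mul_lid matrix_mul_rid)
  then have G_sym: "G i j = G j i" for i j
    using arg_cong[of "transpose (inv_hessian f)" _ "\<lambda>M. M $ i $ j"] by (simp add: transpose_def G_def)
  have H_G: "(\<Sum>j\<in>UNIV. H i j * G j l) = (if i = l then 1 else 0)" for i l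
    using arg_cong[OF HG(1), of "\<lambda>M. M $ i $ l"] by (simp add: matrix_matrix_mult_def Hm_H G_def mat_def)
  have G_H: "(\<Sum>j\<in>UNIV. G i j * H j l) = (if i = l then 1 else 0)" for i l
    using arg_cong[OF HG(2), of "\<lambda>M. M $ i $ l"] by (simp add: matrix_matrix_mult_def Hm_H G_def mat_def)

  \<comment> \<open>The frame at the generic point, as a matrix over the fraction field. The
    coordinates of the expanded section in it are \<open>w\<close>: \<open>w None\<close> is the
    \<open>\<zeta>\<close> of the overview and \<open>w (Some i)\<close> is its
    \<open>\<omega>\<^sub>i\<close>.\<close>
  define B where "B = (\<chi> j r. to_fract (frame r j))"
  have detB: "det B = to_fract frame_det"
    using ring_map_det[OF ring_map_to_fract, of "\<chi> j r. frame r j"] by (simp add: B_def frame_det_def)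
  then have invB: "invertible B" using frame_det_nonzero by (simp add: invertible_det_nz)
  define Bi where "Bi = matrix_inv B"
  have BBi: "B ** Bi = mat 1" "Bi ** B = mat 1" using matrix_inv_mult[OF invB] by (simp_all add: Bi_def)
  define w where "w r = (\<Sum>j\<in>UNIV. mps_const (Bi $ r $ j) * expand (u j))" for r
  have U_eq: "expand (u j) = (\<Sum>r\<in>UNIV. w r * mps_const (B $ j $ r))" for j
  proof -
    have "(\<Sum>r\<in>UNIV. w r * mps_const (B $ j $ r)) = (\<Sum>l\<in>UNIV. (\<Sum>r\<in>UNIV. mps_const (B $ j $ r * Bi $ r $ l)) * expand (u l))"
      unfolding w_def sum_distrib_right by (subst sum.swap) (simp add: mps_const_mult mult_ac)
    also have "\<dots> = (\<Sum>l\<in>UNIV. mps_const ((B ** Bi) $ j $ l) * expand (u l))"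
      by (simp add: matrix_matrix_mult_def mps_const_sum)
    also have "\<dots> = expand (u j)"
      by (simp add: BBi mat_def if_distrib if_distribR cong: if_cong)
    finally show ?thesis by simp
  qed
  have jet_w: "mps_coeff (jet s (w r)) {#} = (if r = s then 1 else 0)" for r s
  proof -
    have "mps_coeff (jet s (w r)) {#} = (Bi ** B) $ r $ s"
      by (simp add: w_def jet_sum jet_expand frame_jet B_def matrix_matrix_mult_def)
    then show ?thesis by (simp add: BBi mat_def)
  qed
  \<comment> \<open>Gram matrices of the forms in this frame. Their row \<open>None\<close> is read
    off from \<open>Y_frame\<close>; for \<open>y\<^sub>0\<close> it is (2, 0, ..., 0) because
    \<open>y\<^sub>0 = 1\<close> has no derivatives.\<close>
  define b where "b m r s = to_fract (Y m (frame r) (frame s))" for m r s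
  have b_sym: "b m r s = b m s r" for m r s by (simp add: b_def Y_commute)
  have b_None: "b m None r = to_fract (case r of None \<Rightarrow> 2 * y m | Some l \<Rightarrow> mps_deriv l (y m))" for m r
  proof -
    have "frame None = u" by (simp add: frame_def fun_eq_iff)
    then show ?thesis by (simp add: b_def Y_frame)
  qed
  have expand_y: "expand (y m) = mps_const (1 / 2) * polar mps_const (b m) w w" for m
  proof -
    define \<iota> :: "'k \<Rightarrow> ('n, ('n, 'k) mps fract) mps" where "\<iota> c = mps_const (to_fract (mps_const c))" for c
    have pb: "polar \<iota> (q m) (\<lambda>j. mps_const (B $ j $ r)) (\<lambda>j. mps_const (B $ j $ s)) = mps_const (b m r s)" for r s
      by (simp add: polar_ring_map[OF ring_map_comp[OF ring_map_mps_const ring_map_to_fract]] \<iota>_def[abs_def] B_def b_def)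
    have "expand (Y m u u) = polar (\<lambda>c. expand (mps_const c)) (q m) (\<lambda>j. expand (u j)) (\<lambda>j. expand (u j))"
      by (rule polar_ring_map[OF ring_map_expand])
    also have "\<dots> = polar \<iota> (q m) (\<lambda>j. \<Sum>r\<in>UNIV. w r * mps_const (B $ j $ r)) (\<lambda>j. \<Sum>r\<in>UNIV. w r * mps_const (B $ j $ r))"
      by (simp add: expand_const \<iota>_def[abs_def] U_eq)
    also have "\<dots> = (\<Sum>r\<in>UNIV. w r * (\<Sum>s\<in>UNIV. w s * mps_const (b m r s)))"
      by (simp only: polar_sum_left polar_sum_right pb)
    also have "\<dots> = polar mps_const (b m) w w"
      by (simp add: polar_def sum_distrib_left mult_ac)
    finally show ?thesis
      by (simp add: y_eq expand_mult expand_const to_fract_const_half)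
  qed
  define \<omega> where "\<omega> i = w (Some i)" for i
  have polar_w: "polar mps_const P w w = mps_const (P None None) * (w None)\<^sup>2
      + polar mps_const (\<lambda>i j. P (Some i) (Some j)) \<omega> \<omega>"
    if "\<And>i. P None (Some i) = 0" "\<And>r s. P r s = P s r" for P
  proof -
    have "P (Some i) None = 0" for i using that by metis
    then show ?thesis
      by (simp add: polar_def sum_option \<omega>_def that(1) power2_eq_square mult.assoc)
  qed
  define b0 where "b0 i j = b (Some None) (Some i) (Some j)" for i j
  have two: "(2 :: ('n, 'k) mps fract) = to_fract 2"
    by (simp add: to_fract_numeral)
  have quadric: "(w None)\<^sup>2 + mps_const (1 / 2) * polar mps_const b0 \<omega> \<omega> = 1"
  proof -
    have "polar mps_const (b (Some None)) w w = mps_const 2 * (w None)\<^sup>2 + polar mps_const b0 \<omega> \<omega>"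
      by (subst polar_w) (auto simp: b_None y_def b0_def[abs_def] b_sym two)
    moreover have "mps_const (1 / 2) * polar mps_const (b (Some None)) w w = 1"
      using expand_y[of "Some None"] by (simp add: y_def)
    ultimately show ?thesis
      by (simp add: distrib_left mult.assoc[symmetric] mps_const_mult[symmetric])
  qed

  define \<phi> where "\<phi> = expand f - mps_const (to_fract f) - (\<Sum>i\<in>UNIV. mps_const (to_fract (mps_deriv i f)) * mps_var i)"
  \<comment> \<open>The Gram matrix of \<open>Q\<close>: the phase is the combination of the
    \<open>y\<^sub>m\<close> at \<open>t + v\<close> with these coefficients, in which
    \<open>y\<^sub>0 = 1\<close> makes the constants quadratic as well.\<close>
  define h where "h r s = b None r s - to_fract f * b (Some None) r s
      - (\<Sum>i\<in>UNIV. to_fract (mps_deriv i f) * (b (Some (Some i)) r s - to_fract (y (Some (Some i))) * b (Some None) r s))" for r s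
  have h_sym: "h r s = h s r" for r s by (simp add: h_def b_sym)
  have h_None: "h None r = 0" for r
  proof (cases r)
    case None
    then show ?thesis by (simp add: h_def b_None y_def two[symmetric] to_fract_mult)
  next
    case (Some l)
    have "(\<Sum>i\<in>UNIV. to_fract (mps_deriv i f) * to_fract (if l = i then 1 else 0)) = to_fract (mps_deriv l f)"
      by (simp add: if_distrib cong: if_cong)
    then show ?thesis using Some by (simp add: h_def b_None y_def mps_deriv_var)
  qed
  have \<phi>_eq: "\<phi> = mps_const (1 / 2) * polar mps_const (\<lambda>i j. h (Some i) (Some j)) \<omega> \<omega>"
  proof -
    have fN: "mps_const (1 / 2) * polar mps_const (b None) w w = expand f"
      by (simp add: expand_y[symmetric] y_def)
    have "mps_const (1 / 2) * polar mps_const h w w = expand f - mps_const (to_fract f) * expand (y (Some None))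
      - (\<Sum>i\<in>UNIV. mps_const (to_fract (mps_deriv i f)) * (expand (y (Some (Some i))) - mps_const (to_fract (y (Some (Some i)))) * expand (y (Some None))))"
      unfolding fN[symmetric] expand_y h_def[abs_def] polar_form_diff polar_form_sum polar_form_mult
      by (simp add: y_def right_diff_distrib sum_distrib_left mult.left_commute)
    also have "\<dots> = \<phi>"
      by (simp add: \<phi>_def y_def expand_add expand_const expand_var to_fract_add mps_const_add)
    finally have "\<phi> = mps_const (1 / 2) * polar mps_const h w w" ..
    then show ?thesis by (subst (asm) polar_w) (simp_all add: h_None h_sym)
  qed
  have \<omega>_0: "mps_coeff (\<omega> a) {#} = 0" for a using jet_w[of None "Some a"] by (simp add: \<omega>_def)
  have d\<omega>: "mps_coeff (mps_deriv i (\<omega> a)) {#} = (if a = i then 1 else 0)" for i a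
    using jet_w[of "Some i" "Some a"] by (simp add: \<omega>_def)
  note d\<phi> = quadratic_form_derivatives[OF \<phi>_eq \<omega>_0 h_sym]
  \<comment> \<open>The \<open>\<omega> i\<close> agree with the variables to first order, so
    comparing second derivatives at the origin identifies the restricted form with the
    Hessian.\<close>
  have h_H: "h (Some i) (Some j) = H i j" for i j
  proof -
    have "mps_deriv i (mps_deriv j \<phi>) = expand (mps_deriv i (mps_deriv j f))"
      by (simp add: \<phi>_def expand_deriv mps_deriv_var if_distrib cong: if_cong)
    then have "H i j = mps_coeff (mps_deriv i (mps_deriv j \<phi>)) {#}" by (simp add: H_def)
    also have "\<dots> = h (Some i) (Some j)"
      unfolding d\<phi>(3) d\<omega> sum_delta_delta ..
    finally show ?thesis by simp
  qed
  define \<psi> where "\<psi> = mps_const (1 / 2) * polar mps_const H mps_var mps_var"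
  note d\<psi> = quadratic_form_derivatives[OF \<psi>_def mps_coeff_var_empty H_sym]
  have R_eq: "remainder f = \<phi> - \<psi>"
    by (simp add: remainder_def \<phi>_def \<psi>_def polar_def H_def hessian_def)
  have R_order: "mps_order_ge 3 (remainder f)"
  proof -
    have 0: "mps_coeff (remainder f) {#} = 0" "mps_coeff (mps_deriv i (remainder f)) {#} = 0" for i
      by (simp_all add: R_eq d\<phi>(1,2) d\<psi>(1,2))
    have "mps_coeff (mps_deriv i (mps_deriv j (remainder f))) {#} = 0" for i j
    proof -
      have "mps_coeff (mps_deriv i (mps_var a :: ('n, ('n, 'k) mps fract) mps)) {#} = (if a = i then 1 else 0)" for i a
        by (simp add: mps_deriv_var)
      then show ?thesis
        unfolding R_eq mps_deriv_diff mps_coeff_diff d\<phi>(3) d\<psi>(3) d\<omega> by (simp only: sum_delta_delta h_H diff_self)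
    qed
    then show ?thesis
      using 0 unfolding eval_nat_numeral by (intro mps_order_ge_SucI) (auto simp: mps_order_ge_Suc_0)
  qed
  interpret stationary_phase H G "remainder f"
    by unfold_locales (fact H_sym G_sym H_G G_H R_order)+
  have phase: "phase = \<phi>"
  proof -
    have "(\<Sum>i\<in>UNIV. mps_var i * Hv i) = polar mps_const H mps_var mps_var"
      by (simp add: polar_def Hv_def sum_distrib_left mult_ac)
    then show ?thesis unfolding phase_def by (simp add: R_eq \<psi>_def)
  qed
  interpret morse_coordinates H G "remainder f" \<omega>
    by unfold_locales (simp_all add: \<omega>_0 phase \<phi>_eq h_H polar_def)
  have stat: "stat_phase_coeff f g k = A k (expand g)" for g
  proof -
    have "Lap f = \<Delta>" by (rule ext) (simp add: Lap_def laplace_def G_def)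
    then show ?thesis by (simp add: stat_phase_coeff_def phase_coeff_def)
  qed

  \<comment> \<open>The factor 1/2 comes from \<open>density\<close>, and \<open>det B\<close> from
    passing to the coordinates \<open>w\<close>.\<close>
  define \<kappa> where "\<kappa> = 1 / 2 * det B"
  define g where "g r = (\<Sum>j\<in>UNIV. to_fract (mps_const (c j)) * B $ j $ r)" for r
  have "expand frame_det = det (\<chi> j r. expand (frame r j))"
    by (simp add: frame_det_def ring_map_det[OF ring_map_expand])
  also have "(\<chi> j r. expand (frame r j)) = (\<chi> j s. mps_const (B $ j $ s)) ** (\<chi> s r. jet r (w s))"
  proof -
    have "expand (frame r j) = (\<Sum>s\<in>UNIV. mps_const (B $ j $ s) * jet r (w s))" for j r
      unfolding frame_jet jet_expand[symmetric] U_eq by (simp only: mult.commute[of "w _"] jet_sum)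
    then show ?thesis by (simp add: vec_eq_iff matrix_matrix_mult_def)
  qed
  also have "det \<dots> = mps_const (det B) * det (\<chi> s r. jet r (w s))"
    by (simp add: det_mul ring_map_det[OF ring_map_mps_const])
  finally have expand_det: "expand frame_det = mps_const (det B) * det (\<chi> s r. jet r (w s))" .
  have "w None * det (\<chi> s r. jet r (w s)) = J"
  proof -
    have \<omega>_eq: "(\<lambda>i. w (Some i)) = \<omega>" by (simp add: \<omega>_def fun_eq_iff)
    have "w None * det (\<chi> s r. jet r (w s)) = det (ext_jacobian (\<lambda>i. w (Some i)))"
      by (rule homogeneous_jacobian[where b = b0]) (use quadric b_sym in \<open>simp_all add: b0_def \<omega>_eq\<close>)
    then show ?thesis unfolding J_def \<omega>_eq .
  qed
  then have 1: "w None * expand frame_det = mps_const (det B) * J"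
    by (simp add: expand_det mult.left_commute)
  have 2: "(\<Sum>j\<in>UNIV. expand (mps_const (c j)) * expand (u j)) = (\<Sum>r\<in>UNIV. mps_const (g r) * w r)"
    unfolding U_eq expand_const g_def mps_const_sum sum_distrib_left sum_distrib_right
    by (subst sum.swap) (simp add: mps_const_mult mult_ac)
  define \<gamma> where "\<gamma> = expand (density c)"
  have "\<gamma> = mps_const (1 / 2) * (\<Sum>r\<in>UNIV. mps_const (g r) * w r) * expand frame_det"
    by (simp add: \<gamma>_def density_def expand_mult ring_map_sum[OF ring_map_expand] 2[symmetric])
       (simp add: expand_const to_fract_const_half)
  then have "w None * \<gamma> = mps_const (1 / 2) * (\<Sum>r\<in>UNIV. mps_const (g r) * w r) * (w None * expand frame_det)"
    by (simp only: mult_ac)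
  also have "\<dots> = mps_const \<kappa> * (\<Sum>r\<in>UNIV. mps_const (g r) * w r) * J"
    unfolding 1 \<kappa>_def mps_const_mult by (simp only: mult_ac)
  finally have \<gamma>: "w None * \<gamma> = mps_const \<kappa> * (\<Sum>r\<in>UNIV. mps_const (g r) * w r) * J" .
  \<comment> \<open>Multiplying by \<open>w None\<close> leaves only the odd part of the linear
    form; the subtracted part is a multiple of \<open>J\<close>, which is handled by
    \<open>phase_coeff_J\<close>.\<close>
  have "A k (\<gamma> - mps_const (\<kappa> * g None) * J) = 0"
  proof (rule phase_coeff_odd_density[of "w None" _ "\<lambda>i. \<kappa> * g (Some i)"])
    show "mps_coeff (w None) {#} = 1" using jet_w[of None None] by simp
    have "(w None)\<^sup>2 = 1 - mps_const (1 / 2) * polar mps_const b0 \<omega> \<omega>"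
      using quadric by (simp add: algebra_simps)
    moreover have b0: "mps_const (b0 i j) * \<omega> i * \<omega> j \<in> even_polys" for i j
      using even_polys_monom[of "{#i, j#}" "b0 i j"] by (simp add: mult.assoc)
    moreover have "1 - mps_const (1 / 2) * polar mps_const b0 \<omega> \<omega> \<in> even_polys"
      unfolding polar_def mps_const_1[symmetric]
      by (intro even_polys_diff even_polys_mult[OF even_polys_const] even_polys_const even_polys_sum b0)
    ultimately show "(w None)\<^sup>2 \<in> even_polys" by simp
    show "w None * (\<gamma> - mps_const (\<kappa> * g None) * J) = (\<Sum>i\<in>UNIV. mps_const (\<kappa> * g (Some i)) * \<omega> i) * J"
      unfolding right_diff_distrib \<gamma> sum_option \<omega>_def mps_const_mult
      by (simp add: distrib_left distrib_right sum_distrib_left sum_distrib_right mult_ac)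
  qed
  then have "A k \<gamma> = A k (mps_const (\<kappa> * g None) * J)" by (simp add: phase_coeff_diff)
  also have "\<dots> = 0" by (simp add: phase_coeff_const_mult phase_coeff_J[OF k])
  finally show ?thesis by (simp add: stat \<gamma>_def)
qed

end

section \<open>Quadratic systems of equations for power series\<close>

lemma mps_eqI_order:
  assumes "\<And>m. mps_order_ge m (p - q :: ('v, 'k :: ab_group_add) mps)"
  shows "p = q"
proof (rule mps_eqI)
  fix M :: "'v multiset"
  show "mps_coeff p M = mps_coeff q M"
    using assms[of "Suc (size M)"] by (simp add: mps_order_ge_def)
qed

lemma mps_order_ge_diff: "mps_order_ge m p \<Longrightarrow> mps_order_ge m q \<Longrightarrow> mps_order_ge m (p - q :: ('v, 'k :: ab_group_add) mps)"
  by (auto simp: mps_order_ge_def)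

lemma mps_order_ge_polar:
  assumes "\<And>j. mps_order_ge m (v j)" "\<And>j. mps_order_ge l (w j)"
  shows "mps_order_ge (m + l) (polar mps_const Q v w)"
  unfolding polar_def mult.assoc
  by (intro mps_order_ge_sum mps_order_ge_mult_left mps_order_ge_mult assms)

text \<open>Since all iterates vanish at the origin, a quadratic expression in them improves the
  order of a difference by one, so the iteration from 0 stabilizes in every degree.\<close>

lemma quadratic_fixpoint:
  fixes Q :: "'w :: finite \<Rightarrow> 'w \<Rightarrow> 'w \<Rightarrow> 'k :: comm_ring_1" and N :: "'w \<Rightarrow> ('v, 'k) mps"
  assumes N: "\<And>i. mps_coeff (N i) {#} = 0"
  shows "\<exists>U. (\<forall>i. mps_coeff (U i) {#} = 0) \<and> (\<forall>i. U i = N i + polar mps_const (Q i) U U)"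
proof -
  define step where "step U i = N i + polar mps_const (Q i) U U" for U i
  define it where "it m = (step ^^ m) (\<lambda>_. 0)" for m
  have it_Suc: "it (Suc m) i = N i + polar mps_const (Q i) (it m) (it m)" for m i
    by (simp add: it_def step_def)
  have it_0: "it 0 i = 0" for i by (simp add: it_def)
  have it1: "mps_order_ge (Suc 0) (it m i)" for m i
  proof (induction m arbitrary: i)
    case (Suc m)
    have "mps_order_ge (Suc 0 + Suc 0) (polar mps_const (Q i) (it m) (it m))"
      by (intro mps_order_ge_polar Suc)
    then have "mps_order_ge (Suc 0) (polar mps_const (Q i) (it m) (it m))"
      by (rule mps_order_ge_mono) simp
    then show ?case unfolding it_Suc by (intro mps_order_ge_add) (simp_all add: N mps_order_ge_Suc_0)
  qed (simp add: it_0)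
  have quad: "mps_order_ge (Suc m) (polar mps_const (Q i) v v - polar mps_const (Q i) w w)"
    if "\<And>j. mps_order_ge m (v j - w j)" "\<And>j. mps_order_ge (Suc 0) (v j)" "\<And>j. mps_order_ge (Suc 0) (w j)"
    for m i and v w :: "'w \<Rightarrow> ('v, 'k) mps"
  proof -
    have "polar mps_const (Q i) v v - polar mps_const (Q i) w w
      = polar mps_const (Q i) (\<lambda>j. v j - w j) v + polar mps_const (Q i) w (\<lambda>j. v j - w j)"
      using polar_add_left[of mps_const "Q i" "\<lambda>j. v j - w j" w v]
      by (simp add: polar_diff_right)
    moreover have "mps_order_ge (m + Suc 0) (polar mps_const (Q i) (\<lambda>j. v j - w j) v)"
      "mps_order_ge (Suc 0 + m) (polar mps_const (Q i) w (\<lambda>j. v j - w j))"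
      by (intro mps_order_ge_polar that)+
    ultimately show ?thesis by (simp add: mps_order_ge_add)
  qed
  have it_diff: "mps_order_ge (Suc m) (it (Suc m) i - it m i)" for m i
  proof (induction m arbitrary: i)
    case 0
    show ?case using mps_order_ge_diff[OF it1[of "Suc 0"] it1[of 0]] by simp
  next
    case (Suc m)
    show ?case
      unfolding it_Suc[of "Suc m"] it_Suc[of m i] add_diff_cancel_left
      by (intro quad Suc it1)
  qed
  have it_stable: "mps_order_ge (Suc m) (it (m + l) i - it m i)" for m l i
  proof (induction l)
    case (Suc l)
    have "mps_order_ge (Suc m) (it (Suc (m + l)) i - it (m + l) i)"
      by (rule mps_order_ge_mono[OF it_diff]) simp
    from mps_order_ge_add[OF this Suc] show ?case by simp
  qed simp
  \<comment> \<open>The coefficient at \<open>M\<close> no longer changes from iteration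
    \<open>size M\<close> on.\<close>
  define U where "U i = Abs_mps (\<lambda>M. mps_coeff (it (size M) i) M)" for i
  have U_it: "mps_order_ge (Suc m) (U i - it m i)" for m i
    unfolding mps_order_ge_def
  proof (intro allI impI)
    fix M :: "'v multiset" assume "size M < Suc m"
    then obtain l where "m = size M + l" by (metis less_Suc_eq_le le_iff_add)
    then show "mps_coeff (U i - it m i) M = 0"
      using it_stable[of "size M" l i] by (simp add: U_def mps_order_ge_def)
  qed
  have U1: "mps_order_ge (Suc 0) (U i)" for i using U_it[of 0 i] by (simp add: it_0)
  have "U i = N i + polar mps_const (Q i) U U" for i
  proof (rule mps_eqI_order)
    fix m
    have "mps_order_ge m (U i - it (Suc m) i)" 
      by (rule mps_order_ge_mono[OF U_it]) simp
    moreover have "mps_order_ge m (polar mps_const (Q i) U U - polar mps_const (Q i) (it m) (it m))"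
      by (rule mps_order_ge_mono[OF quad[of "Suc m"]]) (simp_all add: U_it U1 it1)
    ultimately have "mps_order_ge m ((U i - it (Suc m) i) - (polar mps_const (Q i) U U - polar mps_const (Q i) (it m) (it m)))"
      by (rule mps_order_ge_diff)
    then show "mps_order_ge m (U i - (N i + polar mps_const (Q i) U U))"
      by (simp add: it_Suc algebra_simps)
  qed
  with U1 show ?thesis by (metis mps_order_ge_Suc_0)
qed

text \<open>After scaling to \<open>1 - Z\<close>, the geometric series minus 1 solves
  \<open>U = Z + Z * U\<close>.\<close>

lemma mps_unit:
  fixes p :: "('v, 'k :: field) mps"
  assumes "mps_coeff p {#} \<noteq> 0"
  obtains p' where "p * p' = 1"
proof -
  define c where "c = mps_coeff p {#}"
  define Z where "Z = 1 - mps_const (1 / c) * p"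
  have Z: "mps_coeff Z {#} = 0" using assms by (simp add: Z_def c_def)
  \<comment> \<open>The fixpoint lemma has constant coefficients, so the series \<open>Z\<close> is
    carried as the unknown \<open>False\<close>, and \<open>True\<close> is the solution
    proper.\<close>
  define Q :: "bool \<Rightarrow> bool \<Rightarrow> bool \<Rightarrow> 'k" where "Q i j k = (if i \<and> \<not> j \<and> k then 1 else 0)" for i j k
  obtain U where U: "\<And>i. U i = Z + polar mps_const (Q i) U U"
    using quadratic_fixpoint[of "\<lambda>_. Z" Q] Z by metis
  have "U False = Z" using U[of False] by (simp add: polar_def Q_def)
  moreover have "U True = Z + U False * U True" using U[of True] by (simp add: polar_def Q_def UNIV_bool)
  ultimately have "(1 - Z) * (1 + U True) = 1" by (simp add: algebra_simps)
  then have "p * (mps_const (1 / c) * (1 + U True)) = 1" by (simp add: Z_def mult_ac)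
  then show ?thesis by (rule that)
qed

text \<open>With \<open>s = c + V\<close>, the equation \<open>s\<^sup>2 = p\<close> becomes the
  fixpoint equation \<open>V = (p - c\<^sup>2) / (2 * c) - V\<^sup>2 / (2 * c)\<close>.\<close>

lemma mps_sqrt:
  fixes p :: "('v, 'k :: field_char_0) mps"
  assumes "mps_coeff p {#} = c\<^sup>2" "c \<noteq> 0"
  obtains s where "s\<^sup>2 = p" "mps_coeff s {#} = c"
proof -
  have N0: "mps_coeff (mps_const (1 / (2 * c)) * (p - mps_const (c\<^sup>2))) {#} = 0"
    using assms by simp
  obtain U :: "unit \<Rightarrow> ('v, 'k) mps" where U: "\<And>i. mps_coeff (U i) {#} = 0"
      "\<And>i. U i = mps_const (1 / (2 * c)) * (p - mps_const (c\<^sup>2)) + polar mps_const (\<lambda>_ _. - 1 / (2 * c)) U U"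
    using quadratic_fixpoint[of "\<lambda>_. mps_const (1 / (2 * c)) * (p - mps_const (c\<^sup>2))" "\<lambda>_ _ _. - 1 / (2 * c)", OF N0] by blast
  define V where "V = U ()"
  have cc: "2 * c * (1 / (2 * c)) = 1" "2 * c * (- 1 / (2 * c)) = - 1" using assms by auto
  have "V = mps_const (1 / (2 * c)) * (p - mps_const (c\<^sup>2)) + mps_const (- 1 / (2 * c)) * V * V"
    using U(2)[of "()"] by (simp add: polar_def V_def UNIV_unit)
  then have "mps_const (2 * c) * V = mps_const (2 * c) * (mps_const (1 / (2 * c)) * (p - mps_const (c\<^sup>2)) + mps_const (- 1 / (2 * c)) * V * V)"
    by simp
  also have "\<dots> = mps_const (2 * c * (1 / (2 * c))) * (p - mps_const (c\<^sup>2)) + mps_const (2 * c * (- 1 / (2 * c))) * (V * V)"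
    unfolding mps_const_mult[of "2 * c"] by (simp add: distrib_left mult.assoc)
  finally have "mps_const (2 * c) * V = p - mps_const (c\<^sup>2) - V * V"
    unfolding cc by (simp add: mps_const_uminus)
  then have "(mps_const c + V)\<^sup>2 = p"
    by (simp add: power2_eq_square algebra_simps mps_const_mult mps_numeral[symmetric])
  then show ?thesis by (rule that) (simp add: V_def U(1))
qed

text \<open>The matrix is the Jacobian at \<open>b\<close> of the map with components half of
  \<open>Q i\<close> on the diagonal; the two results are the formal inverse function theorem for
  it.\<close>

locale quadratic_system =
  fixes Q :: "'w :: finite \<Rightarrow> 'w \<Rightarrow> 'w \<Rightarrow> 'k :: field_char_0" and b :: "'w \<Rightarrow> 'k"
  assumes Q_sym: "Q i j k = Q i k j"
    and det_nonzero: "det (\<chi> i k. \<Sum>j\<in>UNIV. Q i j k * b j) \<noteq> 0"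
begin

definition Mi where "Mi = matrix_inv (\<chi> i k. \<Sum>j\<in>UNIV. Q i j k * b j)"

lemma M_Mi: "(\<Sum>k\<in>UNIV. (\<Sum>j\<in>UNIV. Q i j k * b j) * Mi $ k $ l) = (if i = l then 1 else 0)"
proof -
  have "(\<chi> i k. \<Sum>j\<in>UNIV. Q i j k * b j) ** Mi = mat 1"
    unfolding Mi_def by (rule matrix_inv_mult) (simp add: invertible_det_nz det_nonzero)
  from arg_cong[OF this, of "\<lambda>M. M $ i $ l"] show ?thesis by (simp add: matrix_matrix_mult_def mat_def)
qed

text \<open>Expanding at \<open>b\<close> and multiplying by the inverse Jacobian gives a fixpoint
  equation for the increment \<open>U\<close>. That equation is part of the conclusion because
  convergence is derived from it.\<close>

lemma solution_exists:
  fixes N :: "'w \<Rightarrow> ('v, 'k) mps"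
  assumes N: "\<And>i. mps_coeff (N i) {#} = 0"
  obtains U where "\<And>i. mps_coeff (U i) {#} = 0"
    "\<And>i. U i = (\<Sum>l\<in>UNIV. mps_const (Mi $ i $ l) * N l) + polar mps_const (\<lambda>j k. - (1 / 2) * (\<Sum>l\<in>UNIV. Mi $ i $ l * Q l j k)) U U"
    "\<And>i. mps_const (1 / 2) * polar mps_const (Q i) (\<lambda>j. mps_const (b j) + U j) (\<lambda>j. mps_const (b j) + U j)
        = mps_const (1 / 2 * polar id (Q i) b b) + N i"
proof -
  obtain U where U: "\<And>i. mps_coeff (U i) {#} = 0"
    "\<And>i. U i = (\<Sum>l\<in>UNIV. mps_const (Mi $ i $ l) * N l) + polar mps_const (\<lambda>j k. - (1 / 2) * (\<Sum>l\<in>UNIV. Mi $ i $ l * Q l j k)) U U"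
  proof -
    have "mps_coeff (\<Sum>l\<in>UNIV. mps_const (Mi $ i $ l) * N l) {#} = 0" for i by (simp add: N)
    from quadratic_fixpoint[of "\<lambda>i. \<Sum>l\<in>UNIV. mps_const (Mi $ i $ l) * N l" "\<lambda>i j k. - (1 / 2) * (\<Sum>l\<in>UNIV. Mi $ i $ l * Q l j k)", OF this]
    show ?thesis using that by blast
  qed
  have U2: "U k = (\<Sum>l\<in>UNIV. mps_const (Mi $ k $ l) * (N l - mps_const (1 / 2) * polar mps_const (Q l) U U))" for k
  proof -
    have "U k = (\<Sum>l\<in>UNIV. mps_const (Mi $ k $ l) * N l) + mps_const (- (1 / 2)) * (\<Sum>l\<in>UNIV. mps_const (Mi $ k $ l) * polar mps_const (Q l) U U)"
      by (subst U(2)) (simp only: polar_form_mult polar_form_sum)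
    then show ?thesis
      by (simp add: right_diff_distrib sum_subtractf mps_const_uminus sum_distrib_left sum_negf mult.left_commute)
  qed
  have lin: "polar mps_const (Q i) (\<lambda>j. mps_const (b j)) U = N i - mps_const (1 / 2) * polar mps_const (Q i) U U" for i
  proof -
    have "polar mps_const (Q i) (\<lambda>j. mps_const (b j)) U = (\<Sum>k\<in>UNIV. mps_const (\<Sum>j\<in>UNIV. Q i j k * b j) * U k)"
      unfolding polar_def mps_const_sum mps_const_mult sum_distrib_right by (rule sum.swap)
    also have "\<dots> = (\<Sum>k\<in>UNIV. \<Sum>l\<in>UNIV. mps_const ((\<Sum>j\<in>UNIV. Q i j k * b j) * Mi $ k $ l) * (N l - mps_const (1 / 2) * polar mps_const (Q l) U U))"
      by (intro sum.cong refl, subst U2) (simp add: sum_distrib_left mps_const_mult mult.assoc)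
    also have "\<dots> = (\<Sum>l\<in>UNIV. mps_const (\<Sum>k\<in>UNIV. (\<Sum>j\<in>UNIV. Q i j k * b j) * Mi $ k $ l) * (N l - mps_const (1 / 2) * polar mps_const (Q l) U U))"
      by (subst sum.swap) (simp only: mps_const_sum sum_distrib_right)
    also have "\<dots> = (\<Sum>l\<in>UNIV. if i = l then N l - mps_const (1 / 2) * polar mps_const (Q l) U U else 0)"
      unfolding M_Mi by (intro sum.cong refl) auto
    finally show ?thesis by simp
  qed
  have "mps_const (1 / 2) * polar mps_const (Q i) (\<lambda>j. mps_const (b j) + U j) (\<lambda>j. mps_const (b j) + U j)
        = mps_const (1 / 2 * polar id (Q i) b b) + N i" for i
  proof -
    have "polar mps_const (Q i) (\<lambda>j. mps_const (b j)) (\<lambda>j. mps_const (b j)) = mps_const (polar id (Q i) b b)"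
      using polar_ring_map[OF ring_map_mps_const, of id "Q i" b b, symmetric] by simp
    moreover have "polar mps_const (Q i) U (\<lambda>j. mps_const (b j)) = polar mps_const (Q i) (\<lambda>j. mps_const (b j)) U"
      by (rule polar_commute) (rule Q_sym)
    ultimately have "polar mps_const (Q i) (\<lambda>j. mps_const (b j) + U j) (\<lambda>j. mps_const (b j) + U j)
       = mps_const (polar id (Q i) b b) + 2 * (N i - mps_const (1 / 2) * polar mps_const (Q i) U U) + polar mps_const (Q i) U U"
      by (simp add: polar_add_left polar_add_right lin)
    then show ?thesis
      by (simp add: algebra_simps mps_numeral mps_const_mult[symmetric] mult.assoc[symmetric])
  qed
  with U show ?thesis by (rule that)
qed

text \<open>By polarization \<open>u - u'\<close> is killed by the matrix of the forms paired with
  \<open>u + u'\<close>, whose value at the origin is twice the Jacobian at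
  \<open>b\<close>.\<close>

lemma solution_unique:
  fixes u u' :: "'w \<Rightarrow> ('v :: countable, 'k) mps"
  assumes "\<And>j. mps_coeff (u j) {#} = b j" "\<And>j. mps_coeff (u' j) {#} = b j"
    and eq: "\<And>i. polar mps_const (Q i) u u = polar mps_const (Q i) u' u'"
  shows "u k = u' k"
proof -
  define A where "A = (\<chi> i k. \<Sum>j\<in>UNIV. mps_const (Q i j k) * (u j + u' j))"
  have "mps_coeff (det A) {#} = det (\<chi> i k. mps_coeff (A $ i $ k) {#})"
    by (rule ring_map_det[OF ring_map_const_term])
  also have "(\<chi> i k. mps_coeff (A $ i $ k) {#}) = (\<chi> i. 2 *s (\<chi> k. \<Sum>j\<in>UNIV. Q i j k * b j))"
    by (simp add: A_def vec_eq_iff assms sum_distrib_left mult_ac)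
  also have "det \<dots> \<noteq> 0"
    using det_nonzero by (simp add: det_rows_mul)
  finally have "det A \<noteq> 0" by auto
  moreover have "(\<Sum>k\<in>UNIV. A $ i $ k * (u k - u' k)) = 0" for i
  proof -
    have "(\<Sum>k\<in>UNIV. A $ i $ k * (u k - u' k)) = polar mps_const (Q i) (\<lambda>j. u j + u' j) (\<lambda>k. u k - u' k)"
      unfolding A_def polar_def by (subst sum.swap) (simp add: sum_distrib_right)
    also have "\<dots> = 0"
      using polar_commute[of "Q i" mps_const u u'] Q_sym[of i] by (simp add: polar_add_left polar_diff_right eq)
    finally show ?thesis .
  qed
  ultimately have "u k - u' k = 0" by (rule det_nonzero_kernel)
  then show ?thesis by simp
qed

end

section \<open>Convergence\<close>

lemma size_add_diff_mset [simp]: "B \<subseteq># A \<Longrightarrow> size B + size (A - B) = size A"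
  by (metis size_union subset_mset.add_diff_inverse)


definition absolute_value :: "('k :: comm_ring_1 \<Rightarrow> real) \<Rightarrow> bool" where
  "absolute_value \<nu> \<longleftrightarrow> \<nu> 0 = 0 \<and> \<nu> 1 = 1 \<and> (\<forall>x. 0 \<le> \<nu> x) \<and> (\<forall>x y. \<nu> (x + y) \<le> \<nu> x + \<nu> y) \<and> (\<forall>x y. \<nu> (x * y) = \<nu> x * \<nu> y)"

text \<open>The sum of absolute values of the terms on the polydisc of radius \<open>r\<close>,
  truncated at degree \<open>d\<close>. Convergence means boundedness in \<open>d\<close>, so
  estimates become inductions on \<open>d\<close>.\<close>

definition majorant :: "('k \<Rightarrow> real) \<Rightarrow> real \<Rightarrow> nat \<Rightarrow> ('v :: finite, 'k) mps \<Rightarrow> real" where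
  "majorant \<nu> r d p = (\<Sum>M | size M \<le> d. \<nu> (mps_coeff p M) * r ^ size M)"

definition convergent_mps :: "('k \<Rightarrow> real) \<Rightarrow> ('v :: finite, 'k) mps \<Rightarrow> bool" where
  "convergent_mps \<nu> p \<longleftrightarrow> (\<exists>r>0. \<exists>B. \<forall>d. majorant \<nu> r d p \<le> B)"

text \<open>Non-negative terms are summable exactly when the truncations by degree are bounded,
  since finitely many monomials have bounded degree.\<close>

lemma germ_space_cases:
  fixes \<O> :: "('v :: finite, 'k :: field) mps set"
  assumes "germ_space \<O>"
  obtains "\<O> = UNIV" | \<nu> where "absolute_value \<nu>" "\<O> = {p. convergent_mps \<nu> p}"
proof -
  have "\<exists>\<nu>. absolute_value \<nu> \<and> \<O> = {p. convergent_mps \<nu> p}"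
    if \<phi>: "bij \<phi>" "\<forall>x y. \<phi> (x + y) = \<phi> x + \<phi> y" "\<forall>x y. \<phi> (x * y) = \<phi> x * \<phi> y"
      and \<O>: "\<O> = {p. \<exists>r>0. (\<lambda>M. norm (\<phi> (mps_coeff p M)) * r ^ size M) summable_on UNIV}"
    for \<phi> :: "'k \<Rightarrow> complex"
  proof (intro exI conjI)
    define \<nu> where "\<nu> x = norm (\<phi> x)" for x
    have "\<phi> 0 = 0" using \<phi>(2) by (metis add_cancel_left_left)
    moreover have "\<phi> 1 = 1"
    proof -
      have "\<phi> 1 \<noteq> 0" using \<phi>(1) \<open>\<phi> 0 = 0\<close> by (metis bij_is_inj inj_eq zero_neq_one)
      moreover have "\<phi> 1 * \<phi> 1 = \<phi> 1" using \<phi>(3) by (metis mult_1)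
      ultimately show ?thesis by simp
    qed
    ultimately show "absolute_value \<nu>"
      using \<phi> by (simp add: absolute_value_def \<nu>_def norm_triangle_ineq norm_mult)
    have "(\<lambda>M. \<nu> (mps_coeff p M) * r ^ size M) summable_on UNIV \<longleftrightarrow> (\<exists>B. \<forall>d. majorant \<nu> r d p \<le> B)"
      if "r > 0" for r and p :: "('v, 'k) mps"
    proof
      assume s: "(\<lambda>M. \<nu> (mps_coeff p M) * r ^ size M) summable_on UNIV"
      show "\<exists>B. \<forall>d. majorant \<nu> r d p \<le> B"
        unfolding majorant_def
        by (intro exI[of _ "infsum (\<lambda>M. \<nu> (mps_coeff p M) * r ^ size M) UNIV"] allI finite_sum_le_infsum[OF s]) (use that in \<open>auto simp: \<nu>_def\<close>)
    next
      assume "\<exists>B. \<forall>d. majorant \<nu> r d p \<le> B"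
      then obtain B where B: "\<And>d. majorant \<nu> r d p \<le> B" by blast
      show "(\<lambda>M. \<nu> (mps_coeff p M) * r ^ size M) summable_on UNIV"
      proof (rule nonneg_bounded_partial_sums_imp_summable_on)
        show "\<forall>\<^sub>F F in finite_subsets_at_top UNIV. (\<Sum>M\<in>F. \<nu> (mps_coeff p M) * r ^ size M) \<le> B"
        proof (rule eventually_finite_subsets_at_top_weakI)
          fix F :: "'v multiset set" assume F: "finite F"
          define d where "d = Max (insert 0 (size ` F))"
          have "F \<subseteq> {M. size M \<le> d}" using F by (auto simp: d_def intro!: Max_ge)
          then have "(\<Sum>M\<in>F. \<nu> (mps_coeff p M) * r ^ size M) \<le> majorant \<nu> r d p"
            unfolding majorant_def by (intro sum_mono2) (use that in \<open>auto simp: \<nu>_def\<close>)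
          then show "(\<Sum>M\<in>F. \<nu> (mps_coeff p M) * r ^ size M) \<le> B" using B[of d] by linarith
        qed
      qed (use that in \<open>auto simp: \<nu>_def\<close>)
    qed
    then show "\<O> = {p. convergent_mps \<nu> p}" by (auto simp: \<O> convergent_mps_def \<nu>_def)
  qed
  then show ?thesis using assms that unfolding germ_space_def by blast
qed

context
  fixes \<nu> :: "'k :: comm_ring_1 \<Rightarrow> real"
  assumes \<nu>: "absolute_value \<nu>"
begin

lemma \<nu>_simps: "\<nu> 0 = 0" "\<nu> 1 = 1" "0 \<le> \<nu> x" "\<nu> (x * y) = \<nu> x * \<nu> y" "\<nu> (x + y) \<le> \<nu> x + \<nu> y"
  using \<nu> by (auto simp: absolute_value_def)

lemma \<nu>_sum: "\<nu> (sum f A) \<le> (\<Sum>x\<in>A. \<nu> (f x))"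
proof (induction A rule: infinite_finite_induct)
  case (insert x A)
  then show ?case using \<nu>_simps(5)[of "f x" "sum f A"] by simp
qed (auto simp: \<nu>_simps)

lemma \<nu>_of_nat: "\<nu> (of_nat n) \<le> of_nat n"
proof (induction n)
  case (Suc n)
  then show ?case using \<nu>_simps(5)[of 1 "of_nat n"] by (simp add: \<nu>_simps)
qed (auto simp: \<nu>_simps)

lemma majorant_nonneg: "0 \<le> r \<Longrightarrow> 0 \<le> majorant \<nu> r d p"
  by (simp add: majorant_def \<nu>_simps sum_nonneg)

lemma majorant_mono:
  assumes "0 \<le> r" "r \<le> r'" "d \<le> d'"
  shows "majorant \<nu> r d p \<le> majorant \<nu> r' d' p"
proof -
  have "majorant \<nu> r d p \<le> (\<Sum>M | size M \<le> d. \<nu> (mps_coeff p M) * r' ^ size M)"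
    unfolding majorant_def by (intro sum_mono mult_left_mono power_mono) (use assms in \<open>auto simp: \<nu>_simps\<close>)
  also have "\<dots> \<le> majorant \<nu> r' d' p"
    unfolding majorant_def by (intro sum_mono2) (use assms in \<open>auto simp: \<nu>_simps\<close>)
  finally show ?thesis .
qed

lemma majorant_add:
  assumes "0 \<le> r"
  shows "majorant \<nu> r d (p + q) \<le> majorant \<nu> r d p + majorant \<nu> r d q"
  unfolding majorant_def sum.distrib[symmetric] distrib_right[symmetric] mps_coeff_add
  by (intro sum_mono mult_right_mono \<nu>_simps) (use assms in auto)

lemma majorant_sum:
  assumes "0 \<le> r"
  shows "majorant \<nu> r d (sum f A) \<le> (\<Sum>x\<in>A. majorant \<nu> r d (f x))"
proof (induction A rule: infinite_finite_induct)
  case (insert x A)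
  then show ?case using majorant_add[OF assms, of d "f x" "sum f A"] by simp
qed (auto simp: majorant_def \<nu>_simps)

lemma majorant_const_mult: "majorant \<nu> r d (mps_const c * p) = \<nu> c * majorant \<nu> r d p"
  by (simp add: majorant_def mps_coeff_const_mult \<nu>_simps sum_distrib_left mult.assoc)

text \<open>The index sets \<open>X\<close> and \<open>Z\<close> are left open to yield both
  submultiplicativity and the sharper bound for factors without constant term.\<close>

lemma majorant_mult_le:
  fixes p q :: "('v :: finite, 'k) mps"
  assumes r: "0 \<le> r" and fin: "finite X" "finite Z"
    and XZ: "\<And>A B. size (A + B) \<le> d \<Longrightarrow> mps_coeff p A \<noteq> 0 \<Longrightarrow> mps_coeff q B \<noteq> 0 \<Longrightarrow> A \<in> X \<and> B \<in> Z"
  shows "majorant \<nu> r d (p * q) \<le> (\<Sum>A\<in>X. \<nu> (mps_coeff p A) * r ^ size A) * (\<Sum>B\<in>Z. \<nu> (mps_coeff q B) * r ^ size B)"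
proof -
  define F where "F A B = \<nu> (mps_coeff p A) * r ^ size A * (\<nu> (mps_coeff q B) * r ^ size B)" for A B
  have F: "0 \<le> F A B" for A B using r by (simp add: F_def \<nu>_simps)
  have "majorant \<nu> r d (p * q) \<le> (\<Sum>M | size M \<le> d. \<Sum>A | A \<subseteq># M. F A (M - A))"
    unfolding majorant_def
  proof (rule sum_mono)
    fix M :: "'v multiset"
    have "\<nu> (mps_coeff (p * q) M) \<le> (\<Sum>A | A \<subseteq># M. \<nu> (mps_coeff p A * mps_coeff q (M - A)))"
      unfolding mps_coeff_mult by (rule \<nu>_sum)
    then have "\<nu> (mps_coeff (p * q) M) * r ^ size M \<le> (\<Sum>A | A \<subseteq># M. \<nu> (mps_coeff p A * mps_coeff q (M - A))) * r ^ size M"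
      by (rule mult_right_mono) (use r in simp)
    also have "\<dots> = (\<Sum>A | A \<subseteq># M. F A (M - A))"
      unfolding sum_distrib_right
    proof (intro sum.cong refl)
      fix A assume "A \<in> {A. A \<subseteq># M}"
      then have "M = A + (M - A)" by simp
      then have "size M = size A + size (M - A)" by (metis size_union)
      then show "\<nu> (mps_coeff p A * mps_coeff q (M - A)) * r ^ size M = F A (M - A)"
        by (simp add: F_def \<nu>_simps power_add mult_ac)
    qed
    finally show "\<nu> (mps_coeff (p * q) M) * r ^ size M \<le> (\<Sum>A | A \<subseteq># M. F A (M - A))" .
  qed
  also have "\<dots> = (\<Sum>(M, A)\<in>(SIGMA M:{M. size M \<le> d}. {A. A \<subseteq># M}). F A (M - A))"
    by (rule sum.Sigma) auto
  also have "\<dots> = (\<Sum>(A, B)\<in>{(A, B). size (A + B) \<le> d}. F A B)"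
    by (rule sum.reindex_bij_witness[of _ "\<lambda>(A, B). (A + B, A)" "\<lambda>(M, A). (A, M - A)"]) auto
  also have "\<dots> \<le> (\<Sum>(A, B)\<in>X \<times> Z. F A B)"
  proof -
    have finS: "finite {(A, B :: 'v multiset). size (A + B) \<le> d}"
      by (rule finite_subset[of _ "{A. size A \<le> d} \<times> {B. size B \<le> d}"]) auto
    have "(\<Sum>(A, B)\<in>{(A, B). size (A + B) \<le> d}. F A B) = (\<Sum>(A, B)\<in>{(A, B). size (A + B) \<le> d} \<inter> X \<times> Z. F A B)"
    proof (rule sum.mono_neutral_right[OF finS])
      show "\<forall>i\<in>{(A, B). size (A + B) \<le> d} - {(A, B). size (A + B) \<le> d} \<inter> X \<times> Z. (case i of (A, B) \<Rightarrow> F A B) = 0"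
        using XZ by (force simp: F_def \<nu>_simps)
    qed auto
    also have "\<dots> \<le> (\<Sum>(A, B)\<in>X \<times> Z. F A B)"
      by (rule sum_mono2) (use fin F in auto)
    finally show ?thesis .
  qed
  also have "\<dots> = (\<Sum>A\<in>X. \<nu> (mps_coeff p A) * r ^ size A) * (\<Sum>B\<in>Z. \<nu> (mps_coeff q B) * r ^ size B)"
    by (simp add: F_def sum_product sum.cartesian_product)
  finally show ?thesis .
qed

lemma majorant_mult:
  "0 \<le> r \<Longrightarrow> majorant \<nu> r d (p * q) \<le> majorant \<nu> r d p * majorant \<nu> r d q"
  unfolding majorant_def[of _ _ _ p] majorant_def[of _ _ _ q]
  by (rule majorant_mult_le) auto

text \<open>Each factor takes at least one degree, so only degrees up to \<open>d\<close> of the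
  other one are seen. This is what makes the induction for the fixpoint go through.\<close>

lemma majorant_mult_Suc:
  assumes "0 \<le> r" "mps_coeff p {#} = 0" "mps_coeff q {#} = 0"
  shows "majorant \<nu> r (Suc d) (p * q) \<le> majorant \<nu> r d p * majorant \<nu> r d q"
  unfolding majorant_def[of _ _ _ p] majorant_def[of _ _ _ q]
proof (rule majorant_mult_le[OF assms(1)])
  fix A B :: "'a multiset" assume *: "size (A + B) \<le> Suc d" "mps_coeff p A \<noteq> 0" "mps_coeff q B \<noteq> 0"
  then have "A \<noteq> {#}" "B \<noteq> {#}" using assms by auto
  then have "0 < size A" "0 < size B" by (auto simp: nonempty_has_size)
  then show "A \<in> {M. size M \<le> d} \<and> B \<in> {M. size M \<le> d}" using *(1) by auto
qed auto

text \<open>Halving the radius pays for the exponent, which is bounded by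
  \<open>2 ^ size M\<close>.\<close>

lemma majorant_deriv:
  assumes "0 < r"
  shows "majorant \<nu> (r / 2) d (mps_deriv i p) \<le> majorant \<nu> r (Suc d) p / r"
proof -
  have "majorant \<nu> (r / 2) d (mps_deriv i p) \<le> (\<Sum>M | size M \<le> d. \<nu> (mps_coeff p (add_mset i M)) * r ^ size (add_mset i M) / r)"
    unfolding majorant_def
  proof (rule sum_mono)
    fix M :: "'a multiset"
    have "Suc (count M i) \<le> Suc (size M)" by (simp add: count_le_size)
    also have "\<dots> \<le> 2 ^ size M" by (rule Suc_leI) simp
    finally have "real (Suc (count M i)) \<le> 2 ^ size M" by (metis of_nat_le_iff of_nat_numeral of_nat_power)
    then have "\<nu> (of_nat (Suc (count M i))) \<le> 2 ^ size M" using \<nu>_of_nat[of "Suc (count M i)"] by linarith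
    then have "\<nu> (of_nat (Suc (count M i))) * (\<nu> (mps_coeff p (add_mset i M)) * (r / 2) ^ size M)
      \<le> 2 ^ size M * (\<nu> (mps_coeff p (add_mset i M)) * (r / 2) ^ size M)"
      by (rule mult_right_mono) (use assms in \<open>simp add: \<nu>_simps\<close>)
    then show "\<nu> (mps_coeff (mps_deriv i p) M) * (r / 2) ^ size M \<le> \<nu> (mps_coeff p (add_mset i M)) * r ^ size (add_mset i M) / r"
      using assms by (simp add: mps_coeff_deriv \<nu>_simps power_divide mult_ac del: of_nat_Suc)
  qed
  also have "\<dots> = (\<Sum>M\<in>add_mset i ` {M. size M \<le> d}. \<nu> (mps_coeff p M) * r ^ size M) / r"
    by (subst sum.reindex) (auto simp: inj_on_def sum_divide_distrib)
  also have "\<dots> \<le> majorant \<nu> r (Suc d) p / r"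
    unfolding majorant_def
    by (intro divide_right_mono sum_mono2) (use assms in \<open>auto simp: \<nu>_simps\<close>)
  finally show ?thesis .
qed

lemma convergent_mps_common:
  assumes "convergent_mps \<nu> p" "convergent_mps \<nu> q"
  obtains r B C where "0 < r" "\<And>d. majorant \<nu> r d p \<le> B" "\<And>d. majorant \<nu> r d q \<le> C"
proof -
  obtain r B where r: "0 < r" "\<And>d. majorant \<nu> r d p \<le> B" using assms(1) by (auto simp: convergent_mps_def)
  obtain r' C where r': "0 < r'" "\<And>d. majorant \<nu> r' d q \<le> C" using assms(2) by (auto simp: convergent_mps_def)
  have "majorant \<nu> (min r r') d p \<le> B" "majorant \<nu> (min r r') d q \<le> C" for d
    using majorant_mono[of "min r r'" r d d p] majorant_mono[of "min r r'" r' d d q] r(1) r'(1) r(2)[of d] r'(2)[of d]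
    by auto
  then show ?thesis using that[of "min r r'"] r(1) r'(1) by auto
qed

lemma convergent_mps_add: "convergent_mps \<nu> p \<Longrightarrow> convergent_mps \<nu> q \<Longrightarrow> convergent_mps \<nu> (p + q)"
proof (erule (1) convergent_mps_common)
  fix r B C assume r: "0 < r" and *: "\<And>d. majorant \<nu> r d p \<le> B" "\<And>d. majorant \<nu> r d q \<le> C"
  have "majorant \<nu> r d (p + q) \<le> B + C" for d
    using majorant_add[of r d p q] *[of d] r by linarith
  then show "convergent_mps \<nu> (p + q)" using r unfolding convergent_mps_def by blast
qed

lemma convergent_mps_mult: "convergent_mps \<nu> p \<Longrightarrow> convergent_mps \<nu> q \<Longrightarrow> convergent_mps \<nu> (p * q)"
proof (erule (1) convergent_mps_common)
  fix r B C assume r: "0 < r" and *: "\<And>d. majorant \<nu> r d p \<le> B" "\<And>d. majorant \<nu> r d q \<le> C"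
  have "0 \<le> B" using majorant_nonneg[of r 0 p] *(1)[of 0] r by linarith
  have "majorant \<nu> r d (p * q) \<le> B * C" for d
    using majorant_mult[of r d p q] mult_mono[OF *(1)[of d] *(2)[of d] \<open>0 \<le> B\<close> majorant_nonneg] r by linarith
  then show "convergent_mps \<nu> (p * q)" using r unfolding convergent_mps_def by blast
qed

lemma convergent_mps_const: "convergent_mps \<nu> (mps_const c)"
proof -
  have "majorant \<nu> 1 d (mps_const c) \<le> \<nu> c" for d
    unfolding majorant_def by (subst sum.remove[of _ "{#}"]) (auto simp: mps_coeff_const \<nu>_simps)
  then show ?thesis unfolding convergent_mps_def by (intro exI[of _ 1]) auto
qed

lemma convergent_mps_deriv: "convergent_mps \<nu> p \<Longrightarrow> convergent_mps \<nu> (mps_deriv i p)"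
proof -
  assume "convergent_mps \<nu> p"
  then obtain r B where r: "0 < r" "\<And>d. majorant \<nu> r d p \<le> B" by (auto simp: convergent_mps_def)
  have "majorant \<nu> (r / 2) d (mps_deriv i p) \<le> B / r" for d
    using majorant_deriv[OF r(1), of d i p] divide_right_mono[OF r(2)[of "Suc d"], of r] r(1) by linarith
  then show ?thesis using r(1) unfolding convergent_mps_def by (intro exI[of _ "r / 2"]) auto
qed

text \<open>The truncated majorants satisfy
  \<open>T (Suc d) \<le> \<epsilon> + K * (T d)\<^sup>2\<close>, hence stay below
  \<open>2 * \<epsilon>\<close> once \<open>4 * K * \<epsilon> \<le> 1\<close>.\<close>

lemma convergent_quadratic_fixpoint:
  fixes Q :: "'w :: finite \<Rightarrow> 'w \<Rightarrow> 'w \<Rightarrow> 'k" and N :: "'w \<Rightarrow> ('v :: finite, 'k) mps"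
  assumes N: "\<And>i M. size M \<noteq> 1 \<Longrightarrow> mps_coeff (N i) M = 0"
    and U_0: "\<And>i. mps_coeff (U i) {#} = 0"
    and U: "\<And>i. U i = N i + polar mps_const (Q i) U U"
  shows "convergent_mps \<nu> (U i)"
proof -
  define K where "K = (\<Sum>i\<in>UNIV. \<Sum>j\<in>UNIV. \<Sum>k\<in>UNIV. \<nu> (Q i j k))"
  define L where "L = (\<Sum>i\<in>UNIV. majorant \<nu> 1 1 (N i))"
  have K: "0 \<le> K" by (simp add: K_def \<nu>_simps sum_nonneg)
  have L: "0 \<le> L" by (simp add: L_def majorant_nonneg sum_nonneg)
  \<comment> \<open>The \<open>N i\<close> are homogeneous linear, so their majorants scale with
    \<open>r\<close>; this \<open>r\<close> is small enough for
    \<open>4 * K * \<epsilon> \<le> 1\<close>, and the added ones avoid division by zero.\<close>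
  define r where "r = 1 / (4 * (K + 1) * (L + 1))"
  have r: "0 < r" using K L by (simp add: r_def)
  define \<epsilon> where "\<epsilon> = r * L"
  have \<epsilon>: "0 \<le> \<epsilon>" using r L by (simp add: \<epsilon>_def)
  have "4 * K * \<epsilon> \<le> 1"
  proof -
    have "4 * K * L \<le> 4 * (K + 1) * (L + 1)" using K L by (simp add: algebra_simps)
    then show ?thesis using K L by (simp add: \<epsilon>_def r_def divide_simps)
  qed
  have N_le: "(\<Sum>i\<in>UNIV. majorant \<nu> r d (N i)) \<le> \<epsilon>" for d
  proof -
    have "majorant \<nu> r d (N i) \<le> r * majorant \<nu> 1 1 (N i)" for i
    proof -
      have "majorant \<nu> r d (N i) = (\<Sum>M | size M \<le> d. if size M = 1 then \<nu> (mps_coeff (N i) M) * r else 0)"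
        unfolding majorant_def by (intro sum.cong) (auto simp: N \<nu>_simps)
      also have "\<dots> = (\<Sum>M\<in>{M \<in> {M. size M \<le> d}. size M = 1}. \<nu> (mps_coeff (N i) M) * r)"
        by (rule sum.inter_filter[symmetric]) simp
      also have "\<dots> \<le> (\<Sum>M | size M \<le> 1. \<nu> (mps_coeff (N i) M) * r)"
        by (rule sum_mono2) (use r in \<open>auto simp: \<nu>_simps\<close>)
      also have "\<dots> = r * majorant \<nu> 1 1 (N i)"
        by (simp add: majorant_def sum_distrib_left mult.commute)
      finally show ?thesis .
    qed
    then show ?thesis unfolding \<epsilon>_def L_def sum_distrib_left by (rule sum_mono)
  qed
  define T where "T d = (\<Sum>i\<in>UNIV. majorant \<nu> r d (U i))" for d
  have T0: "0 \<le> T d" for d using r by (simp add: T_def majorant_nonneg sum_nonneg)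
  have U_T: "majorant \<nu> r d (U i) \<le> T d" for d i
    unfolding T_def by (rule member_le_sum) (use r in \<open>auto simp: majorant_nonneg\<close>)
  have T: "T d \<le> 2 * \<epsilon>" for d
  proof (induction d)
    case 0
    have "majorant \<nu> r 0 (U i) = 0" for i
      unfolding majorant_def by (simp add: U_0 \<nu>_simps)
    then show ?case using \<epsilon> by (simp add: T_def)
  next
    case (Suc d)
    have "majorant \<nu> r (Suc d) (U i) \<le> majorant \<nu> r (Suc d) (N i) + (\<Sum>j\<in>UNIV. \<Sum>k\<in>UNIV. \<nu> (Q i j k)) * (T d * T d)" for i
    proof -
      have "majorant \<nu> r (Suc d) (U i) \<le> majorant \<nu> r (Suc d) (N i) + majorant \<nu> r (Suc d) (polar mps_const (Q i) U U)"
        by (subst U) (rule majorant_add, use r in simp)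
      also have "majorant \<nu> r (Suc d) (polar mps_const (Q i) U U) \<le> (\<Sum>j\<in>UNIV. \<Sum>k\<in>UNIV. majorant \<nu> r (Suc d) (mps_const (Q i j k) * (U j * U k)))"
        unfolding polar_def mult.assoc by (rule order_trans[OF majorant_sum]) (use r in \<open>auto intro!: sum_mono majorant_sum\<close>)
      also have "\<dots> \<le> (\<Sum>j\<in>UNIV. \<Sum>k\<in>UNIV. \<nu> (Q i j k) * (T d * T d))"
      proof (intro sum_mono)
        fix j k
        have "majorant \<nu> r (Suc d) (U j * U k) \<le> majorant \<nu> r d (U j) * majorant \<nu> r d (U k)"
          by (rule majorant_mult_Suc) (use r U_0 in auto)
        also have "\<dots> \<le> T d * T d"
          by (intro mult_mono U_T T0 majorant_nonneg) (use r in simp)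
        finally show "majorant \<nu> r (Suc d) (mps_const (Q i j k) * (U j * U k)) \<le> \<nu> (Q i j k) * (T d * T d)"
          unfolding majorant_const_mult by (rule mult_left_mono) (simp add: \<nu>_simps)
      qed
      finally show ?thesis by (simp add: sum_distrib_right)
    qed
    then have "T (Suc d) \<le> (\<Sum>i\<in>UNIV. majorant \<nu> r (Suc d) (N i)) + K * (T d * T d)"
      unfolding T_def[of "Suc d"] K_def sum_distrib_right sum.distrib[symmetric] by (rule sum_mono)
    also have "\<dots> \<le> \<epsilon> + K * (2 * \<epsilon> * (2 * \<epsilon>))"
      by (intro add_mono N_le mult_left_mono mult_mono Suc T0 K) (use \<epsilon> in auto)
    also have "\<dots> = \<epsilon> + (4 * K * \<epsilon>) * \<epsilon>" by (simp add: algebra_simps)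
    also have "\<dots> \<le> \<epsilon> + 1 * \<epsilon>" by (intro add_left_mono mult_right_mono) fact+
    finally show ?case by simp
  qed
  have "majorant \<nu> r d (U i) \<le> 2 * \<epsilon>" for d using U_T[of d i] T[of d] by linarith
  then show ?thesis using r unfolding convergent_mps_def by blast
qed

end

section \<open>Substitution\<close>

context
  fixes T :: "'v :: finite \<Rightarrow> ('w, 'k :: comm_ring_1) mps"
  assumes T: "\<And>i. mps_coeff (T i) {#} = 0"
begin

lemma monom_order: "mps_order_ge (size A) (\<Prod>i\<in>#A. T i)"
proof (induction A)
  case (add x A)
  have "mps_order_ge (Suc 0 + size A) (T x * (\<Prod>i\<in>#A. T i))"
    by (intro mps_order_ge_mult add) (simp add: mps_order_ge_Suc_0 T)
  then show ?case by simp
qed simp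

text \<open>Monomials of degree above \<open>size M\<close> do not reach the coefficient at
  \<open>M\<close>. A common cutoff \<open>d\<close> is needed to compare coefficients of the
  factors of a product.\<close>

lemma mps_coeff_subst:
  assumes "size M \<le> d"
  shows "mps_coeff (mps_subst T p) M = (\<Sum>A | size A \<le> d. mps_coeff p A * mps_coeff (\<Prod>i\<in>#A. T i) M)"
  unfolding mps_subst_def mps_coeff_Abs
  by (rule sum.mono_neutral_left) (use assms monom_order in \<open>auto simp: mps_order_ge_def\<close>)

lemma mps_subst_add: "mps_subst T (p + q) = mps_subst T p + mps_subst T q"
  by (rule mps_eqI) (simp add: mps_coeff_subst[OF order_refl] distrib_right sum.distrib)

lemma mps_subst_const: "mps_subst T (mps_const c) = mps_const c"
proof (rule mps_eqI)
  fix M :: "'w multiset"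
  have "mps_coeff (mps_subst T (mps_const c)) M = (\<Sum>A | size (A :: 'v multiset) \<le> size M. if A = {#} then c * mps_coeff 1 M else 0)"
    unfolding mps_coeff_subst[OF order_refl] by (intro sum.cong) (auto simp: mps_coeff_const)
  then show "mps_coeff (mps_subst T (mps_const c)) M = mps_coeff (mps_const c) M"
    by (simp add: mps_coeff_1 mps_coeff_const)
qed

lemma mps_subst_var: "mps_subst T (mps_var i) = T i"
proof (rule mps_eqI)
  fix M :: "'w multiset"
  have "mps_coeff (mps_subst T (mps_var i)) M = (\<Sum>A | size A \<le> Suc (size M). if A = {#i#} then mps_coeff (T i) M else 0)"
    unfolding mps_coeff_subst[OF le_SucI[OF order_refl]] by (intro sum.cong) (auto simp: mps_coeff_var)
  then show "mps_coeff (mps_subst T (mps_var i)) M = mps_coeff (T i) M"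
    by simp
qed

lemma mps_subst_mult: "mps_subst T (p * q) = mps_subst T p * mps_subst T q"
proof (rule mps_eqI)
  fix M :: "'w multiset"
  define d where "d = size M"
  define m where "m A N = mps_coeff (\<Prod>i\<in>#A. T i) N" for A N
  have "mps_coeff (mps_subst T (p * q)) M = (\<Sum>A | size A \<le> d. \<Sum>B | B \<subseteq># A. mps_coeff p B * mps_coeff q (A - B) * m A M)"
    by (simp add: mps_coeff_subst[of M d] d_def mps_coeff_mult sum_distrib_right m_def)
  also have "\<dots> = (\<Sum>(A, B)\<in>(SIGMA A:{A. size A \<le> d}. {B. B \<subseteq># A}). mps_coeff p B * mps_coeff q (A - B) * m A M)"
    by (rule sum.Sigma) auto
  also have "\<dots> = (\<Sum>(B, C)\<in>{(B, C). size (B + C) \<le> d}. mps_coeff p B * mps_coeff q C * m (B + C) M)"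
    by (rule sum.reindex_bij_witness[of _ "\<lambda>(B, C). (B + C, B)" "\<lambda>(A, B). (B, A - B)"]) auto
  \<comment> \<open>Pairs of total degree above \<open>d\<close> contribute nothing because
    \<open>T\<close> has no constant terms, so the triangle of pairs may be completed to a
    square.\<close>
  also have "\<dots> = (\<Sum>(B, C)\<in>{B. size B \<le> d} \<times> {C. size C \<le> d}. mps_coeff p B * mps_coeff q C * m (B + C) M)"
  proof (rule sum.mono_neutral_left)
    show "\<forall>i\<in>{B. size B \<le> d} \<times> {C. size C \<le> d} - {(B, C). size (B + C) \<le> d}.
       (case i of (B, C) \<Rightarrow> mps_coeff p B * mps_coeff q C * m (B + C) M) = 0"
    proof
      fix i assume i: "i \<in> {B. size B \<le> d} \<times> {C. size C \<le> d} - {(B, C :: 'v multiset). size (B + C) \<le> d}"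
      obtain B C where BC: "i = (B, C)" by (cases i)
      then have "size M < size (B + C)" using i by (auto simp: d_def)
      then have "m (B + C) M = 0" using monom_order[of "B + C"] by (simp add: m_def mps_order_ge_def)
      then show "(case i of (B, C) \<Rightarrow> mps_coeff p B * mps_coeff q C * m (B + C) M) = 0" by (simp add: BC)
    qed
  qed auto
  also have "\<dots> = (\<Sum>B | size B \<le> d. \<Sum>C | size C \<le> d. mps_coeff p B * mps_coeff q C * (\<Sum>N | N \<subseteq># M. m B N * m C (M - N)))"
    by (simp add: sum.cartesian_product m_def mps_coeff_mult[symmetric])
  also have "\<dots> = (\<Sum>B | size B \<le> d. \<Sum>C | size C \<le> d. \<Sum>N | N \<subseteq># M. mps_coeff p B * m B N * (mps_coeff q C * m C (M - N)))"
    by (simp add: sum_distrib_left mult_ac)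
  also have "\<dots> = (\<Sum>B | size B \<le> d. \<Sum>N | N \<subseteq># M. \<Sum>C | size C \<le> d. mps_coeff p B * m B N * (mps_coeff q C * m C (M - N)))"
    by (intro sum.cong refl sum.swap)
  also have "\<dots> = (\<Sum>N | N \<subseteq># M. \<Sum>B | size B \<le> d. \<Sum>C | size C \<le> d. mps_coeff p B * m B N * (mps_coeff q C * m C (M - N)))"
    by (rule sum.swap)
  also have "\<dots> = (\<Sum>N | N \<subseteq># M. mps_coeff (mps_subst T p) N * mps_coeff (mps_subst T q) (M - N))"
  proof (intro sum.cong refl)
    fix N assume "N \<in> {N. N \<subseteq># M}"
    then have "size N \<le> d" "size (M - N) \<le> d" by (auto simp: d_def size_mset_mono)
    then show "(\<Sum>B | size B \<le> d. \<Sum>C | size C \<le> d. mps_coeff p B * m B N * (mps_coeff q C * m C (M - N)))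
      = mps_coeff (mps_subst T p) N * mps_coeff (mps_subst T q) (M - N)"
      by (simp add: mps_coeff_subst[of _ d] m_def sum_product)
  qed
  finally show "mps_coeff (mps_subst T (p * q)) M = mps_coeff (mps_subst T p * mps_subst T q) M"
    by (simp add: mps_coeff_mult)
qed

lemma ring_map_mps_subst: "ring_map (mps_subst T)"
  using mps_subst_const[of 1] by (simp add: ring_map_def mps_subst_add mps_subst_mult)

lemma mps_subst_const_term [simp]: "mps_coeff (mps_subst T p) {#} = mps_coeff p {#}"
  by (simp add: mps_coeff_subst[of _ 0])

end

section \<open>Polynomials\<close>

lemma mps_coeff_var_mult:
  fixes p :: "('v, 'k :: comm_ring_1) mps"
  shows "mps_coeff (mps_var i * p) M = (if i \<in># M then mps_coeff p (M - {#i#}) else 0)"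
proof -
  have "mps_coeff (mps_var i * p) M = (\<Sum>A | A \<subseteq># M. if A = {#i#} then mps_coeff p (M - {#i#}) else 0)"
    unfolding mps_coeff_mult by (intro sum.cong) (auto simp: mps_coeff_var)
  then show ?thesis by simp
qed

lemma mps_coeff_monom:
  "mps_coeff (\<Prod>i\<in>#M. mps_var i) N = (if N = M then 1 else 0 :: 'k :: comm_ring_1)"
proof (induction M arbitrary: N)
  case (add x M)
  show ?case
    by (auto simp: mps_coeff_var_mult add)
qed (simp add: mps_coeff_1)

lemma is_poly_0 [simp]: "is_poly 0"
  by (simp add: is_poly_def)

lemma is_poly_const [simp]: "is_poly (mps_const c)"
  unfolding is_poly_def by (rule finite_subset[of _ "{{#}}"]) (auto simp: mps_coeff_const split: if_splits)

lemma is_poly_1 [simp]: "is_poly (1 :: ('v, 'k :: comm_ring_1) mps)"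
  by (metis is_poly_const mps_const_1)

lemma is_poly_var [simp]: "is_poly (mps_var i)"
  unfolding is_poly_def by (rule finite_subset[of _ "{{#i#}}"]) (auto simp: mps_coeff_var split: if_splits)

lemma is_poly_add: "is_poly p \<Longrightarrow> is_poly q \<Longrightarrow> is_poly (p + q)"
  unfolding is_poly_def
  by (rule finite_subset[of _ "{M. mps_coeff p M \<noteq> 0} \<union> {M. mps_coeff q M \<noteq> 0}"]) auto

lemma is_poly_mult:
  fixes p q :: "('v, 'k :: comm_ring_1) mps"
  assumes "is_poly p" "is_poly q"
  shows "is_poly (p * q)"
proof -
  have "{M. mps_coeff (p * q) M \<noteq> 0} \<subseteq> (\<lambda>(A, B). A + B) ` ({M. mps_coeff p M \<noteq> 0} \<times> {M. mps_coeff q M \<noteq> 0})"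
  proof
    fix M assume "M \<in> {M. mps_coeff (p * q) M \<noteq> 0}"
    then have "(\<Sum>A | A \<subseteq># M. mps_coeff p A * mps_coeff q (M - A)) \<noteq> 0" by (simp add: mps_coeff_mult)
    then obtain A where A: "A \<subseteq># M" "mps_coeff p A * mps_coeff q (M - A) \<noteq> 0"
      by (auto elim!: sum.not_neutral_contains_not_neutral)
    then have "M = A + (M - A)" "mps_coeff p A \<noteq> 0" "mps_coeff q (M - A) \<noteq> 0" by auto
    then show "M \<in> (\<lambda>(A, B). A + B) ` ({M. mps_coeff p M \<noteq> 0} \<times> {M. mps_coeff q M \<noteq> 0})"
      by (intro image_eqI[of _ _ "(A, M - A)"]) auto
  qed
  then show ?thesis
    using assms unfolding is_poly_def by (meson finite_SigmaI finite_imageI finite_subset)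
qed

lemma is_poly_sum: "(\<And>x. x \<in> A \<Longrightarrow> is_poly (f x)) \<Longrightarrow> is_poly (sum f A)"
  by (induction A rule: infinite_finite_induct) (auto intro: is_poly_add)

lemma is_poly_prod: "(\<And>x. x \<in> A \<Longrightarrow> is_poly (f x :: ('v, 'k :: comm_ring_1) mps)) \<Longrightarrow> is_poly (prod f A)"
  by (induction A rule: infinite_finite_induct) (auto intro: is_poly_mult)

lemma is_poly_prod_mset: "(\<And>i. is_poly (f i :: ('v, 'k :: comm_ring_1) mps)) \<Longrightarrow> is_poly (\<Prod>i\<in>#M. f i)"
  by (induction M) (auto intro: is_poly_mult)

lemma is_poly_of_int: "is_poly (of_int n :: ('v, 'k :: comm_ring_1) mps)"
  by (simp add: mps_of_int)

lemma is_poly_det: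
  fixes A :: "('v, 'k :: comm_ring_1) mps ^ 'm ^ 'm"
  shows "(\<And>i j. is_poly (A $ i $ j)) \<Longrightarrow> is_poly (det A)"
  unfolding det_def by (intro is_poly_sum is_poly_mult is_poly_of_int is_poly_prod)

lemma is_poly_deriv: "is_poly p \<Longrightarrow> is_poly (mps_deriv i p)"
proof -
  assume "is_poly p"
  then have "finite (add_mset i -` {M. mps_coeff p M \<noteq> 0})"
    unfolding is_poly_def by (intro finite_vimageI) (auto simp: inj_on_def)
  then show ?thesis
    unfolding is_poly_def by (rule finite_subset[rotated]) (auto simp: mps_coeff_deriv)
qed

lemma is_poly_expansion:
  fixes p :: "('v, 'k :: comm_ring_1) mps"
  assumes "is_poly p"
  shows "p = (\<Sum>M | mps_coeff p M \<noteq> 0. mps_const (mps_coeff p M) * (\<Prod>i\<in>#M. mps_var i))"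
proof (rule mps_eqI)
  fix N
  have "mps_coeff (\<Sum>M | mps_coeff p M \<noteq> 0. mps_const (mps_coeff p M) * (\<Prod>i\<in>#M. mps_var i)) N
    = (\<Sum>M | mps_coeff p M \<noteq> 0. if M = N then mps_coeff p N else 0)"
    unfolding mps_coeff_sum by (intro sum.cong) (auto simp: mps_coeff_const_mult mps_coeff_monom)
  then show "mps_coeff p N = mps_coeff (\<Sum>M | mps_coeff p M \<noteq> 0. mps_const (mps_coeff p M) * (\<Prod>i\<in>#M. mps_var i)) N"
    using assms by (simp add: is_poly_def)
qed

lemma is_poly_induct [consumes 1, case_names const var add mult]:
  fixes p :: "('v, 'k :: comm_ring_1) mps"
  assumes "is_poly p"
    and const: "\<And>c. P (mps_const c)" and var: "\<And>i. P (mps_var i)"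
    and add: "\<And>p q. is_poly p \<Longrightarrow> is_poly q \<Longrightarrow> P p \<Longrightarrow> P q \<Longrightarrow> P (p + q)"
    and mult: "\<And>p q. is_poly p \<Longrightarrow> is_poly q \<Longrightarrow> P p \<Longrightarrow> P q \<Longrightarrow> P (p * q)"
  shows "P p"
proof -
  have monom: "P (\<Prod>i\<in>#M. mps_var i)" for M
  proof (induction M)
    case empty
    show ?case using const[of 1] by simp
  next
    case (add x M)
    then show ?case by (auto intro!: mult var is_poly_prod_mset)
  qed
  have "P (\<Sum>M\<in>S. mps_const (mps_coeff p M) * (\<Prod>i\<in>#M. mps_var i))" for S
  proof (induction S rule: infinite_finite_induct)
    case (insert M S)
    then show ?case
      by (auto intro!: add mult const monom is_poly_mult is_poly_sum is_poly_prod_mset)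
  qed (use const[of 0] in auto)
  then show ?thesis using is_poly_expansion[OF assms(1)] by metis
qed

section \<open>Evaluation of polynomials\<close>

lemma poly_eval_superset:
  assumes "ring_map \<iota>" "finite S" "{M. mps_coeff p M \<noteq> 0} \<subseteq> S"
  shows "poly_eval \<iota> \<sigma> p = (\<Sum>M\<in>S. \<iota> (mps_coeff p M) * (\<Prod>i\<in>#M. \<sigma> i))"
  unfolding poly_eval_def using assms(2,3) ring_map_0[OF assms(1)]
  by (intro sum.mono_neutral_left) auto

lemma poly_eval_add:
  assumes "ring_map \<iota>" "is_poly p" "is_poly q"
  shows "poly_eval \<iota> \<sigma> (p + q) = poly_eval \<iota> \<sigma> p + poly_eval \<iota> \<sigma> q"
proof -
  define S where "S = {M. mps_coeff p M \<noteq> 0} \<union> {M. mps_coeff q M \<noteq> 0}"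
  have S: "finite S" using assms by (simp add: S_def is_poly_def)
  have "poly_eval \<iota> \<sigma> (p + q) = (\<Sum>M\<in>S. \<iota> (mps_coeff (p + q) M) * (\<Prod>i\<in>#M. \<sigma> i))"
    by (rule poly_eval_superset[OF assms(1) S]) (auto simp: S_def)
  moreover have "poly_eval \<iota> \<sigma> p = (\<Sum>M\<in>S. \<iota> (mps_coeff p M) * (\<Prod>i\<in>#M. \<sigma> i))"
    by (rule poly_eval_superset[OF assms(1) S]) (auto simp: S_def)
  moreover have "poly_eval \<iota> \<sigma> q = (\<Sum>M\<in>S. \<iota> (mps_coeff q M) * (\<Prod>i\<in>#M. \<sigma> i))"
    by (rule poly_eval_superset[OF assms(1) S]) (auto simp: S_def)
  ultimately show ?thesis
    by (simp add: sum.distrib[symmetric] distrib_right ring_map_add[OF assms(1)])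
qed

lemma poly_eval_mult:
  fixes \<iota> :: "'k :: comm_ring_1 \<Rightarrow> 'a :: comm_ring_1"
  assumes \<iota>: "ring_map \<iota>" and p: "is_poly p" and q: "is_poly q"
  shows "poly_eval \<iota> \<sigma> (p * q) = poly_eval \<iota> \<sigma> p * poly_eval \<iota> \<sigma> q"
proof -
  define P Q where "P = {M. mps_coeff p M \<noteq> 0}" and "Q = {M. mps_coeff q M \<noteq> 0}"
  define S where "S = {M. mps_coeff (p * q) M \<noteq> 0} \<union> (\<lambda>(A, B). A + B) ` (P \<times> Q)"
  define m where "m M = (\<Prod>i\<in>#M. \<sigma> i)" for M
  have fin: "finite P" "finite Q" using p q by (auto simp: P_def Q_def is_poly_def)
  have S: "finite S" using is_poly_mult[OF p q] fin by (auto simp: S_def is_poly_def)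
  have "poly_eval \<iota> \<sigma> (p * q) = (\<Sum>M\<in>S. \<iota> (mps_coeff (p * q) M) * m M)"
    unfolding m_def by (rule poly_eval_superset[OF \<iota> S]) (auto simp: S_def)
  also have "\<dots> = (\<Sum>M\<in>S. \<Sum>A | A \<subseteq># M. \<iota> (mps_coeff p A) * \<iota> (mps_coeff q (M - A)) * m M)"
    by (simp add: mps_coeff_mult ring_map_sum[OF \<iota>] ring_map_mult[OF \<iota>] sum_distrib_right)
  also have "\<dots> = (\<Sum>(M, A)\<in>(SIGMA M:S. {A. A \<subseteq># M}). \<iota> (mps_coeff p A) * \<iota> (mps_coeff q (M - A)) * m M)"
    by (rule sum.Sigma) (use S in auto)
  also have "\<dots> = (\<Sum>(M, A)\<in>(\<lambda>(A, B). (A + B, A)) ` (P \<times> Q). \<iota> (mps_coeff p A) * \<iota> (mps_coeff q (M - A)) * m M)"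
  proof (rule sum.mono_neutral_right)
    show "\<forall>i\<in>(SIGMA M:S. {A. A \<subseteq># M}) - (\<lambda>(A, B). (A + B, A)) ` (P \<times> Q).
       (case i of (M, A) \<Rightarrow> \<iota> (mps_coeff p A) * \<iota> (mps_coeff q (M - A)) * m M) = 0"
    proof
      fix i assume i: "i \<in> (SIGMA M:S. {A. A \<subseteq># M}) - (\<lambda>(A, B). (A + B, A)) ` (P \<times> Q)"
      obtain M A where MA: "i = (M, A)" by (cases i)
      have "mps_coeff p A = 0 \<or> mps_coeff q (M - A) = 0"
      proof (rule ccontr)
        assume "\<not> ?thesis"
        then have "(A, M - A) \<in> P \<times> Q" by (simp add: P_def Q_def)
        then have "(A + (M - A), A) \<in> (\<lambda>(A, B). (A + B, A)) ` (P \<times> Q)" by force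
        then show False using i MA by auto
      qed
      then show "(case i of (M, A) \<Rightarrow> \<iota> (mps_coeff p A) * \<iota> (mps_coeff q (M - A)) * m M) = 0"
        using ring_map_0[OF \<iota>] by (auto simp: MA)
    qed
  qed (use S fin in \<open>auto simp: S_def\<close>)
  also have "\<dots> = (\<Sum>(A, B)\<in>P \<times> Q. \<iota> (mps_coeff p A) * \<iota> (mps_coeff q B) * m (A + B))"
    by (subst sum.reindex) (auto simp: inj_on_def case_prod_unfold)
  also have "\<dots> = (\<Sum>(A, B)\<in>P \<times> Q. (\<iota> (mps_coeff p A) * m A) * (\<iota> (mps_coeff q B) * m B))"
    by (intro sum.cong) (auto simp: m_def mult_ac)
  also have "\<dots> = poly_eval \<iota> \<sigma> p * poly_eval \<iota> \<sigma> q"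
    by (simp add: poly_eval_def P_def Q_def m_def sum_product sum.cartesian_product)
  finally show ?thesis .
qed

lemma poly_eval_const: "ring_map \<iota> \<Longrightarrow> poly_eval \<iota> \<sigma> (mps_const c) = \<iota> c"
  by (subst poly_eval_superset[of _ "{{#}}"]) (auto simp: mps_coeff_const split: if_splits)

lemma poly_eval_0: "poly_eval \<iota> \<sigma> 0 = 0"
  by (simp add: poly_eval_def)

lemma poly_eval_1: "ring_map \<iota> \<Longrightarrow> poly_eval \<iota> \<sigma> 1 = 1"
  using poly_eval_const[of \<iota> \<sigma> 1] by (simp add: ring_map_1)

lemma poly_eval_var: "ring_map \<iota> \<Longrightarrow> poly_eval \<iota> \<sigma> (mps_var i) = \<sigma> i"
  by (subst poly_eval_superset[of _ "{{#i#}}"]) (auto simp: mps_coeff_var ring_map_1 split: if_splits)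

lemma poly_eval_sum:
  assumes "ring_map \<iota>" "\<And>x. x \<in> A \<Longrightarrow> is_poly (f x)"
  shows "poly_eval \<iota> \<sigma> (sum f A) = (\<Sum>x\<in>A. poly_eval \<iota> \<sigma> (f x))"
  using assms(2)
  by (induction A rule: infinite_finite_induct) (auto simp: poly_eval_0 poly_eval_add assms(1) is_poly_sum)

lemma poly_eval_prod:
  assumes "ring_map \<iota>" "\<And>x. x \<in> A \<Longrightarrow> is_poly (f x)"
  shows "poly_eval \<iota> \<sigma> (prod f A) = (\<Prod>x\<in>A. poly_eval \<iota> \<sigma> (f x))"
  using assms(2)
  by (induction A rule: infinite_finite_induct) (auto simp: poly_eval_1 poly_eval_mult assms(1) is_poly_prod)

lemma poly_eval_det:
  fixes A :: "('v, 'k :: comm_ring_1) mps ^ 'm ^ 'm"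
  assumes "ring_map \<iota>" "\<And>i j. is_poly (A $ i $ j)"
  shows "poly_eval \<iota> \<sigma> (det A) = det (\<chi> i j. poly_eval \<iota> \<sigma> (A $ i $ j))"
  unfolding det_def
  by (simp add: poly_eval_sum poly_eval_mult poly_eval_prod assms is_poly_of_int is_poly_prod is_poly_mult
      mps_of_int poly_eval_const ring_map_of_int)

lemma ring_map_poly_eval:
  assumes "ring_map h"
  shows "h (poly_eval \<iota> \<sigma> p) = poly_eval (\<lambda>c. h (\<iota> c)) (\<lambda>i. h (\<sigma> i)) p"
  by (simp add: poly_eval_def ring_map_sum[OF assms] ring_map_mult[OF assms] ring_map_prod_mset[OF assms])

lemma is_poly_poly_eval:
  fixes S :: "'v \<Rightarrow> ('w, 'k :: comm_ring_1) mps"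
  shows "(\<And>i. is_poly (S i)) \<Longrightarrow> is_poly (poly_eval mps_const S F)"
  unfolding poly_eval_def by (intro is_poly_sum is_poly_mult is_poly_const is_poly_prod_mset)

lemma poly_eval_poly_eval:
  fixes S :: "'v \<Rightarrow> ('w, 'k :: comm_ring_1) mps"
  assumes \<iota>: "ring_map \<iota>" and S: "\<And>i. is_poly (S i)" and F: "is_poly F"
  shows "poly_eval \<iota> \<sigma> (poly_eval mps_const S F) = poly_eval \<iota> (\<lambda>i. poly_eval \<iota> \<sigma> (S i)) F"
  using F
  by (induction rule: is_poly_induct)
     (simp_all add: poly_eval_const poly_eval_var poly_eval_add poly_eval_mult \<iota> ring_map_mps_const
       is_poly_poly_eval S)

lemma poly_eval_derivation:
  fixes \<iota> :: "'k :: comm_ring_1 \<Rightarrow> 'a :: comm_ring_1" and \<sigma> :: "'v :: finite \<Rightarrow> 'a"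
  assumes d: "derivation d" "\<And>c. d (\<iota> c) = 0" and \<iota>: "ring_map \<iota>" and p: "is_poly p"
  shows "d (poly_eval \<iota> \<sigma> p) = (\<Sum>i\<in>UNIV. poly_eval \<iota> \<sigma> (mps_deriv i p) * d (\<sigma> i))"
  using p
proof (induction rule: is_poly_induct)
  case (const c)
  then show ?case by (simp add: poly_eval_const \<iota> d poly_eval_0)
next
  case (var i)
  have "poly_eval \<iota> \<sigma> (if j = i then 1 else 0) = (if j = i then 1 else 0)" for j
    by (simp add: poly_eval_0 poly_eval_1 \<iota>)
  then show ?case by (simp add: poly_eval_var \<iota> mps_deriv_var if_distrib if_distribR cong: if_cong)
next
  case (add p q)
  then show ?case by (simp add: poly_eval_add \<iota> is_poly_deriv derivation_add[OF d(1)] distrib_right sum.distrib)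
next
  case (mult p q)
  then show ?case
    by (simp add: poly_eval_mult poly_eval_add \<iota> is_poly_deriv is_poly_mult mps_deriv_mult derivation_mult[OF d(1)]
        distrib_right distrib_left sum.distrib sum_distrib_left sum_distrib_right mult_ac)
qed

text \<open>In characteristic 0 a vanishing derivative means that the variable does not
  occur.\<close>

lemma poly_eval_cong_deriv:
  fixes p :: "('v, 'k :: {idom, ring_char_0}) mps"
  assumes "mps_deriv l p = 0" "\<And>i. i \<noteq> l \<Longrightarrow> \<sigma> i = \<sigma>' i"
  shows "poly_eval \<iota> \<sigma> p = poly_eval \<iota> \<sigma>' p"
  unfolding poly_eval_def
proof (intro sum.cong refl arg_cong2[where f = "(*)"])
  fix M assume M: "M \<in> {M. mps_coeff p M \<noteq> 0}"
  have "l \<notin># M"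
  proof
    assume "l \<in># M"
    then obtain N where N: "M = add_mset l N" by (metis multi_member_split)
    have "mps_coeff (mps_deriv l p) N = 0" by (simp add: assms)
    then show False using M by (simp add: mps_coeff_deriv N del: of_nat_Suc)
  qed
  then have "image_mset \<sigma> M = image_mset \<sigma>' M"
    using assms(2) by (intro image_mset_cong) metis
  then show "(\<Prod>i\<in>#M. \<sigma> i) = (\<Prod>i\<in>#M. \<sigma>' i)" by simp
qed

lemma ring_map_id: "ring_map id" "ring_map (\<lambda>x. x)"
  by (simp_all add: ring_map_def)

lemma ring_map_pCons: "ring_map (\<lambda>c. [:c:])"
  by (simp add: ring_map_def one_pCons)

lemma ring_map_poly: "ring_map (\<lambda>p. poly p x)"
  by (simp add: ring_map_def)

lemma derivation_pderiv: "derivation (pderiv :: 'a :: idom poly \<Rightarrow> _)"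
  by (simp add: derivation_def pderiv_add pderiv_mult mult.commute add.commute)

text \<open>The restriction of a polynomial to the line \<open>z + X e\<close>.\<close>

lemma poly_eval_line:
  fixes \<iota> :: "'k :: comm_ring_1 \<Rightarrow> 'a :: idom" and P :: "('v :: finite, 'k) mps" and z e :: "'v \<Rightarrow> 'a"
  assumes \<iota>: "ring_map \<iota>" and P: "is_poly P"
  defines "g \<equiv> poly_eval (\<lambda>c. [:\<iota> c:]) (\<lambda>j. [:z j, e j:]) P"
  shows "poly g d = poly_eval \<iota> (\<lambda>j. z j + d * e j) P"
    and "poly (pderiv g) d = (\<Sum>j\<in>UNIV. poly_eval \<iota> (\<lambda>j. z j + d * e j) (mps_deriv j P) * e j)"
proof -
  have r: "ring_map (\<lambda>c. [:\<iota> c:])" using ring_map_comp[OF ring_map_pCons \<iota>] .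
  have p: "poly (poly_eval (\<lambda>c. [:\<iota> c:]) (\<lambda>j. [:z j, e j:]) Q) d = poly_eval \<iota> (\<lambda>j. z j + d * e j) Q" for Q
    by (simp add: ring_map_poly_eval[OF ring_map_poly])
  show "poly g d = poly_eval \<iota> (\<lambda>j. z j + d * e j) P" unfolding g_def by (rule p)
  have "pderiv g = (\<Sum>i\<in>UNIV. poly_eval (\<lambda>c. [:\<iota> c:]) (\<lambda>j. [:z j, e j:]) (mps_deriv i P) * pderiv [:z i, e i:])"
    unfolding g_def by (rule poly_eval_derivation[OF derivation_pderiv _ r P]) (simp add: pderiv_pCons)
  then show "poly (pderiv g) d = (\<Sum>j\<in>UNIV. poly_eval \<iota> (\<lambda>j. z j + d * e j) (mps_deriv j P) * e j)"
    by (simp add: poly_sum p pderiv_pCons mult.commute[of "e _"])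
qed

text \<open>Restricted to a line the polynomial becomes univariate, and its first two coefficients
  are the value and the directional derivative.\<close>

lemma poly_eval_taylor:
  fixes \<iota> :: "'k :: comm_ring_1 \<Rightarrow> 'a :: idom" and P :: "('v :: finite, 'k) mps"
  assumes \<iota>: "ring_map \<iota>" and P: "is_poly P"
  obtains R where "poly_eval \<iota> (\<lambda>j. z j + d * e j) P
    = poly_eval \<iota> z P + d * ((\<Sum>j\<in>UNIV. poly_eval \<iota> z (mps_deriv j P) * e j) + d * R)"
proof -
  define g where "g = poly_eval (\<lambda>c. [:\<iota> c:]) (\<lambda>j. [:z j, e j:]) P"
  obtain g0 h where h: "g = pCons g0 h" by (cases g)
  obtain h0 h' where h': "h = pCons h0 h'" by (cases h)
  have "poly g 0 = poly_eval \<iota> z P" "poly (pderiv g) 0 = (\<Sum>j\<in>UNIV. poly_eval \<iota> z (mps_deriv j P) * e j)"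
    unfolding g_def using poly_eval_line[OF assms, of z e 0] by simp_all
  then have "g0 = poly_eval \<iota> z P" "h0 = (\<Sum>j\<in>UNIV. poly_eval \<iota> z (mps_deriv j P) * e j)"
    by (simp_all add: h h' pderiv_pCons)
  moreover have "poly_eval \<iota> (\<lambda>j. z j + d * e j) P = poly g d"
    unfolding g_def using poly_eval_line(1)[OF assms] by simp
  ultimately show ?thesis by (intro that[of "poly h' d"]) (simp add: h h')
qed

lemma vec_nth_lambda: "($) (\<chi> j. h j) = h"
  by (rule ext) simp

lemma poly_at_simps:
  shows "poly_at (mps_const c) x = c" "poly_at 0 x = 0" "poly_at 1 x = 1" "poly_at (mps_var i) x = x $ i"
    "is_poly p \<Longrightarrow> is_poly q \<Longrightarrow> poly_at (p + q) x = poly_at p x + poly_at q x"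
    "is_poly p \<Longrightarrow> is_poly q \<Longrightarrow> poly_at (p * q) x = poly_at p x * poly_at q x"
  by (simp_all add: poly_at_def poly_eval_const poly_eval_0 poly_eval_1 poly_eval_var poly_eval_add poly_eval_mult ring_map_id)

lemma poly_at_0:
  fixes p :: "('v :: finite, 'k :: field) mps"
  shows "is_poly p \<Longrightarrow> poly_at p 0 = mps_coeff p {#}"
proof -
  assume "is_poly p"
  then have fin: "finite {M. mps_coeff p M \<noteq> 0}" by (simp add: is_poly_def)
  have "(\<Prod>i\<in>#M. (0 :: 'k)) = (if M = {#} then 1 else 0)" for M :: "'v multiset"
    by (cases M) auto
  then have "poly_at p 0 = (\<Sum>M | mps_coeff p M \<noteq> 0. if M = {#} then mps_coeff p {#} else 0)"
    unfolding poly_at_def poly_eval_def by (intro sum.cong) (auto cong: image_mset_cong)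
  then show ?thesis using fin by auto
qed

lemma poly_at_poly_eval:
  assumes "\<And>i. is_poly (S i)" "is_poly F"
  shows "poly_at (poly_eval mps_const S F) x = poly_at F (\<chi> i. poly_at (S i) x)"
  using poly_eval_poly_eval[OF ring_map_id(1) assms] by (simp add: poly_at_def)

text \<open>Vanishing everywhere is inherited by partial derivatives, by restricting to coordinate
  lines over an infinite field; so all derivatives vanish at the origin.\<close>

lemma poly_eq_0I:
  fixes P :: "('v :: finite, 'k :: field_char_0) mps"
  assumes "is_poly P" "\<And>x. poly_at P x = 0"
  shows "P = 0"
proof (rule mps_eqI_deriv)
  have step: "poly_at (mps_deriv i Q) x = 0" if Q: "is_poly Q" "\<And>x. poly_at Q x = 0" for Q :: "('v, 'k) mps" and i x
  proof -
    define g where "g = poly_eval (\<lambda>c. [:id c:]) (\<lambda>j. [:x $ j, if j = i then 1 else 0:]) Q"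
    have "poly g c = poly_at Q (\<chi> j. x $ j + c * (if j = i then 1 else 0))" for c
      unfolding g_def poly_eval_line(1)[OF ring_map_id(1) Q(1)] poly_at_def vec_nth_lambda ..
    then have "poly g c = 0" for c using Q(2) by simp
    then have "g = 0" by (simp add: poly_all_0_iff_0[symmetric])
    then have "poly (pderiv g) 0 = 0" by simp
    then have "(\<Sum>j\<in>UNIV. poly_at (mps_deriv j Q) x * (if j = i then 1 else 0)) = 0"
      unfolding g_def poly_eval_line(2)[OF ring_map_id(1) Q(1)] poly_at_def by simp
    then show ?thesis by (simp add: if_distrib cong: if_cong)
  qed
  fix l :: "'v list"
  have "is_poly (foldr mps_deriv l P) \<and> (\<forall>x. poly_at (foldr mps_deriv l P) x = 0)"
    by (induction l) (auto simp: assms is_poly_deriv step)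
  then have "mps_coeff (foldr mps_deriv l P) {#} = 0" using poly_at_0 by metis
  moreover have "foldr mps_deriv l (0 :: ('v, 'k) mps) = 0" by (induction l) auto
  ultimately show "mps_coeff (foldr mps_deriv l P) {#} = mps_coeff (foldr mps_deriv l 0) {#}" by simp
qed

section \<open>Algebraic dependence\<close>

text \<open>Gaussian elimination: the equation \<open>t0\<close> is solved for an unknown
  \<open>s0\<close> occurring in it.\<close>

lemma underdetermined_system:
  fixes a :: "'s \<Rightarrow> 't \<Rightarrow> 'k :: field"
  assumes "finite T" "finite S" "card T < card S"
  shows "\<exists>c. (\<exists>s\<in>S. c s \<noteq> 0) \<and> (\<forall>t\<in>T. (\<Sum>s\<in>S. c s * a s t) = 0)"
  using assms
proof (induction T arbitrary: S a rule: finite_induct)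
  case empty
  then obtain s where "s \<in> S" by fastforce
  then show ?case by (intro exI[of _ "\<lambda>_. 1"]) auto
next
  case (insert t0 T)
  show ?case
  proof (cases "\<forall>s\<in>S. a s t0 = 0")
    case True
    then show ?thesis using insert.IH[of S a] insert.prems insert.hyps by auto
  next
    case False
    then obtain s0 where s0: "s0 \<in> S" "a s0 t0 \<noteq> 0" by blast
    define a' where "a' s t = a s t - a s t0 / a s0 t0 * a s0 t" for s t
    have "card T < card (S - {s0})" using insert.prems insert.hyps s0 by (simp add: card_Diff_singleton)
    then obtain c where c: "\<exists>s\<in>S - {s0}. c s \<noteq> 0" "\<forall>t\<in>T. (\<Sum>s\<in>S - {s0}. c s * a' s t) = 0"
      using insert.IH[of "S - {s0}" a'] insert.prems by auto
    define c' where "c' = c(s0 := - (\<Sum>s\<in>S - {s0}. c s * (a s t0 / a s0 t0)))"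
    have sum: "(\<Sum>s\<in>S. c' s * a s t) = (\<Sum>s\<in>S - {s0}. c s * a' s t)" for t
    proof -
      have "(\<Sum>s\<in>S. c' s * a s t) = c' s0 * a s0 t + (\<Sum>s\<in>S - {s0}. c' s * a s t)"
        using insert.prems s0 by (simp add: sum.remove)
      also have "(\<Sum>s\<in>S - {s0}. c' s * a s t) = (\<Sum>s\<in>S - {s0}. c s * a s t)"
        by (intro sum.cong) (auto simp: c'_def)
      finally show ?thesis
        by (simp add: c'_def a'_def right_diff_distrib sum_subtractf sum_distrib_right mult.assoc)
    qed
    have "a' s t0 = 0" for s using s0 by (simp add: a'_def)
    then have "\<forall>t\<in>insert t0 T. (\<Sum>s\<in>S. c' s * a s t) = 0" using c(2) by (simp add: sum)
    moreover have "\<exists>s\<in>S. c' s \<noteq> 0" using c(1) by (auto simp: c'_def)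
    ultimately show ?thesis by blast
  qed
qed

lemma bij_count_multiset: "bij (count :: 'v :: finite multiset \<Rightarrow> _)"
proof (rule bijI)
  show "inj (count :: 'v multiset \<Rightarrow> _)" by (auto simp: inj_def multiset_eq_iff)
  show "surj (count :: 'v multiset \<Rightarrow> _)"
  proof (rule surjI)
    fix f :: "'v \<Rightarrow> nat"
    show "count (Abs_multiset f) = f" by (rule Abs_multiset_inverse) simp
  qed
qed

lemma card_multisets_bounded: "card {M :: 'v :: finite multiset. \<forall>i. count M i \<le> N} = Suc N ^ CARD('v)"
  and finite_multisets_bounded: "finite {M :: 'v :: finite multiset. \<forall>i. count M i \<le> N}"
proof -
  have img: "count ` {M :: 'v multiset. \<forall>i. count M i \<le> N} = (UNIV \<rightarrow>\<^sub>E {..N})"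
  proof -
    have "f \<in> count ` {M :: 'v multiset. \<forall>i. count M i \<le> N}" if f: "\<And>i. f i \<le> N" for f :: "'v \<Rightarrow> nat"
    proof -
      obtain M where "f = count M" using bij_count_multiset by (metis bij_pointE)
      then show ?thesis using f by auto
    qed
    then show ?thesis by (auto simp: PiE_UNIV_domain)
  qed
  have inj: "inj_on count {M :: 'v multiset. \<forall>i. count M i \<le> N}"
    using bij_count_multiset by (auto simp: bij_def intro: inj_on_subset)
  show "finite {M :: 'v multiset. \<forall>i. count M i \<le> N}"
    using inj by (rule finite_imageD[rotated]) (auto simp: img finite_PiE)
  have "card {M :: 'v multiset. \<forall>i. count M i \<le> N} = card ((UNIV :: 'v set) \<rightarrow>\<^sub>E {..N})"
    using card_image[OF inj] by (simp add: img)
  then show "card {M :: 'v multiset. \<forall>i. count M i \<le> N} = Suc N ^ CARD('v)"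
    by (simp add: card_PiE)
qed

lemma poly_degree_bound:
  assumes "is_poly p"
  obtains d where "\<And>M. mps_coeff p M \<noteq> 0 \<Longrightarrow> size M \<le> d"
proof -
  have "finite (size ` {M. mps_coeff p M \<noteq> 0})" using assms by (simp add: is_poly_def)
  then show ?thesis using that[of "Max (insert 0 (size ` {M. mps_coeff p M \<noteq> 0}))"] by auto
qed

text \<open>Dimension count: products of the \<open>w i\<close> with bounded exponents outnumber the
  monomials that occur in them, because there are more \<open>w i\<close> than variables.\<close>

lemma algebraic_dependence:
  fixes w :: "'w :: finite \<Rightarrow> ('v :: finite, 'k :: field) mps"
  assumes w: "\<And>i. is_poly (w i)" and card: "CARD('v) < CARD('w)"
  obtains P where "is_poly P" "P \<noteq> 0" "poly_eval mps_const w P = 0"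
proof -
  have "\<exists>d. \<forall>i M. mps_coeff (w i) M \<noteq> 0 \<longrightarrow> size M \<le> d"
  proof -
    have "\<forall>i. \<exists>d. \<forall>M. mps_coeff (w i) M \<noteq> 0 \<longrightarrow> size M \<le> d" using poly_degree_bound[OF w] by metis
    then obtain d where d: "\<And>i M. mps_coeff (w i) M \<noteq> 0 \<Longrightarrow> size M \<le> d i" by metis
    have "size M \<le> (\<Sum>i\<in>UNIV. d i)" if "mps_coeff (w i) M \<noteq> 0" for i M
      using d[OF that] member_le_sum[of i UNIV d] by simp
    then show ?thesis by blast
  qed
  then obtain d where d: "\<And>i M. mps_coeff (w i) M \<noteq> 0 \<Longrightarrow> size M \<le> d" by blast
  have deg: "size N \<le> d * size M" if "mps_coeff (\<Prod>i\<in>#M. w i) N \<noteq> 0" for M N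
    using that
  proof (induction M arbitrary: N)
    case empty
    then show ?case by (simp add: mps_coeff_1 split: if_splits)
  next
    case (add x M)
    then have "(\<Sum>A | A \<subseteq># N. mps_coeff (w x) A * mps_coeff (\<Prod>i\<in>#M. w i) (N - A)) \<noteq> 0" by (simp add: mps_coeff_mult)
    then obtain A where A: "A \<subseteq># N" "mps_coeff (w x) A * mps_coeff (\<Prod>i\<in>#M. w i) (N - A) \<noteq> 0"
      by (auto elim!: sum.not_neutral_contains_not_neutral)
    then have "size A \<le> d" "size (N - A) \<le> d * size M" using d add.IH by auto
    moreover have "size N = size A + size (N - A)" using A(1) by (metis size_union subset_mset.add_diff_inverse)
    ultimately show ?case by simp
  qed
  define D where "D = Suc (d * CARD('w))"
  \<comment> \<open>Chosen so that \<open>(D * Suc N) ^ CARD('v) = N * Suc N ^ CARD('v)\<close>,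
    which is less than \<open>Suc N ^ CARD('w)\<close>.\<close>
  define N where "N = D ^ CARD('v)"
  define S where "S = {M :: 'w multiset. \<forall>i. count M i \<le> N}"
  define T where "T = {M :: 'v multiset. \<forall>i. count M i \<le> d * CARD('w) * N}"
  have fin: "finite S" "finite T" by (simp_all add: S_def T_def finite_multisets_bounded)
  have "Suc (d * CARD('w) * N) \<le> D * Suc N" by (simp add: D_def)
  then have "card T \<le> (D * Suc N) ^ CARD('v)"
    unfolding T_def card_multisets_bounded by (intro power_mono) auto
  also have "\<dots> = N * Suc N ^ CARD('v)" by (simp only: power_mult_distrib N_def)
  also have "\<dots> < Suc N * Suc N ^ CARD('v)" by simp
  also have "\<dots> \<le> Suc N ^ CARD('w)" 
    using card power_increasing[of "Suc CARD('v)" "CARD('w)" "Suc N"] by simp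
  finally have "card T < card S" by (simp add: S_def card_multisets_bounded)
  then obtain c where c: "\<exists>M\<in>S. c M \<noteq> 0" "\<forall>A\<in>T. (\<Sum>M\<in>S. c M * mps_coeff (\<Prod>i\<in>#M. w i) A) = 0"
    using underdetermined_system[OF fin(2,1), of "\<lambda>M. mps_coeff (\<Prod>i\<in>#M. w i)"] by auto
  define P where "P = Abs_mps (\<lambda>M. if M \<in> S then c M else 0)"
  have P: "is_poly P" unfolding is_poly_def P_def by (rule finite_subset[OF _ fin(1)]) auto
  have "P \<noteq> 0" using c(1) by (auto simp: P_def mps_eq_iff)
  have "poly_eval mps_const w P = (\<Sum>M\<in>S. mps_const (mps_coeff P M) * (\<Prod>i\<in>#M. w i))"
    by (rule poly_eval_superset[OF ring_map_mps_const fin(1)]) (auto simp: P_def)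
  also have "\<dots> = 0"
  proof (rule mps_eqI)
    fix A
    have "mps_coeff (\<Sum>M\<in>S. mps_const (mps_coeff P M) * (\<Prod>i\<in>#M. w i)) A = (\<Sum>M\<in>S. c M * mps_coeff (\<Prod>i\<in>#M. w i) A)"
      unfolding mps_coeff_sum by (intro sum.cong) (auto simp: mps_coeff_const_mult P_def)
    also have "\<dots> = 0"
    proof (cases "A \<in> T")
      case False
      have "mps_coeff (\<Prod>i\<in>#M. w i) A = 0" if M: "M \<in> S" for M
      proof (rule ccontr)
        assume "mps_coeff (\<Prod>i\<in>#M. w i) A \<noteq> 0"
        from deg[OF this] have "size A \<le> d * size M" .
        also have "size M = (\<Sum>i\<in>UNIV. count M i)"
          unfolding size_multiset_overloaded_eq by (rule sum.mono_neutral_left) (auto simp: not_in_iff)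
        also have "d * (\<Sum>i\<in>UNIV. count M i) \<le> d * (CARD('w) * N)"
          using M sum_bounded_above[of UNIV "count M" N] by (intro mult_left_mono) (auto simp: S_def)
        finally have "count A i \<le> d * CARD('w) * N" for i
          using count_le_size[of A i] by (simp add: mult.assoc)
        then show False using False by (simp add: T_def)
      qed
      then show ?thesis by simp
    qed (use c in auto)
    finally show "mps_coeff (\<Sum>M\<in>S. mps_const (mps_coeff P M) * (\<Prod>i\<in>#M. w i)) A = mps_coeff 0 A" by simp
  qed
  finally show ?thesis using that P \<open>P \<noteq> 0\<close> by blast
qed

section \<open>Generic points of a cone with a quadratic parametrization\<close>

lemma singular_matrix_kernel:
  fixes A :: "'a :: field ^ 'n ^ 'n"
  assumes "det A = 0"
  obtains \<xi> l where "A *v \<xi> = 0" "\<xi> $ l \<noteq> 0"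
proof -
  have "\<not> (\<forall>\<xi>. A *v \<xi> = 0 \<longrightarrow> \<xi> = 0)"
    using assms by (simp add: matrix_left_invertible_ker[symmetric] invertible_left_inverse[symmetric] invertible_det_nz)
  then show ?thesis using that by (auto simp: vec_eq_iff)
qed

locale quadratic_cone =
  fixes C :: "('k :: {alg_closed_field, field_char_0} ^ 'n :: finite option option) set"
    and a :: "'n option option \<Rightarrow> 'n option \<Rightarrow> 'n option \<Rightarrow> 'k"
  assumes nondegenerate: "nondegenerate_cone C"
    and param: "quadratic_parametrization C a"
begin

lemma a_sym: "a i j k = a i k j"
  using param by (simp add: quadratic_parametrization_def)

definition x :: "'n option option \<Rightarrow> ('n option, 'k) mps" where
  "x i = mps_const (1 / 2) * polar mps_const (a i) mps_var mps_var"

text \<open>\<open>polar id (a i)\<close> applied to \<open>b\<close> and \<open>\<xi>\<close> is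
  the differential of the \<open>i\<close>-th coordinate at \<open>b\<close> in direction
  \<open>\<xi>\<close>, so this is injectivity of the differential of the parametrization.\<close>

definition immersive_at :: "'k ^ 'n option \<Rightarrow> bool" where
  "immersive_at b \<longleftrightarrow> (\<forall>\<xi>. (\<forall>i. polar id (a i) (($) b) \<xi> = 0) \<longrightarrow> (\<forall>k. \<xi> k = 0))"

lemma is_poly_x: "is_poly (x i)"
  unfolding x_def polar_def by (intro is_poly_mult is_poly_sum is_poly_const is_poly_var)

lemma poly_eval_x:
  assumes "ring_map \<iota>"
  shows "poly_eval \<iota> \<sigma> (x i) = \<iota> (1 / 2) * polar \<iota> (a i) \<sigma> \<sigma>"
  unfolding x_def polar_def
  by (simp add: poly_eval_mult poly_eval_sum poly_eval_const poly_eval_var assms is_poly_mult is_poly_sum)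

lemma poly_at_x: "poly_at (x i) b = quad_map a id b $ i"
  by (simp add: poly_at_def poly_eval_x[OF ring_map_id(1)] quad_map_nth)

lemma deriv_x: "mps_deriv k (x i) = (\<Sum>j\<in>UNIV. mps_const (a i j k) * mps_var j)"
proof -
  have v: "(\<lambda>j. mps_deriv k (mps_var j)) = (\<lambda>j. if j = k then 1 else 0 :: ('n option, 'k) mps)"
    by (auto simp: mps_deriv_var)
  have p: "polar mps_const (a i) mps_var (\<lambda>j. if j = k then 1 else 0 :: ('n option, 'k) mps) = (\<Sum>j\<in>UNIV. mps_const (a i j k) * mps_var j)"
    by (simp add: polar_def if_distrib cong: if_cong)
  have "mps_deriv k (polar mps_const (a i) mps_var mps_var) = 2 * (\<Sum>j\<in>UNIV. mps_const (a i j k) * mps_var j)"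
    by (subst polar_derivation[OF derivation_mps_deriv])
       (simp_all add: v p polar_commute[of "a i" mps_const "\<lambda>j. if j = k then 1 else 0", OF a_sym])
  then show ?thesis
    by (simp add: x_def mult.assoc[symmetric] mps_numeral mps_const_mult[symmetric])
qed

text \<open>The comorphism of the parametrization; its kernel turns out to be the ideal of
  \<open>C\<close>.\<close>

definition pull :: "('n option option, 'k) mps \<Rightarrow> ('n option, 'k) mps" where
  "pull P = poly_eval mps_const x P"

lemma is_poly_pull: "is_poly (pull P)"
  unfolding pull_def by (rule is_poly_poly_eval[OF is_poly_x])

lemma poly_at_pull: "is_poly P \<Longrightarrow> poly_at (pull P) b = poly_at P (quad_map a id b)"
  unfolding pull_def by (subst poly_at_poly_eval[OF is_poly_x]) (simp_all add: poly_at_x)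

lemma pull_mult: "is_poly P \<Longrightarrow> is_poly Q \<Longrightarrow> pull (P * Q) = pull P * pull Q"
  unfolding pull_def by (rule poly_eval_mult[OF ring_map_mps_const])

lemma quad_map_in_C: "quad_map a id b \<in> C"
  using param by (auto simp: quadratic_parametrization_def)

lemma C_nonempty: "C \<noteq> {}"
  using nondegenerate by (simp add: nondegenerate_cone_def conical_hypersurface_def)

text \<open>The image of the parametrization is Zariski dense in \<open>C\<close>. Since the target
  of \<open>pull\<close> is a domain, this also makes \<open>C\<close> irreducible.\<close>

lemma vanishes_iff:
  assumes "is_poly P"
  shows "(\<forall>p\<in>C. poly_at P p = 0) \<longleftrightarrow> pull P = 0"
proof
  assume "\<forall>p\<in>C. poly_at P p = 0"
  then show "pull P = 0"
    by (intro poly_eq_0I is_poly_pull) (simp add: poly_at_pull[OF assms] quad_map_in_C)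
next
  assume "pull P = 0"
  then have P: "poly_at P (quad_map a id b) = 0" for b
    by (simp add: poly_at_pull[OF assms, symmetric] poly_at_simps)
  obtain W where W: "C \<subseteq> zariski_closure (C - W)" "\<forall>p\<in>C - W. p \<in> range (quad_map a id)"
    using param by (auto simp: quadratic_parametrization_def generically_def)
  have "\<forall>y\<in>C - W. poly_at P y = 0" using W(2) P by (metis rangeE)
  then show "\<forall>p\<in>C. poly_at P p = 0" using W(1) assms by (auto simp: zariski_closure_def)
qed

lemma zariski_closed_zeros:
  assumes "is_poly (G :: ('v :: finite, 'k) mps)"
  shows "zariski_closure {p. poly_at G p = 0} = {p. poly_at G p = 0}"
  using assms by (auto simp: zariski_closure_def)

text \<open>If \<open>P\<close> vanishes where \<open>G\<close> does not, then \<open>P * G\<close>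
  vanishes on \<open>C\<close>, and irreducibility removes \<open>G\<close>. Together with the
  converse below, generic conditions can be combined by multiplying polynomials.\<close>

lemma generically_C_I:
  assumes G: "is_poly G" "pull G \<noteq> 0" and Q: "\<And>p. p \<in> C \<Longrightarrow> poly_at G p \<noteq> 0 \<Longrightarrow> Q p"
  shows "generically C Q"
  unfolding generically_def
proof (intro exI[of _ "{p. poly_at G p = 0}"] conjI)
  show "zariski_closure {p. poly_at G p = 0} = {p. poly_at G p = 0}"
    by (rule zariski_closed_zeros[OF G(1)])
  show "C \<subseteq> zariski_closure (C - {p. poly_at G p = 0})"
    unfolding zariski_closure_def
  proof (intro subsetI CollectI allI impI)
    fix p P assume p: "p \<in> C" and P: "is_poly P \<and> (\<forall>y\<in>C - {p. poly_at G p = 0}. poly_at P y = 0)"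
    then have "\<forall>y\<in>C. poly_at (P * G) y = 0" by (auto simp: poly_at_simps G(1))
    then have "pull (P * G) = 0" using P G(1) by (simp add: vanishes_iff is_poly_mult)
    then have "pull P = 0" using P G by (simp add: pull_mult)
    then show "poly_at P p = 0" using P p vanishes_iff by blast
  qed
qed (use Q in auto)

text \<open>A closed set with dense complement in the non-empty \<open>C\<close> cannot contain
  \<open>C\<close>, so some polynomial vanishes on it but not on \<open>C\<close>.\<close>

lemma generically_C_E:
  assumes "generically C Q"
  shows "\<exists>G. is_poly G \<and> pull G \<noteq> 0 \<and> (\<forall>p\<in>C. poly_at G p \<noteq> 0 \<longrightarrow> Q p)"
proof -
  obtain W where W: "zariski_closure W = W" "C \<subseteq> zariski_closure (C - W)" "\<forall>p\<in>C - W. Q p"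
    using assms by (auto simp: generically_def)
  have "\<exists>G. is_poly G \<and> (\<forall>y\<in>W. poly_at G y = 0) \<and> pull G \<noteq> 0"
  proof (rule ccontr)
    assume "\<not> ?thesis"
    then have "\<And>G. is_poly G \<Longrightarrow> (\<forall>y\<in>W. poly_at G y = 0) \<Longrightarrow> (\<forall>p\<in>C. poly_at G p = 0)"
      using vanishes_iff by blast
    then have "C \<subseteq> zariski_closure W" by (auto simp: zariski_closure_def)
    then have "C - W = {}" using W(1) by auto
    moreover have "zariski_closure ({} :: ('k ^ 'n option option) set) = {}"
      by (auto simp: zariski_closure_def poly_at_simps intro!: exI[of _ 1])
    ultimately show False using W(2) C_nonempty by (metis subset_empty)
  qed
  then obtain G where "is_poly G" "\<forall>y\<in>W. poly_at G y = 0" "pull G \<noteq> 0" by blast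
  then show ?thesis using W(3) by (intro exI[of _ G]) auto
qed

lemma generically_UNIV_I:
  assumes G: "is_poly (G :: ('v :: finite, 'k) mps)" "G \<noteq> 0" and Q: "\<And>p. poly_at G p \<noteq> 0 \<Longrightarrow> Q p"
  shows "generically UNIV Q"
  unfolding generically_def
proof (intro exI[of _ "{p. poly_at G p = 0}"] conjI)
  show "zariski_closure {p. poly_at G p = 0} = {p. poly_at G p = 0}"
    by (rule zariski_closed_zeros[OF G(1)])
  show "UNIV \<subseteq> zariski_closure (UNIV - {p. poly_at G p = 0})"
    unfolding zariski_closure_def
  proof (intro subsetI CollectI allI impI)
    fix p P assume P: "is_poly P \<and> (\<forall>y\<in>UNIV - {p. poly_at G p = 0}. poly_at P y = 0)"
    then have "P * G = 0"
      by (intro poly_eq_0I is_poly_mult G) (auto simp: poly_at_simps G(1))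
    then show "poly_at P p = 0" using G(2) by (simp add: poly_at_simps)
  qed
qed (use Q in auto)

text \<open>Since \<open>F\<close> involves the coordinate \<open>\<rho> None\<close>, every line in that direction meets \<open>C\<close>, so the
  other coordinates of the parametrization are algebraically independent.\<close>

lemma coordinates_independent:
  fixes \<rho> :: "'n option option \<Rightarrow> 'n option option"
  assumes F: "reduced_equation C F" "mps_deriv (\<rho> None) F \<noteq> 0" and \<rho>: "bij \<rho>"
    and P: "is_poly P" "mps_deriv None P = 0" and w: "\<And>i. w (Some i) = x (\<rho> (Some i))"
    and 0: "poly_eval mps_const w P = 0"
  shows "P = 0"
proof -
  have F': "is_poly F" "C = {z. poly_at F z = 0}" using F(1) by (auto simp: reduced_equation_def)
  define P' where "P' = poly_eval mps_const (\<lambda>k. mps_var (\<rho> k)) P"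
  have P': "is_poly P'" unfolding P'_def by (rule is_poly_poly_eval) simp
  have at: "poly_at P' z = poly_eval id (\<lambda>k. z $ \<rho> k) P" for z
    unfolding P'_def using poly_at_poly_eval[of "\<lambda>k. mps_var (\<rho> k)" P z] P(1)
    by (simp add: poly_at_simps) (simp add: poly_at_def vec_nth_lambda)
  have "pull P' = poly_eval mps_const (\<lambda>k. x (\<rho> k)) P"
    unfolding pull_def P'_def by (subst poly_eval_poly_eval[OF ring_map_mps_const]) (simp_all add: P poly_eval_var ring_map_mps_const)
  also have "\<dots> = poly_eval mps_const w P"
    by (rule poly_eval_cong_deriv[OF P(2)]) (metis w not_None_eq)
  finally have "pull P' = 0" using 0 by simp
  then have van: "\<forall>p\<in>C. poly_at P' p = 0" using vanishes_iff[OF P'] by simp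
  have "poly_at P' z = 0" if z: "poly_at (mps_deriv (\<rho> None) F) z \<noteq> 0" for z
  proof -
    define e :: "'n option option \<Rightarrow> 'k" where "e j = (if j = \<rho> None then 1 else 0)" for j
    define g where "g = poly_eval (\<lambda>c. [:id c:]) (\<lambda>j. [:z $ j, e j:]) F"
    have "poly (pderiv g) 0 = poly_at (mps_deriv (\<rho> None) F) z"
      unfolding g_def poly_eval_line(2)[OF ring_map_id(1) F'(1)]
      by (simp add: e_def poly_at_def if_distrib cong: if_cong)
    then have "pderiv g \<noteq> 0" using z by auto
    then have "degree g > 0" by (metis pderiv_eq_0_iff gr0I)
    then obtain c where "poly g c = 0" using alg_closed_imp_poly_has_root by blast
    then have "(\<chi> j. z $ j + c * e j) \<in> C"
      unfolding g_def poly_eval_line(1)[OF ring_map_id(1) F'(1)] by (simp add: F'(2) poly_at_def vec_nth_lambda)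
    then have "poly_at P' (\<chi> j. z $ j + c * e j) = 0" using van by blast
    moreover have "poly_at P' (\<chi> j. z $ j + c * e j) = poly_at P' z"
      unfolding at
    proof (rule poly_eval_cong_deriv[OF P(2)])
      fix k :: "'n option option" assume "k \<noteq> None"
      then have "\<rho> k \<noteq> \<rho> None" using \<rho> by (metis bij_is_inj inj_eq)
      then show "(\<chi> j. z $ j + c * e j) $ \<rho> k = z $ \<rho> k" by (simp add: e_def)
    qed
    ultimately show ?thesis by simp
  qed
  then have "P' * mps_deriv (\<rho> None) F = 0"
    by (intro poly_eq_0I is_poly_mult P' is_poly_deriv F') (auto simp: poly_at_simps P' is_poly_deriv F')
  then have "P' = 0" using F(2) by simp
  show "P = 0"
  proof (rule poly_eq_0I[OF P(1)])
    fix y :: "'k ^ 'n option option"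
    have "(\<lambda>k. (\<chi> k. y $ inv \<rho> k) $ \<rho> k) = ($) y" using \<rho> by (auto simp: fun_eq_iff bij_is_inj)
    then have "poly_at P y = poly_at P' (\<chi> k. y $ inv \<rho> k)"
      unfolding at by (simp only: poly_at_def)
    then show "poly_at P y = 0" using \<open>P' = 0\<close> by (simp add: poly_at_simps)
  qed
qed

text \<open>A relation of least degree is a separable equation of \<open>w None\<close> over the other \<open>w i\<close>.\<close>

lemma minimal_relation:
  fixes w :: "'n option option \<Rightarrow> ('n option, 'k) mps"
  assumes "\<And>i. is_poly (w i)"
  shows "\<exists>P d. is_poly P \<and> P \<noteq> 0 \<and> poly_eval mps_const w P = 0 \<and> (\<forall>M. mps_coeff P M \<noteq> 0 \<longrightarrow> size M \<le> d) \<and>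
    (\<forall>Q. is_poly Q \<longrightarrow> poly_eval mps_const w Q = 0 \<longrightarrow> (\<forall>M. mps_coeff Q M \<noteq> 0 \<longrightarrow> size M < d) \<longrightarrow> Q = 0)"
proof -
  define rel where "rel d \<longleftrightarrow> (\<exists>P. is_poly P \<and> P \<noteq> 0 \<and> poly_eval mps_const w P = 0 \<and> (\<forall>M. mps_coeff P M \<noteq> 0 \<longrightarrow> size M \<le> d))" for d
  have "CARD('n option) < CARD('n option option)" by (simp add: card_UNIV_option)
  then obtain P0 where P0: "is_poly P0" "P0 \<noteq> 0" "poly_eval mps_const w P0 = 0"
    using algebraic_dependence[of w] assms by blast
  obtain d0 where "\<And>M. mps_coeff P0 M \<noteq> 0 \<Longrightarrow> size M \<le> d0" using poly_degree_bound[OF P0(1)] by blast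
  then have "rel d0" using P0 by (auto simp: rel_def)
  then have r: "rel (LEAST d. rel d)" by (rule LeastI)
  define d where "d = (LEAST d. rel d)"
  obtain P where P: "is_poly P" "P \<noteq> 0" "poly_eval mps_const w P = 0" "\<And>M. mps_coeff P M \<noteq> 0 \<Longrightarrow> size M \<le> d"
    using r by (auto simp: rel_def d_def)
  have "Q = 0" if Q: "is_poly Q" "poly_eval mps_const w Q = 0" "\<And>M. mps_coeff Q M \<noteq> 0 \<Longrightarrow> size M < d" for Q
  proof (rule ccontr)
    assume "Q \<noteq> 0"
    then obtain M where "mps_coeff Q M \<noteq> 0" by (auto simp: mps_eq_iff)
    then have "0 < d" using Q(3) by fastforce
    have "size M \<le> d - 1" if "mps_coeff Q M \<noteq> 0" for M using Q(3)[OF that] by simp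
    then have "rel (d - 1)" using Q \<open>Q \<noteq> 0\<close> by (auto simp: rel_def)
    then have "d \<le> d - 1" unfolding d_def by (rule Least_le)
    then show False using \<open>0 < d\<close> by simp
  qed
  with P show ?thesis by blast
qed

section \<open>Ramification of the coordinate projections\<close>

definition jacobian :: "('n option option \<Rightarrow> 'n option option) \<Rightarrow> ('n option, 'k) mps" where
  "jacobian \<rho> = det (\<chi> i k. mps_deriv k (x (\<rho> (Some i))))"

lemma is_poly_jacobian: "is_poly (jacobian \<rho>)"
  unfolding jacobian_def by (intro is_poly_det) (simp add: is_poly_deriv[OF is_poly_x])

text \<open>Otherwise a kernel vector over the fraction field gives a derivation killing the
  coordinates \<open>x (\<rho> (Some i))\<close> but not some \<open>u\<^sub>l\<close>. Applied to a
  least-degree relation of \<open>u\<^sub>l\<close> over them, it makes the derivative in that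
  variable a relation of smaller degree, hence zero; then the coordinates alone are
  dependent.\<close>

lemma jacobian_nonzero:
  assumes F: "reduced_equation C F" "mps_deriv (\<rho> None) F \<noteq> 0" and \<rho>: "bij \<rho>"
  shows "jacobian \<rho> \<noteq> 0"
proof
  assume "jacobian \<rho> = 0"
  then have "det (\<chi> i k. to_fract (mps_deriv k (x (\<rho> (Some i))))) = 0"
    using ring_map_det[OF ring_map_to_fract, of "\<chi> i k. mps_deriv k (x (\<rho> (Some i)))"] by (simp add: jacobian_def)
  then obtain \<xi> l where \<xi>: "(\<chi> i k. to_fract (mps_deriv k (x (\<rho> (Some i))))) *v \<xi> = 0" "\<xi> $ l \<noteq> 0"
    by (rule singular_matrix_kernel)
  define dd where "dd p = (\<Sum>k\<in>UNIV. to_fract (mps_deriv k p) * \<xi> $ k)" for p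
  have dx: "dd (x (\<rho> (Some i))) = 0" for i
    using \<xi>(1) by (simp add: vec_eq_iff matrix_vector_mult_def dd_def)
  define w where "w i = (case i of None \<Rightarrow> mps_var l | Some i \<Rightarrow> x (\<rho> (Some i)))" for i
  have w: "is_poly (w i)" for i by (auto simp: w_def is_poly_x split: option.splits)
  obtain P d where P: "is_poly P" "P \<noteq> 0" "poly_eval mps_const w P = 0" "\<And>M. mps_coeff P M \<noteq> 0 \<Longrightarrow> size M \<le> d"
    and min: "\<And>Q. is_poly Q \<Longrightarrow> poly_eval mps_const w Q = 0 \<Longrightarrow> (\<And>M. mps_coeff Q M \<noteq> 0 \<Longrightarrow> size M < d) \<Longrightarrow> Q = 0"
    using minimal_relation[of w] w by blast
  have "0 = dd (poly_eval mps_const w P)" using P(3) by (simp add: dd_def)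
  also have "\<dots> = (\<Sum>k\<in>UNIV. \<Sum>i\<in>UNIV. to_fract (poly_eval mps_const w (mps_deriv i P)) * (to_fract (mps_deriv k (w i)) * \<xi> $ k))"
    unfolding dd_def
    by (subst poly_eval_derivation[OF derivation_mps_deriv mps_deriv_const ring_map_mps_const P(1)])
       (simp add: ring_map_sum[OF ring_map_to_fract] to_fract_mult sum_distrib_right mult.assoc)
  also have "\<dots> = (\<Sum>i\<in>UNIV. to_fract (poly_eval mps_const w (mps_deriv i P)) * dd (w i))"
    unfolding dd_def sum_distrib_left by (rule sum.swap)
  also have "\<dots> = to_fract (poly_eval mps_const w (mps_deriv None P)) * \<xi> $ l"
  proof -
    have "dd (mps_var l) = \<xi> $ l"
      by (simp add: dd_def mps_deriv_var if_distrib if_distribR cong: if_cong)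
    then show ?thesis by (simp add: sum_option w_def dx)
  qed
  finally have "poly_eval mps_const w (mps_deriv None P) = 0" using \<xi>(2) by simp
  moreover have "size M < d" if "mps_coeff (mps_deriv None P) M \<noteq> 0" for M
  proof -
    have "mps_coeff P (add_mset None M) \<noteq> 0" using that by (auto simp: mps_coeff_deriv)
    from P(4)[OF this] show ?thesis by simp
  qed
  ultimately have "mps_deriv None P = 0" by (intro min is_poly_deriv P)
  then have "P = 0"
    by (intro coordinates_independent[OF F \<rho> P(1) _ _ P(3)]) (simp_all add: w_def)
  then show False using P(2) by simp
qed

text \<open>The image of the ramification locus is not dense: \<open>jacobian \<rho>\<close> satisfies an equation over the
  coordinates of \<open>C\<close> whose constant term does not vanish identically.\<close>

lemma branch_polynomial:
  assumes F: "reduced_equation C F" "mps_deriv (\<rho> None) F \<noteq> 0" and \<rho>: "bij \<rho>"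
  shows "\<exists>G. is_poly G \<and> pull G \<noteq> 0 \<and>
    (\<forall>b. poly_at G (quad_map a id b) \<noteq> 0 \<longrightarrow> poly_at (jacobian \<rho>) b \<noteq> 0)"
proof -
  define w where "w i = (case i of None \<Rightarrow> jacobian \<rho> | Some i \<Rightarrow> x (\<rho> (Some i)))" for i
  have w: "is_poly (w i)" for i by (auto simp: w_def is_poly_x is_poly_jacobian split: option.splits)
  obtain P d where P: "is_poly P" "P \<noteq> 0" "poly_eval mps_const w P = 0" "\<And>M. mps_coeff P M \<noteq> 0 \<Longrightarrow> size M \<le> d"
    and min: "\<And>Q. is_poly Q \<Longrightarrow> poly_eval mps_const w Q = 0 \<Longrightarrow> (\<And>M. mps_coeff Q M \<noteq> 0 \<Longrightarrow> size M < d) \<Longrightarrow> Q = 0"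
    using minimal_relation[of w] w by blast
  \<comment> \<open>Splits the relation as \<open>P0 + mps_var None * P1\<close>, with
    \<open>P0\<close> free of the variable that stands for the Jacobian. Where the Jacobian
    vanishes, so does \<open>P0\<close>.\<close>
  define P0 where "P0 = Abs_mps (\<lambda>M. if None \<in># M then 0 else mps_coeff P M)"
  define P1 where "P1 = Abs_mps (\<lambda>M. mps_coeff P (add_mset None M))"
  have P0: "is_poly P0" using P(1) unfolding is_poly_def P0_def
    by (rule finite_subset[rotated]) auto
  have P1: "is_poly P1"
  proof -
    have "finite (add_mset None -` {M. mps_coeff P M \<noteq> 0})"
      using P(1) unfolding is_poly_def by (intro finite_vimageI) (auto simp: inj_on_def)
    then show ?thesis unfolding is_poly_def P1_def by (rule finite_subset[rotated]) auto
  qed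
  have dec: "P = P0 + mps_var None * P1"
    by (rule mps_eqI) (auto simp: P0_def P1_def mps_coeff_var_mult)
  have ev: "poly_eval \<iota> \<sigma> P = poly_eval \<iota> \<sigma> P0 + \<sigma> None * poly_eval \<iota> \<sigma> P1" if "ring_map \<iota>"
    for \<iota> :: "'k \<Rightarrow> 'b :: comm_ring_1" and \<sigma>
    by (subst dec) (simp add: poly_eval_add poly_eval_mult poly_eval_var that P0 P1 is_poly_mult)
  \<comment> \<open>Otherwise division by the non-zero Jacobian leaves a relation of smaller
    degree.\<close>
  have "P0 \<noteq> 0"
  proof
    assume "P0 = 0"
    then have "jacobian \<rho> * poly_eval mps_const w P1 = 0"
      using ev[OF ring_map_mps_const, of w] P(3) by (simp add: poly_eval_0 w_def)
    then have "poly_eval mps_const w P1 = 0" using jacobian_nonzero[OF assms] by simp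
    moreover have "size M < d" if "mps_coeff P1 M \<noteq> 0" for M
      using P(4)[of "add_mset None M"] that by (simp add: P1_def)
    ultimately have "P1 = 0" by (intro min P1)
    then show False using dec \<open>P0 = 0\<close> P(2) by simp
  qed
  have dP0: "mps_deriv None P0 = 0" by (rule mps_eqI) (simp add: mps_coeff_deriv P0_def)
  define G where "G = poly_eval mps_const (\<lambda>k. mps_var (\<rho> k)) P0"
  have G: "is_poly G" unfolding G_def by (rule is_poly_poly_eval) simp
  have "pull G = poly_eval mps_const (\<lambda>k. x (\<rho> k)) P0"
    unfolding pull_def G_def by (subst poly_eval_poly_eval[OF ring_map_mps_const]) (simp_all add: P0 poly_eval_var ring_map_mps_const)
  then have "pull G \<noteq> 0"
    using coordinates_independent[OF F \<rho> P0 dP0, of "\<lambda>k. x (\<rho> k)"] \<open>P0 \<noteq> 0\<close> by auto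
  moreover have "poly_at (jacobian \<rho>) b \<noteq> 0" if b: "poly_at G (quad_map a id b) \<noteq> 0" for b
  proof
    assume J: "poly_at (jacobian \<rho>) b = 0"
    define \<sigma> where "\<sigma> k = poly_at (w k) b" for k
    have "0 = poly_at (poly_eval mps_const w P) b" using P(3) by (simp add: poly_at_simps)
    also have "\<dots> = poly_eval id \<sigma> P"
      by (subst poly_at_poly_eval[OF w P(1)]) (simp add: poly_at_def[of P] vec_nth_lambda \<sigma>_def[abs_def])
    also have "\<dots> = poly_eval id \<sigma> P0"
      using J by (subst ev[OF ring_map_id(1)]) (simp add: \<sigma>_def w_def)
    also have "\<dots> = poly_eval id (\<lambda>k. quad_map a id b $ \<rho> k) P0"
      by (rule poly_eval_cong_deriv[OF dP0]) (auto simp: \<sigma>_def w_def poly_at_x split: option.splits)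
    also have "\<dots> = poly_at G (quad_map a id b)"
      unfolding G_def by (subst poly_at_poly_eval) (simp_all add: P0 poly_at_simps(4) poly_at_def[of P0] vec_nth_lambda)
    finally show False using b by simp
  qed
  ultimately show ?thesis using G by blast
qed

text \<open>A vector killed by the differentials of all coordinates is killed by the
  \<open>n + 1\<close> independent ones selected by \<open>\<rho>\<close>.\<close>

lemma jacobian_immersive:
  assumes "poly_at (jacobian \<rho>) b \<noteq> 0"
  shows "immersive_at b"
  unfolding immersive_at_def
proof (intro allI impI)
  fix \<xi> k assume \<xi>: "\<forall>i. polar id (a i) (($) b) \<xi> = 0"
  define A where "A = (\<chi> i k. \<Sum>j\<in>UNIV. a (\<rho> (Some i)) j k * b $ j)"
  have "poly_at (jacobian \<rho>) b = det A"
    unfolding jacobian_def poly_at_def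
    by (subst poly_eval_det[OF ring_map_id(1)])
       (simp_all add: deriv_x is_poly_mult is_poly_sum poly_eval_sum poly_eval_mult poly_eval_const poly_eval_var ring_map_id A_def)
  then have d: "det A \<noteq> 0" using assms by simp
  have k: "(\<Sum>k\<in>UNIV. A $ i $ k * \<xi> k) = 0" for i
  proof -
    have "(\<Sum>k\<in>UNIV. A $ i $ k * \<xi> k) = polar id (a (\<rho> (Some i))) (($) b) \<xi>"
      unfolding A_def polar_def by (subst sum.swap) (simp add: sum_distrib_right)
    then show ?thesis using \<xi> by simp
  qed
  show "\<xi> k = 0" by (rule det_nonzero_kernel[OF d k])
qed

section \<open>Generic points of the cone and of the parameter space\<close>

lemma gauss_immersive_generic: "generically C (gauss_immersive C)"
  using nondegenerate by (simp add: nondegenerate_cone_def)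

text \<open>At a smooth point some partial derivative of the equation is non-zero; a transposition
  moves that coordinate to \<open>None\<close>.\<close>

lemma good_coordinates:
  obtains F and \<rho> :: "'n option option \<Rightarrow> 'n option option" where "reduced_equation C F" "mps_deriv (\<rho> None) F \<noteq> 0" "bij \<rho>"
proof -
  obtain G where G: "is_poly G" "pull G \<noteq> 0" "\<And>p. p \<in> C \<Longrightarrow> poly_at G p \<noteq> 0 \<Longrightarrow> gauss_immersive C p"
    using generically_C_E[OF gauss_immersive_generic] by blast
  then obtain p where "p \<in> C" "poly_at G p \<noteq> 0" using vanishes_iff by blast
  then have "gauss_immersive C p" using G by blast
  then obtain F where F: "reduced_equation C F" "gradient_at F p \<noteq> 0" by (auto simp: gauss_immersive_def)
  then obtain j where "poly_at (mps_deriv j F) p \<noteq> 0" by (auto simp: gradient_at_def vec_eq_iff)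
  then have "mps_deriv j F \<noteq> 0" by (auto simp: poly_at_simps)
  then show ?thesis using F(1) by (intro that[of F "Transposition.transpose None j"]) auto
qed

text \<open>A generic point has a preimage, and the branch polynomial makes every preimage of such a
  point immersive, whichever one is chosen.\<close>

lemma generic_point:
  "generically C (\<lambda>p. \<exists>b. quad_map a id b = p \<and> immersive_at b \<and> gauss_immersive C p)"
proof -
  obtain G1 where G1: "is_poly G1" "pull G1 \<noteq> 0" "\<And>p. p \<in> C \<Longrightarrow> poly_at G1 p \<noteq> 0 \<Longrightarrow> gauss_immersive C p"
    using generically_C_E[OF gauss_immersive_generic] by blast
  obtain G2 where G2: "is_poly G2" "pull G2 \<noteq> 0" "\<And>p. p \<in> C \<Longrightarrow> poly_at G2 p \<noteq> 0 \<Longrightarrow> p \<in> range (quad_map a id)"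
    using param generically_C_E[of "\<lambda>p. p \<in> range (quad_map a id)"] unfolding quadratic_parametrization_def by blast
  obtain F and \<rho> :: "'n option option \<Rightarrow> 'n option option" where F: "reduced_equation C F" "mps_deriv (\<rho> None) F \<noteq> 0" "bij \<rho>" by (rule good_coordinates)
  obtain G3 where G3: "is_poly G3" "pull G3 \<noteq> 0" "\<And>b. poly_at G3 (quad_map a id b) \<noteq> 0 \<Longrightarrow> poly_at (jacobian \<rho>) b \<noteq> 0"
    using branch_polynomial[OF F] by blast
  show ?thesis
  proof (rule generically_C_I[of "G1 * G2 * G3"])
    show "is_poly (G1 * G2 * G3)" by (intro is_poly_mult G1 G2 G3)
    show "pull (G1 * G2 * G3) \<noteq> 0" using G1 G2 G3 by (simp add: pull_mult is_poly_mult)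
    fix p assume p: "p \<in> C" "poly_at (G1 * G2 * G3) p \<noteq> 0"
    then have "poly_at G1 p \<noteq> 0" "poly_at G2 p \<noteq> 0" "poly_at G3 p \<noteq> 0"
      by (auto simp: poly_at_simps is_poly_mult G1 G2 G3)
    moreover from this p obtain b where "p = quad_map a id b" using G2 by blast
    ultimately show "\<exists>b. quad_map a id b = p \<and> immersive_at b \<and> gauss_immersive C p"
      using G1(3)[OF p(1)] G3(3) jacobian_immersive by blast
  qed
qed

lemma generic_parameter:
  "generically UNIV (\<lambda>b. immersive_at b \<and> gauss_immersive C (quad_map a id b))"
proof -
  obtain G1 where G1: "is_poly G1" "pull G1 \<noteq> 0" "\<And>p. p \<in> C \<Longrightarrow> poly_at G1 p \<noteq> 0 \<Longrightarrow> gauss_immersive C p"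
    using generically_C_E[OF gauss_immersive_generic] by blast
  obtain F and \<rho> :: "'n option option \<Rightarrow> 'n option option" where F: "reduced_equation C F" "mps_deriv (\<rho> None) F \<noteq> 0" "bij \<rho>" by (rule good_coordinates)
  show ?thesis
  proof (rule generically_UNIV_I[of "pull G1 * jacobian \<rho>"])
    show "is_poly (pull G1 * jacobian \<rho>)" by (intro is_poly_mult is_poly_pull is_poly_jacobian)
    show "pull G1 * jacobian \<rho> \<noteq> 0" using G1 jacobian_nonzero[OF F] by simp
    fix b assume "poly_at (pull G1 * jacobian \<rho>) b \<noteq> 0"
    then have "poly_at G1 (quad_map a id b) \<noteq> 0" "poly_at (jacobian \<rho>) b \<noteq> 0"
      by (auto simp: poly_at_simps is_poly_pull is_poly_jacobian poly_at_pull[OF G1(1)])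
    then show "immersive_at b \<and> gauss_immersive C (quad_map a id b)"
      using G1(3)[OF quad_map_in_C] jacobian_immersive by blast
  qed
qed

end

section \<open>Germs\<close>

lemma
  assumes "germ_space (\<O> :: ('v :: finite, 'k :: field) mps set)"
  shows germ_const: "mps_const c \<in> \<O>"
    and germ_add: "p \<in> \<O> \<Longrightarrow> q \<in> \<O> \<Longrightarrow> p + q \<in> \<O>"
    and germ_mult: "p \<in> \<O> \<Longrightarrow> q \<in> \<O> \<Longrightarrow> p * q \<in> \<O>"
    and germ_deriv: "p \<in> \<O> \<Longrightarrow> mps_deriv i p \<in> \<O>"
  using assms
  by (auto elim!: germ_space_cases intro: convergent_mps_const convergent_mps_add convergent_mps_mult convergent_mps_deriv)

lemma germ_quadratic_fixpoint:
  fixes Q :: "'w :: finite \<Rightarrow> 'w \<Rightarrow> 'w \<Rightarrow> 'k :: field" and N :: "'w \<Rightarrow> ('v :: finite, 'k) mps"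
  assumes \<O>: "germ_space \<O>"
    and "\<And>i M. size M \<noteq> 1 \<Longrightarrow> mps_coeff (N i) M = 0" "\<And>i. mps_coeff (U i) {#} = 0"
    and "\<And>i. U i = N i + polar mps_const (Q i) U U"
  shows "U i \<in> \<O>"
  using \<O>
proof (cases rule: germ_space_cases)
  case (2 \<nu>)
  then show ?thesis using convergent_quadratic_fixpoint[OF 2(1) assms(2-4)] by simp
qed simp

context
  fixes \<O> :: "('v :: finite, 'k :: field) mps set"
  assumes \<O>: "germ_space \<O>"
begin

lemma germ_sum: "(\<And>x. x \<in> A \<Longrightarrow> h x \<in> \<O>) \<Longrightarrow> sum h A \<in> \<O>"
  using germ_const[OF \<O>, of 0]
  by (induction A rule: infinite_finite_induct) (auto intro: germ_add[OF \<O>])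

lemma germ_prod: "(\<And>x. x \<in> A \<Longrightarrow> h x \<in> \<O>) \<Longrightarrow> prod h A \<in> \<O>"
  using germ_const[OF \<O>, of 1]
  by (induction A rule: infinite_finite_induct) (auto intro: germ_mult[OF \<O>])

lemma germ_det:
  fixes A :: "('v, 'k) mps ^ 'm ^ 'm"
  shows "(\<And>i j. A $ i $ j \<in> \<O>) \<Longrightarrow> det A \<in> \<O>"
  unfolding det_def mps_of_int by (intro germ_sum germ_mult[OF \<O>] germ_const[OF \<O>] germ_prod)

lemma germ_polar: "(\<And>j. v j \<in> \<O>) \<Longrightarrow> (\<And>j. w j \<in> \<O>) \<Longrightarrow> polar mps_const Q v w \<in> \<O>"
  unfolding polar_def by (intro germ_sum germ_mult[OF \<O>] germ_const[OF \<O>])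

end

section \<open>Tangent hyperplanes\<close>

text \<open>The vectors \<open>t k\<close> span the hyperplane \<open>g = 0\<close>. As
  \<open>g\<close> involves the coordinate \<open>\<rho> None\<close>, the remaining coordinates
  separate points of it.\<close>

lemma hyperplane_coordinates:
  fixes t :: "'m :: finite \<Rightarrow> 'm option \<Rightarrow> 'k :: field" and \<rho> :: "'m option \<Rightarrow> 'm option"
  assumes inj: "\<And>\<xi> k. (\<And>i. (\<Sum>k\<in>UNIV. \<xi> k * t k i) = 0) \<Longrightarrow> \<xi> k = 0"
    and g: "\<And>k. (\<Sum>i\<in>UNIV. g i * t k i) = 0" "g (\<rho> None) \<noteq> 0" and \<rho>: "bij \<rho>"
  shows "det (\<chi> i k. t k (\<rho> (Some i))) \<noteq> 0"
proof
  assume "det (\<chi> i k. t k (\<rho> (Some i))) = 0"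
  then obtain \<xi> l where \<xi>: "(\<chi> i k. t k (\<rho> (Some i))) *v \<xi> = 0" "\<xi> $ l \<noteq> 0"
    by (rule singular_matrix_kernel)
  define w where "w i = (\<Sum>k\<in>UNIV. \<xi> $ k * t k i)" for i
  have w: "w (\<rho> (Some i)) = 0" for i
    using \<xi>(1) by (simp add: vec_eq_iff matrix_vector_mult_def w_def mult.commute)
  have "(\<Sum>i\<in>UNIV. g i * w i) = (\<Sum>k\<in>UNIV. \<xi> $ k * (\<Sum>i\<in>UNIV. g i * t k i))"
    unfolding w_def sum_distrib_left by (subst sum.swap) (simp add: mult.left_commute)
  then have "0 = (\<Sum>i\<in>UNIV. g i * w i)" by (simp add: g)
  also have "\<dots> = (\<Sum>i\<in>UNIV. g (\<rho> i) * w (\<rho> i))"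
    using sum.reindex_bij_betw[of \<rho> UNIV UNIV "\<lambda>i. g i * w i"] \<rho> by simp
  also have "\<dots> = g (\<rho> None) * w (\<rho> None)" by (simp add: sum_option w)
  finally have "w (\<rho> None) = 0" using g(2) by simp
  have "w i = 0" for i
  proof -
    obtain i' where "i = \<rho> i'" using \<rho> by (metis bij_pointE)
    then show ?thesis using w \<open>w (\<rho> None) = 0\<close> by (cases i') auto
  qed
  then have "\<xi> $ l = 0" by (intro inj[of "($) \<xi>"]) (simp add: w_def)
  then show False using \<xi>(2) by simp
qed

text \<open>Subtracting a multiple of \<open>g\<close> clears the entry at \<open>i0\<close>; the
  other entries then lie in the kernel of the invertible matrix of
  \<open>hyperplane_coordinates\<close>.\<close>

lemma conormal_unique:
  fixes t :: "'m :: finite \<Rightarrow> 'm option \<Rightarrow> 'k :: field"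
  assumes inj: "\<And>\<xi> k. (\<And>i. (\<Sum>k\<in>UNIV. \<xi> k * t k i) = 0) \<Longrightarrow> \<xi> k = 0"
    and g: "\<And>k. (\<Sum>i\<in>UNIV. g i * t k i) = 0" "g i0 \<noteq> 0"
    and l: "\<And>k. (\<Sum>i\<in>UNIV. l i * t k i) = 0"
  shows "l i = l i0 / g i0 * g i"
proof -
  define \<rho> where "\<rho> = Transposition.transpose None i0"
  have \<rho>: "bij \<rho>" "\<rho> None = i0" by (simp_all add: \<rho>_def)
  define m where "m i = l i - l i0 / g i0 * g i" for i
  have m0: "m (\<rho> None) = 0" using g(2) \<rho> by (simp add: m_def)
  have m: "(\<Sum>i\<in>UNIV. m i * t k i) = 0" for k
  proof -
    have "(\<Sum>i\<in>UNIV. m i * t k i) = (\<Sum>i\<in>UNIV. l i * t k i) - l i0 / g i0 * (\<Sum>i\<in>UNIV. g i * t k i)"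
      by (simp add: m_def left_diff_distrib sum_subtractf sum_distrib_left mult.assoc)
    then show ?thesis by (simp add: l g)
  qed
  have d: "det (\<chi> i k. t k (\<rho> (Some i))) \<noteq> 0"
  proof (rule hyperplane_coordinates[where g = g])
    show "\<xi> k = 0" if "\<And>i. (\<Sum>k\<in>UNIV. \<xi> k * t k i) = 0" for \<xi> k by (rule inj[OF that])
  qed (use g \<rho> in auto)
  have "m (\<rho> (Some i')) = 0" for i'
  proof (rule det_nonzero_kernel[of "transpose (\<chi> i k. t k (\<rho> (Some i)))" "\<lambda>i'. m (\<rho> (Some i'))" i'])
    fix k
    have "0 = (\<Sum>i\<in>UNIV. m (\<rho> i) * t k (\<rho> i))"
      using sum.reindex_bij_betw[of \<rho> UNIV UNIV "\<lambda>i. m i * t k i"] \<rho> m[of k] by simp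
    then show "(\<Sum>j\<in>UNIV. Finite_Cartesian_Product.transpose (\<chi> i k. t k (\<rho> (Some i))) $ k $ j * m (\<rho> (Some j))) = 0"
      by (simp add: sum_option m0 Finite_Cartesian_Product.transpose_def mult.commute)
  qed (use d in simp)
  then have "m i = 0" for i
    using m0 \<rho>(1) by (metis bij_pointE not_None_eq)
  then have "l i - l i0 / g i0 * g i = 0" by (simp only: m_def)
  then show ?thesis by (simp only: right_minus_eq)
qed

context quadratic_cone
begin

text \<open>\<open>tangent b k\<close> is the partial derivative of the parametrization in
  \<open>u\<^sub>k\<close> at \<open>b\<close>.\<close>

definition tangent :: "'k ^ 'n option \<Rightarrow> 'n option \<Rightarrow> 'n option option \<Rightarrow> 'k" where
  "tangent b k i = (\<Sum>j\<in>UNIV. a i j k * b $ j)"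

lemma polar_tangent: "polar id (a i) (($) b) \<xi> = (\<Sum>k\<in>UNIV. \<xi> k * tangent b k i)"
  unfolding polar_def tangent_def by (subst sum.swap) (simp add: sum_distrib_left mult_ac)

lemma poly_at_deriv_x: "poly_at (mps_deriv k (x i)) b = tangent b k i"
  unfolding poly_at_def deriv_x tangent_def
  by (simp add: poly_eval_sum poly_eval_mult poly_eval_const poly_eval_var ring_map_id is_poly_mult)

lemma tangent_inj:
  assumes "immersive_at b" "\<And>i. (\<Sum>k\<in>UNIV. \<xi> k * tangent b k i) = 0"
  shows "\<xi> k = 0"
  using assms by (simp add: immersive_at_def polar_tangent)

lemma reduced_equation_poly: "reduced_equation C F \<Longrightarrow> is_poly F"
  by (simp add: reduced_equation_def)

lemma reduced_equation_pull: "reduced_equation C F \<Longrightarrow> pull F = 0"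
  using vanishes_iff[of F] by (auto simp: reduced_equation_def)

lemma pull_deriv:
  assumes "is_poly P"
  shows "mps_deriv k (pull P) = (\<Sum>i\<in>UNIV. pull (mps_deriv i P) * mps_deriv k (x i))"
  unfolding pull_def
  by (rule poly_eval_derivation[OF derivation_mps_deriv mps_deriv_const ring_map_mps_const assms])

lemma gradient_tangent:
  assumes F: "reduced_equation C F"
  shows "(\<Sum>i\<in>UNIV. gradient_at F (quad_map a id b) $ i * tangent b k i) = 0"
proof -
  have "0 = poly_at (mps_deriv k (pull F)) b"
    by (simp add: reduced_equation_pull[OF F] poly_at_simps)
  also have "\<dots> = (\<Sum>i\<in>UNIV. poly_at (pull (mps_deriv i F) * mps_deriv k (x i)) b)"
    unfolding pull_deriv[OF reduced_equation_poly[OF F]] poly_at_def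
    by (rule poly_eval_sum[OF ring_map_id(1)]) (intro is_poly_mult is_poly_pull is_poly_deriv is_poly_x)
  finally show ?thesis
    by (simp add: poly_at_simps is_poly_pull is_poly_deriv[OF is_poly_x] poly_at_deriv_x gradient_at_def
        poly_at_pull is_poly_deriv reduced_equation_poly[OF F])
qed

text \<open>Two derivatives of the identity \<open>pull F = 0\<close>, using that the
  parametrization has constant second derivatives: the second fundamental form of the cone, read on
  the parameter space.\<close>

lemma hessian_tangent:
  assumes F: "reduced_equation C F"
  shows "(\<Sum>i\<in>UNIV. \<Sum>j\<in>UNIV. hessian_at F (quad_map a id b) $ i $ j * tangent b l j * tangent b k i)
    = - (\<Sum>i\<in>UNIV. gradient_at F (quad_map a id b) $ i * a i l k)"
proof -
  note P = reduced_equation_poly[OF F]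
  have d2: "mps_deriv l (mps_deriv k (x i)) = mps_const (a i l k)" for i
    by (simp add: deriv_x mps_deriv_var if_distrib cong: if_cong)
  have "0 = mps_deriv l (mps_deriv k (pull F))" by (simp add: reduced_equation_pull[OF F])
  also have "\<dots> = (\<Sum>i\<in>UNIV. (\<Sum>j\<in>UNIV. pull (mps_deriv j (mps_deriv i F)) * mps_deriv l (x j)) * mps_deriv k (x i)
       + pull (mps_deriv i F) * mps_const (a i l k))"
    by (simp add: pull_deriv[OF P] mps_deriv_mult pull_deriv[OF is_poly_deriv[OF P]] d2)
  finally have "0 = poly_at (\<Sum>i\<in>UNIV. (\<Sum>j\<in>UNIV. pull (mps_deriv j (mps_deriv i F)) * mps_deriv l (x j)) * mps_deriv k (x i)
       + pull (mps_deriv i F) * mps_const (a i l k)) b"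
    by (simp add: poly_at_simps)
  also have "\<dots> = (\<Sum>i\<in>UNIV. (\<Sum>j\<in>UNIV. poly_at (pull (mps_deriv j (mps_deriv i F))) b * tangent b l j) * tangent b k i
       + poly_at (pull (mps_deriv i F)) b * a i l k)"
    unfolding poly_at_deriv_x[symmetric] unfolding poly_at_def
    by (simp add: poly_eval_sum poly_eval_add poly_eval_mult poly_eval_const ring_map_id is_poly_mult is_poly_add is_poly_sum
        is_poly_pull is_poly_deriv[OF is_poly_x])
  finally show ?thesis
    by (simp add: poly_at_pull is_poly_deriv P hessian_at_def gradient_at_def sum.distrib sum_distrib_right
        mps_deriv_commute eq_neg_iff_add_eq_0)
qed

text \<open>A vector \<open>\<xi>\<close> in the kernel of the conormal combination of the forms
  maps to a tangent vector \<open>w\<close> for which the Hessian times \<open>w\<close> annihilates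
  all tangents, hence is a multiple of the gradient. Immersivity of the Gauss map then puts
  \<open>w\<close> on the line of \<open>p\<close>.\<close>

lemma gauss_kernel:
  assumes b: "immersive_at b" and gauss: "gauss_immersive C (quad_map a id b)"
  shows "\<exists>F. reduced_equation C F \<and> gradient_at F (quad_map a id b) \<noteq> 0 \<and>
    (\<forall>\<xi>. (\<forall>l. (\<Sum>i\<in>UNIV. \<Sum>k\<in>UNIV. gradient_at F (quad_map a id b) $ i * a i k l * \<xi> k) = 0) \<longrightarrow> (\<exists>c. \<forall>k. \<xi> k = c * b $ k))"
proof -
  define p where "p = quad_map a id b"
  obtain F where F: "reduced_equation C F" "gradient_at F p \<noteq> 0"
    and K: "\<And>w. (\<Sum>i\<in>UNIV. gradient_at F p $ i * w $ i) = 0 \<Longrightarrow> (\<exists>c. hessian_at F p *v w = c *s gradient_at F p) \<Longrightarrow> \<exists>c. w = c *s p"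
    using gauss by (auto simp: gauss_immersive_def p_def)
  define g where "g i = gradient_at F p $ i" for i
  have gt: "(\<Sum>i\<in>UNIV. g i * tangent b k i) = 0" for k
    using gradient_tangent[OF F(1)] by (simp add: g_def p_def)
  obtain i0 where i0: "g i0 \<noteq> 0" using F(2) by (auto simp: g_def vec_eq_iff)
  have "\<exists>c. \<forall>k. \<xi> k = c * b $ k"
    if \<xi>: "\<And>l. (\<Sum>i\<in>UNIV. \<Sum>k\<in>UNIV. g i * a i k l * \<xi> k) = 0" for \<xi>
  proof -
    define w where "w = (\<chi> i. \<Sum>k\<in>UNIV. \<xi> k * tangent b k i)"
    have w1: "(\<Sum>i\<in>UNIV. g i * w $ i) = 0"
    proof -
      have "(\<Sum>i\<in>UNIV. g i * w $ i) = (\<Sum>k\<in>UNIV. \<xi> k * (\<Sum>i\<in>UNIV. g i * tangent b k i))"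
        unfolding w_def vec_lambda_beta sum_distrib_left by (subst sum.swap) (simp add: mult.left_commute)
      then show ?thesis by (simp add: gt)
    qed
    define h where "h = hessian_at F p *v w"
    have ht: "(\<Sum>i\<in>UNIV. h $ i * tangent b k i) = 0" for k
    proof -
      have "(\<Sum>i\<in>UNIV. h $ i * tangent b k i)
        = (\<Sum>i\<in>UNIV. \<Sum>j\<in>UNIV. \<Sum>l\<in>UNIV. \<xi> l * (hessian_at F p $ i $ j * tangent b l j * tangent b k i))"
        by (simp add: h_def matrix_vector_mult_def w_def sum_distrib_left sum_distrib_right mult_ac)
      also have "\<dots> = (\<Sum>i\<in>UNIV. \<Sum>l\<in>UNIV. \<Sum>j\<in>UNIV. \<xi> l * (hessian_at F p $ i $ j * tangent b l j * tangent b k i))"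
        by (intro sum.cong refl sum.swap)
      also have "\<dots> = (\<Sum>l\<in>UNIV. \<Sum>i\<in>UNIV. \<Sum>j\<in>UNIV. \<xi> l * (hessian_at F p $ i $ j * tangent b l j * tangent b k i))"
        by (rule sum.swap)
      also have "\<dots> = - (\<Sum>l\<in>UNIV. \<Sum>i\<in>UNIV. \<xi> l * (g i * a i l k))"
        by (simp add: sum_distrib_left[symmetric] hessian_tangent[OF F(1)] p_def g_def sum_negf)
      also have "(\<Sum>l\<in>UNIV. \<Sum>i\<in>UNIV. \<xi> l * (g i * a i l k)) = (\<Sum>i\<in>UNIV. \<Sum>l\<in>UNIV. g i * a i l k * \<xi> l)"
        by (subst sum.swap) (simp add: mult_ac)
      finally show ?thesis by (simp add: \<xi>)
    qed
    define lam where "lam = h $ i0 / g i0"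
    have "h $ i = lam * g i" for i
      unfolding lam_def
    proof (rule conormal_unique[where t = "tangent b" and g = g and l = "\<lambda>i. h $ i"])
      show "\<xi> k = 0" if "\<And>i. (\<Sum>k\<in>UNIV. \<xi> k * tangent b k i) = 0" for \<xi> k by (rule tangent_inj[OF b that])
    qed (fact gt i0 ht)+
    then have "h = lam *s gradient_at F p" by (simp add: vec_eq_iff g_def)
    then obtain c where c: "w = c *s p" using K[of w] w1 by (auto simp: g_def h_def)
    \<comment> \<open>By Euler's relation \<open>p\<close> is half the image of \<open>b\<close>
      under the differential, which accounts for the factor 1/2.\<close>
    have "\<xi> k - c / 2 * b $ k = 0" for k
    proof (rule tangent_inj[OF b])
      fix i
      have "p $ i = 1 / 2 * (\<Sum>k\<in>UNIV. b $ k * tangent b k i)"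
        by (simp add: p_def quad_map_nth polar_tangent)
      then have "(\<Sum>k\<in>UNIV. \<xi> k * tangent b k i) = c / 2 * (\<Sum>k\<in>UNIV. b $ k * tangent b k i)"
        using arg_cong[OF c, of "\<lambda>v. v $ i"] by (simp add: w_def)
      then show "(\<Sum>k\<in>UNIV. (\<xi> k - c / 2 * b $ k) * tangent b k i) = 0"
        by (simp add: left_diff_distrib sum_subtractf sum_distrib_left mult.assoc)
    qed
    then show ?thesis by (intro exI[of _ "c / 2"]) simp
  qed
  then show ?thesis using F by (intro exI[of _ F]) (simp add: g_def p_def)
qed

text \<open>\<open>P\<close> is a multiple of \<open>F\<close>, and \<open>F\<close> vanishes at
  \<open>p\<close>. In particular gradients of any two reduced equations are proportional.\<close>

lemma gradient_proportional:
  assumes F: "reduced_equation C F" and P: "is_poly P" "\<And>y. y \<in> C \<Longrightarrow> poly_at P y = 0" and p: "p \<in> C"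
  obtains q where "\<And>i. poly_at (mps_deriv i P) p = q * gradient_at F p $ i"
proof -
  obtain Q where Q: "is_poly Q" "P = F * Q" using F P by (auto simp: reduced_equation_def)
  have "poly_at F p = 0" "is_poly F" using F p by (auto simp: reduced_equation_def)
  then have "poly_at (mps_deriv i P) p = poly_at Q p * gradient_at F p $ i" for i
    by (simp add: Q mps_deriv_mult poly_at_simps is_poly_mult is_poly_deriv gradient_at_def)
  then show ?thesis by (rule that)
qed

lemma gradient_scale:
  assumes F: "reduced_equation C F" and p: "p \<in> C" and c: "c \<noteq> 0"
    and e: "(\<Sum>j\<in>UNIV. gradient_at F p $ j * e j) \<noteq> 0"
  shows "(\<Sum>j\<in>UNIV. gradient_at F (c *s p) $ j * e j) \<noteq> 0"
proof -
  have cone: "\<And>c x. x \<in> C \<Longrightarrow> c *s x \<in> C"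
    using nondegenerate by (auto simp: nondegenerate_cone_def conical_hypersurface_def)
  have F': "is_poly F" "C = {x. poly_at F x = 0}" using F by (auto simp: reduced_equation_def)
  define P where "P = poly_eval mps_const (\<lambda>j. mps_const (1 / c) * mps_var j) F"
  have at: "poly_at (poly_eval mps_const (\<lambda>j. mps_const (1 / c) * mps_var j) G) y = poly_at G ((1 / c) *s y)" if "is_poly G" for G y
    by (subst poly_at_poly_eval) (auto simp: that poly_at_simps is_poly_mult vector_scalar_mult_def)
  have P: "is_poly P" unfolding P_def by (rule is_poly_poly_eval) (simp add: is_poly_mult)
  have "poly_at P y = 0" if "y \<in> C" for y
    using cone[OF that, of "1 / c"] F'(2) by (simp add: P_def at F'(1))
  from gradient_proportional[OF F P this cone[OF p, of c]]
  obtain q where q: "\<And>i. poly_at (mps_deriv i P) (c *s p) = q * gradient_at F (c *s p) $ i" by blast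
  have "mps_deriv i P = mps_const (1 / c) * poly_eval mps_const (\<lambda>j. mps_const (1 / c) * mps_var j) (mps_deriv i F)" for i
    unfolding P_def
    by (subst poly_eval_derivation[OF derivation_mps_deriv mps_deriv_const ring_map_mps_const F'(1)])
       (simp add: mps_deriv_var if_distrib mult.commute[of _ "mps_const (1 / c)"] cong: if_cong)
  then have dP: "poly_at (mps_deriv i P) (c *s p) = 1 / c * gradient_at F p $ i" for i
    using c by (simp add: poly_at_simps is_poly_poly_eval is_poly_mult at is_poly_deriv F'(1) gradient_at_def vector_smult_assoc)
  then have "gradient_at F p $ i = c * q * gradient_at F (c *s p) $ i" for i
  proof -
    have "gradient_at F p $ i = c * poly_at (mps_deriv i P) (c *s p)" using c by (simp add: dP)
    then show ?thesis by (simp only: q mult.assoc)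
  qed
  then have "(\<Sum>j\<in>UNIV. gradient_at F p $ j * e j) = c * q * (\<Sum>j\<in>UNIV. gradient_at F (c *s p) $ j * e j)"
    by (simp add: sum_distrib_left mult.assoc)
  with e show ?thesis by auto
qed

end

section \<open>Charts at a generic point\<close>

text \<open>\<open>g\<close> will be the gradient at the point of one reduced equation. It is kept
  abstract, with the properties that matter: it annihilates tangents, its combination of the forms
  has kernel in the line of \<open>b\<close>, and it is transversal to the direction
  \<open>y\<^sub>n\<^sub>+\<^sub>1\<close>.\<close>

locale chart_at = quadratic_cone C a
  for C :: "('k :: {alg_closed_field, field_char_0} ^ 'n :: finite option option) set"
    and a :: "'n option option \<Rightarrow> 'n option \<Rightarrow> 'n option \<Rightarrow> 'k" +
  fixes b :: "'k ^ 'n option" and L :: "'k ^ 'n option option ^ 'n option option"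
    and g :: "'n option option \<Rightarrow> 'k" and \<O> :: "('n, 'k) mps set"
  assumes immersive: "immersive_at b"
    and g_tangent: "(\<Sum>i\<in>UNIV. g i * tangent b k i) = 0"
    and g_kernel: "(\<And>l. (\<Sum>i\<in>UNIV. \<Sum>k\<in>UNIV. g i * a i k l * \<xi> k) = 0) \<Longrightarrow> \<exists>c. \<forall>k. \<xi> k = c * b $ k"
    and L: "invertible L"
    and y_0: "(L *v quad_map a id b) $ Some None \<noteq> 0"
    and g_None: "(\<Sum>j\<in>UNIV. g j * matrix_inv L $ j $ None) \<noteq> 0"
    and germs: "germ_space \<O>"
begin

abbreviation Li where "Li \<equiv> matrix_inv L"

definition p where "p = quad_map a id b"
definition yp where "yp i = (L *v p) $ i"
definition \<tau> where "\<tau> i = yp (Some (Some i)) / yp (Some None)"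
definition q where "q i j k = (\<Sum>l\<in>UNIV. L $ i $ l * a l j k)"
definition s0 where "s0 = (SOME s. s\<^sup>2 = yp (Some None))"
text \<open>The parametrization being quadratic, dividing \<open>b\<close> by a square root of
  \<open>y\<^sub>0\<close> normalizes \<open>y\<^sub>0\<close> to 1; this is the value of the
  section at the base point.\<close>

definition bh where "bh j = b $ j / s0"
text \<open>The conormal \<open>g\<close> in the coordinates \<open>y\<close>.\<close>

definition g' where "g' i = (\<Sum>j\<in>UNIV. g j * Li $ j $ i)"

section \<open>Forms and conormal in the coordinates of the chart\<close>

lemma q_sym: "q i j k = q i k j"
  by (simp add: q_def a_sym[of _ j k])

lemma yp_0: "yp (Some None) \<noteq> 0"
  using y_0 by (simp add: yp_def p_def)

lemma s0: "s0\<^sup>2 = yp (Some None)" "s0 \<noteq> 0"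
proof -
  have "\<exists>s. poly [: - yp (Some None), 0, 1:] s = 0"
    by (rule alg_closed_imp_poly_has_root) simp
  then have "\<exists>s. s\<^sup>2 = yp (Some None)" by (auto simp: power2_eq_square)
  then show "s0\<^sup>2 = yp (Some None)" unfolding s0_def by (rule someI_ex)
  then show "s0 \<noteq> 0" using yp_0 by auto
qed

lemma Li_L: "(\<Sum>i\<in>UNIV. Li $ l $ i * L $ i $ m) = (if l = m then 1 else 0)"
  using arg_cong[OF matrix_inv_mult(2)[OF L], of "\<lambda>M. M $ l $ m"] by (simp add: matrix_matrix_mult_def mat_def)

lemma polar_q:
  assumes "ring_map \<iota>"
  shows "polar \<iota> (q i) v w = (\<Sum>l\<in>UNIV. \<iota> (L $ i $ l) * polar \<iota> (a l) v w)"
proof -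
  have "polar \<iota> (q i) v w = (\<Sum>j\<in>UNIV. \<Sum>k\<in>UNIV. \<Sum>l\<in>UNIV. \<iota> (L $ i $ l) * (\<iota> (a l j k) * v j * w k))"
    by (simp add: polar_def q_def ring_map_sum[OF assms] ring_map_mult[OF assms] sum_distrib_right mult.assoc)
  also have "\<dots> = (\<Sum>j\<in>UNIV. \<Sum>l\<in>UNIV. \<Sum>k\<in>UNIV. \<iota> (L $ i $ l) * (\<iota> (a l j k) * v j * w k))"
    by (intro sum.cong refl sum.swap)
  also have "\<dots> = (\<Sum>l\<in>UNIV. \<Sum>j\<in>UNIV. \<Sum>k\<in>UNIV. \<iota> (L $ i $ l) * (\<iota> (a l j k) * v j * w k))"
    by (rule sum.swap)
  finally show ?thesis by (simp add: polar_def sum_distrib_left)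
qed

lemma polar_a:
  assumes "ring_map \<iota>"
  shows "polar \<iota> (a l) v w = (\<Sum>i\<in>UNIV. \<iota> (Li $ l $ i) * polar \<iota> (q i) v w)"
proof -
  have "(\<Sum>i\<in>UNIV. \<iota> (Li $ l $ i) * polar \<iota> (q i) v w)
    = (\<Sum>m\<in>UNIV. \<iota> (\<Sum>i\<in>UNIV. Li $ l $ i * L $ i $ m) * polar \<iota> (a m) v w)"
    unfolding polar_q[OF assms] sum_distrib_left ring_map_sum[OF assms] ring_map_mult[OF assms] sum_distrib_right
    by (subst sum.swap) (simp add: mult.assoc)
  also have "\<dots> = (\<Sum>m\<in>UNIV. if l = m then polar \<iota> (a m) v w else 0)"
    unfolding Li_L by (intro sum.cong refl) (simp add: ring_map_0[OF assms] ring_map_1[OF assms])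
  finally show ?thesis by simp
qed

lemma bh_polar: "polar id (q i) bh bh = 2 * (yp i / yp (Some None))"
proof -
  have bh: "bh = (\<lambda>j. 1 / s0 * b $ j)" by (simp add: bh_def fun_eq_iff)
  have "polar id (q i) (($) b) (($) b) = (\<Sum>l\<in>UNIV. L $ i $ l * (2 * p $ l))"
    by (simp add: polar_q[OF ring_map_id(1)] p_def quad_map_nth)
  also have "\<dots> = 2 * yp i"
    by (simp add: yp_def matrix_vector_mult_def sum_distrib_left mult.left_commute)
  finally show ?thesis
    using s0 unfolding bh polar_mult_left polar_mult_right by (simp add: power2_eq_square[symmetric] field_simps)
qed

lemma g'_q: "(\<Sum>i\<in>UNIV. g' i * q i j k) = (\<Sum>l\<in>UNIV. g l * a l j k)"
proof -
  have "(\<Sum>i\<in>UNIV. g' i * q i j k) = (\<Sum>i\<in>UNIV. \<Sum>l\<in>UNIV. \<Sum>m\<in>UNIV. g l * (Li $ l $ i * L $ i $ m) * a m j k)"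
    by (simp add: g'_def q_def sum_product mult.assoc)
  also have "\<dots> = (\<Sum>l\<in>UNIV. \<Sum>i\<in>UNIV. \<Sum>m\<in>UNIV. g l * (Li $ l $ i * L $ i $ m) * a m j k)"
    by (rule sum.swap)
  also have "\<dots> = (\<Sum>l\<in>UNIV. \<Sum>m\<in>UNIV. \<Sum>i\<in>UNIV. g l * (Li $ l $ i * L $ i $ m) * a m j k)"
    by (intro sum.cong refl sum.swap)
  also have "\<dots> = (\<Sum>l\<in>UNIV. \<Sum>m\<in>UNIV. g l * (\<Sum>i\<in>UNIV. Li $ l $ i * L $ i $ m) * a m j k)"
    by (simp add: sum_distrib_left sum_distrib_right)
  also have "\<dots> = (\<Sum>l\<in>UNIV. g l * a l j k)"
    unfolding Li_L by (simp add: if_distrib if_distribR cong: if_cong)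
  finally show ?thesis .
qed

lemma g'_polar:
  "(\<Sum>i\<in>UNIV. g' i * polar id (q i) v w) = (\<Sum>l\<in>UNIV. g l * polar id (a l) v w)"
proof -
  have swap: "(\<Sum>i\<in>(UNIV :: 'n option option set). h i * polar id (Q i) v w) = (\<Sum>j\<in>UNIV. \<Sum>k\<in>UNIV. (\<Sum>i\<in>UNIV. h i * Q i j k) * v j * w k)" for h Q
  proof -
    have "(\<Sum>i\<in>(UNIV :: 'n option option set). h i * polar id (Q i) v w) = (\<Sum>i\<in>UNIV. \<Sum>j\<in>UNIV. \<Sum>k\<in>UNIV. h i * Q i j k * v j * w k)"
      by (simp add: polar_def sum_distrib_left mult.assoc)
    also have "\<dots> = (\<Sum>j\<in>UNIV. \<Sum>i\<in>UNIV. \<Sum>k\<in>UNIV. h i * Q i j k * v j * w k)"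
      by (rule sum.swap)
    also have "\<dots> = (\<Sum>j\<in>UNIV. \<Sum>k\<in>UNIV. \<Sum>i\<in>UNIV. h i * Q i j k * v j * w k)"
      by (intro sum.cong refl sum.swap)
    finally show ?thesis by (simp add: sum_distrib_right)
  qed
  show ?thesis unfolding swap g'_q ..
qed

lemma g_polar_bh: "(\<Sum>l\<in>UNIV. g l * polar id (a l) bh w) = 0"
proof -
  have bh: "bh = (\<lambda>j. 1 / s0 * b $ j)" by (simp add: bh_def fun_eq_iff)
  have "(\<Sum>l\<in>UNIV. g l * polar id (a l) bh w) = 1 / s0 * (\<Sum>l\<in>UNIV. g l * polar id (a l) (($) b) w)"
    unfolding bh polar_mult_left sum_distrib_left by (simp add: mult_ac)
  also have "(\<Sum>l\<in>UNIV. g l * polar id (a l) (($) b) w) = (\<Sum>k\<in>UNIV. w k * (\<Sum>i\<in>UNIV. g i * tangent b k i))"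
    unfolding polar_tangent sum_distrib_left by (subst sum.swap) (simp add: mult.left_commute)
  finally show ?thesis by (simp only: g_tangent mult_zero_right sum.neutral_const)
qed

text \<open>The tangent hyperplane at \<open>bh\<close> is transversal to
  \<open>y\<^sub>n\<^sub>+\<^sub>1\<close> because \<open>g' None\<close> is non-zero, so
  \<open>y\<^sub>0, ..., y\<^sub>n\<close> have independent differentials there.\<close>

lemma det_bh: "det (\<chi> i k. \<Sum>j\<in>UNIV. q (Some i) j k * bh j) \<noteq> 0"
proof -
  define t where "t k i = (\<Sum>j\<in>UNIV. q i j k * bh j)" for k i
  have t: "(\<Sum>k\<in>UNIV. \<xi> k * t k i) = polar id (q i) bh \<xi>" for \<xi> i
    unfolding t_def polar_def sum_distrib_left by (subst sum.swap) (simp add: mult_ac)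
  have "det (\<chi> i k. t k (id (Some i))) \<noteq> 0"
  proof (rule hyperplane_coordinates[where g = g'])
    fix \<xi> :: "'n option \<Rightarrow> 'k" and k assume "\<And>i. (\<Sum>k\<in>UNIV. \<xi> k * t k i) = 0"
    then have "polar id (a l) bh \<xi> = 0" for l by (simp add: polar_a[OF ring_map_id(1)] t)
    moreover have "polar id (a l) bh \<xi> = 1 / s0 * polar id (a l) (($) b) \<xi>" for l
    proof -
      have "bh = (\<lambda>j. 1 / s0 * b $ j)" by (simp add: bh_def fun_eq_iff)
      then show ?thesis by (simp only: polar_mult_left)
    qed
    ultimately show "\<xi> k = 0" using immersive s0(2) by (simp add: immersive_at_def)
  next
    fix k :: "'n option"
    define e where "e l = (if l = k then 1 else 0 :: 'k)" for l
    have "t k i = polar id (q i) bh e" for i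
      unfolding t[symmetric] e_def by (subst sum.remove[of _ k]) auto
    then have "(\<Sum>i\<in>UNIV. g' i * t k i) = (\<Sum>i\<in>UNIV. g' i * polar id (q i) bh e)" by simp
    then show "(\<Sum>i\<in>UNIV. g' i * t k i) = 0" by (simp add: g'_polar g_polar_bh)
  next
    show "g' (id None) \<noteq> 0" using g_None by (simp add: g'_def)
  qed (rule bij_id)
  then show ?thesis by (simp add: t_def)
qed

sublocale quadratic_system "\<lambda>i. q (Some i)" bh
  by unfold_locales (rule q_sym, rule det_bh)

text \<open>The inverse function theorem with increments 0 for \<open>y\<^sub>0\<close> and the
  variables for the others; these are linear, as the convergence estimate demands.\<close>

lemma section_exists:
  "\<exists>u. quadratic_chart q \<tau> u \<and> (\<forall>j. mps_coeff (u j) {#} = bh j) \<and> (\<forall>j. u j \<in> \<O>)"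
proof -
  define N :: "'n option \<Rightarrow> ('n, 'k) mps" where "N i = (case i of None \<Rightarrow> 0 | Some i \<Rightarrow> mps_var i)" for i
  have N: "mps_coeff (N i) M = 0" if "size M \<noteq> 1" for i M
    using that by (auto simp: N_def mps_coeff_var split: option.splits)
  have N0: "mps_coeff (N i) {#} = 0" for i by (rule N) simp
  obtain U where U: "\<And>i. mps_coeff (U i) {#} = 0"
    "\<And>i. U i = (\<Sum>l\<in>UNIV. mps_const (Mi $ i $ l) * N l) + polar mps_const (\<lambda>j k. - (1 / 2) * (\<Sum>l\<in>UNIV. Mi $ i $ l * q (Some l) j k)) U U"
    "\<And>i. mps_const (1 / 2) * polar mps_const (q (Some i)) (\<lambda>j. mps_const (bh j) + U j) (\<lambda>j. mps_const (bh j) + U j)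
        = mps_const (1 / 2 * polar id (q (Some i)) bh bh) + N i"
    by (rule solution_exists[of N]) (use N0 in auto)
  define u where "u j = mps_const (bh j) + U j" for j
  have "U i \<in> \<O>" for i
    by (rule germ_quadratic_fixpoint[OF germs _ U(1) U(2)]) (simp add: N mps_coeff_const_mult)
  then have "u j \<in> \<O>" for j by (simp add: u_def germ_add[OF germs] germ_const[OF germs])
  moreover have "quadratic_chart q \<tau> u"
  proof
    show "q m j l = q m l j" for m j l by (rule q_sym)
    show "mps_const (1 / 2) * polar mps_const (q (Some None)) u u = 1"
      using U(3)[of None] yp_0 by (simp add: u_def[abs_def] bh_polar N_def)
    show "mps_const (1 / 2) * polar mps_const (q (Some (Some i))) u u = mps_const (\<tau> i) + mps_var i" for i
      using U(3)[of "Some i"] by (simp add: u_def[abs_def] bh_polar N_def \<tau>_def)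
  qed
  ultimately show ?thesis using U(1) by (intro exI[of _ u]) (simp add: u_def)
qed

definition u where "u = (SOME u. quadratic_chart q \<tau> u \<and> (\<forall>j. mps_coeff (u j) {#} = bh j) \<and> (\<forall>j. u j \<in> \<O>))"

lemma u: "quadratic_chart q \<tau> u" "mps_coeff (u j) {#} = bh j" "u j \<in> \<O>"
  using someI_ex[OF section_exists] unfolding u_def[symmetric] by auto

sublocale ch: quadratic_chart q \<tau> u by (rule u(1))

definition jac where "jac = det (\<chi> i k. \<Sum>j\<in>UNIV. mps_const (q (Some i) j k) * u j)"

lemma jac_frame_det: "jac * ch.frame_det = 2"
  unfolding jac_def by (rule ch.jacobian_frame_det)

lemma germ_f: "ch.f \<in> \<O>"
  unfolding ch.f_def by (intro germ_mult[OF germs] germ_const[OF germs] germ_polar[OF germs] u)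

lemma germ_density: "ch.density c \<in> \<O>"
proof -
  have "ch.frame r j \<in> \<O>" for r j
    by (cases r) (simp_all add: ch.frame_def u germ_deriv[OF germs])
  then show ?thesis
    unfolding ch.density_def ch.frame_det_def
    by (intro germ_mult[OF germs] germ_const[OF germs] germ_sum[OF germs] u germ_det[OF germs]) simp
qed

lemma f_0: "mps_coeff ch.f {#} = yp None / yp (Some None)"
proof -
  have "mps_coeff (polar mps_const (q None) u u) {#} = polar id (q None) bh bh"
    using polar_ring_map[OF ring_map_const_term, of mps_const "q None" u u] by (simp add: u id_def)
  then show ?thesis by (simp add: ch.f_def bh_polar)
qed

definition fr where "fr r j = mps_coeff (ch.frame r j) {#}"

lemma fr_None: "fr None j = bh j"
  by (simp add: fr_def ch.frame_def u)

lemma det_fr: "det (\<chi> j r. fr r j) \<noteq> 0"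
proof -
  have "mps_coeff ch.frame_det {#} = det (\<chi> j r. fr r j)"
    unfolding ch.frame_det_def fr_def by (simp add: ring_map_det[OF ring_map_const_term])
  moreover have "mps_coeff jac {#} * mps_coeff ch.frame_det {#} = 2"
    using arg_cong[OF jac_frame_det, of "\<lambda>p. mps_coeff p {#}"] by (simp add: mps_numeral)
  ultimately show ?thesis by auto
qed

text \<open>A linear relation passes to values and first derivatives at the origin, which form the
  invertible matrix \<open>fr\<close>.\<close>

lemma u_independent:
  assumes "(\<Sum>j\<in>UNIV. mps_const (c j) * u j) = 0"
  shows "c k = 0"
proof (rule det_nonzero_kernel[of "transpose (\<chi> j r. fr r j)" c k])
  fix r
  have "jet r (\<Sum>j\<in>UNIV. mps_const (c j) * u j) = 0" unfolding assms by (cases r) auto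
  then have "(\<Sum>j\<in>UNIV. mps_const (c j) * ch.frame r j) = 0" by (simp add: jet_sum ch.frame_jet)
  from arg_cong[OF this, of "\<lambda>p. mps_coeff p {#}"]
  show "(\<Sum>j\<in>UNIV. Finite_Cartesian_Product.transpose (\<chi> j r. fr r j) $ r $ j * c j) = 0"
    by (simp add: fr_def Finite_Cartesian_Product.transpose_def mult.commute)
qed (use det_fr in simp)

lemma density_jac: "ch.density c * jac = (\<Sum>j\<in>UNIV. mps_const (c j) * u j)"
proof -
  have "ch.density c * jac = mps_const (1 / 2) * (\<Sum>j\<in>UNIV. mps_const (c j) * u j) * (jac * ch.frame_det)"
    by (simp add: ch.density_def mult_ac)
  then show ?thesis
    unfolding jac_frame_det by (simp add: mps_numeral mult.commute[of _ "mps_const 2"] mult.assoc[symmetric] mps_const_mult[symmetric])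
qed

lemma density_nonzero: "c k \<noteq> 0 \<Longrightarrow> ch.density c \<noteq> 0"
  using density_jac[of c] u_independent[of c k] by auto

text \<open>Pairing the second derivatives of the \<open>y\<^sub>m\<close> with \<open>g'\<close> at
  the origin removes the second derivatives of \<open>u\<close>, as \<open>g\<close> annihilates
  tangents. So the Hessian is, up to \<open>g' None\<close>, the conormal form on the derivatives of
  \<open>u\<close>. A kernel vector yields \<open>\<eta>\<close> in the kernel of the form, hence on
  the line of \<open>b\<close>, against the independence of the frame.\<close>

lemma det_hessian: "det (hessian ch.f) \<noteq> 0"
proof
  assume "det (hessian ch.f) = 0"
  define h where "h i j = mps_coeff (mps_deriv i (mps_deriv j ch.f)) {#}" for i j
  have "mps_coeff (det (hessian ch.f)) {#} = det (\<chi> i j. h i j)"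
    by (simp add: ring_map_det[OF ring_map_const_term] hessian_def h_def)
  then have "det (\<chi> i j. h i j) = 0" using \<open>det (hessian ch.f) = 0\<close> by simp
  then obtain \<xi> l where \<xi>: "(\<chi> i j. h i j) *v \<xi> = 0" "\<xi> $ l \<noteq> 0"
    by (rule singular_matrix_kernel)
  define \<beta> where "\<beta> i = fr (Some i)" for i
  have ev: "mps_coeff (ch.Y m v w) {#} = polar id (q m) (\<lambda>j. mps_coeff (v j) {#}) (\<lambda>j. mps_coeff (w j) {#})" for m v w
    using polar_ring_map[OF ring_map_const_term, of mps_const "q m" v w] by (simp add: id_def)
  have second: "mps_coeff (mps_deriv i (mps_deriv j (ch.y m))) {#} = polar id (q m) (\<beta> i) (\<beta> j)
      + polar id (q m) bh (\<lambda>k. mps_coeff (mps_deriv i (mps_deriv j (u k))) {#})" for m i j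
    unfolding ch.Y_deriv[symmetric]
    by (subst polar_derivation[OF derivation_mps_deriv]) (simp_all add: ev u \<beta>_def fr_def[abs_def] ch.frame_def)
  have H: "g' None * h i j = (\<Sum>l\<in>UNIV. g l * polar id (a l) (\<beta> i) (\<beta> j))" for i j
  proof -
    have eq: "mps_coeff (mps_deriv i (mps_deriv j (ch.y m))) {#} = (if m = None then h i j else 0)" for m
      by (auto simp: ch.y_def h_def mps_deriv_var split: option.splits)
    have "g' None * h i j = (\<Sum>m\<in>UNIV. g' m * mps_coeff (mps_deriv i (mps_deriv j (ch.y m))) {#})"
      unfolding eq by (simp add: sum_option)
    also have "\<dots> = (\<Sum>m\<in>UNIV. g' m * polar id (q m) (\<beta> i) (\<beta> j))
        + (\<Sum>m\<in>UNIV. g' m * polar id (q m) bh (\<lambda>k. mps_coeff (mps_deriv i (mps_deriv j (u k))) {#}))"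
      by (simp add: second distrib_left sum.distrib)
    finally show ?thesis by (simp add: g'_polar g_polar_bh)
  qed
  define \<eta> where "\<eta> k = (\<Sum>j\<in>UNIV. \<xi> $ j * \<beta> j k)" for k
  define B where "B v = (\<Sum>l\<in>UNIV. g l * polar id (a l) v \<eta>)" for v
  have B_sum: "B v = (\<Sum>k\<in>UNIV. B (\<lambda>l. if l = k then 1 else 0) * v k)" for v
  proof -
    have v: "v = (\<lambda>j. \<Sum>k\<in>UNIV. v k * (if j = k then 1 else 0))"
      by (simp add: fun_eq_iff if_distrib cong: if_cong)
    have "B v = (\<Sum>l\<in>UNIV. g l * (\<Sum>k\<in>UNIV. v k * polar id (a l) (\<lambda>j. if j = k then 1 else 0) \<eta>))"
      unfolding B_def by (subst v) (simp only: polar_sum_left)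
    also have "\<dots> = (\<Sum>k\<in>UNIV. B (\<lambda>l. if l = k then 1 else 0) * v k)"
      unfolding B_def sum_distrib_left sum_distrib_right by (subst sum.swap) (simp add: mult_ac)
    finally show ?thesis .
  qed
  have B_fr: "B (fr r) = 0" for r
  proof (cases r)
    case None
    have "fr None = bh" by (simp add: fr_None fun_eq_iff)
    then show ?thesis using None by (simp add: B_def g_polar_bh)
  next
    case (Some i)
    have "B (\<beta> i) = (\<Sum>l\<in>UNIV. g l * (\<Sum>j\<in>UNIV. \<xi> $ j * polar id (a l) (\<beta> i) (\<beta> j)))"
      unfolding B_def \<eta>_def[abs_def] by (simp only: polar_sum_right)
    also have "\<dots> = (\<Sum>j\<in>UNIV. \<xi> $ j * (g' None * h i j))"
      unfolding H sum_distrib_left by (subst sum.swap) (simp add: mult.left_commute)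
    also have "\<dots> = g' None * (((\<chi> i j. h i j) *v \<xi>) $ i)"
      by (simp add: matrix_vector_mult_def sum_distrib_left mult_ac)
    finally show ?thesis using \<xi>(1) Some by (simp add: \<beta>_def)
  qed
  have B0: "B (\<lambda>l. if l = k then 1 else 0) = 0" for k
  proof (rule det_nonzero_kernel[of "transpose (\<chi> j r. fr r j)" "\<lambda>k. B (\<lambda>l. if l = k then 1 else 0)" k])
    fix r
    show "(\<Sum>j\<in>UNIV. Finite_Cartesian_Product.transpose (\<chi> j r. fr r j) $ r $ j * B (\<lambda>l. if l = j then 1 else 0)) = 0"
      using B_fr[of r] unfolding B_sum[of "fr r"] by (simp add: Finite_Cartesian_Product.transpose_def mult.commute)
  qed (use det_fr in simp)
  have "\<exists>c. \<forall>k. \<eta> k = c * b $ k"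
  proof (rule g_kernel)
    fix l
    have "(\<Sum>i\<in>UNIV. \<Sum>k\<in>UNIV. g i * a i k l * \<eta> k) = B (\<lambda>j. if j = l then 1 else 0)"
    proof -
      have "polar id (a i) (\<lambda>j. if j = l then 1 else 0) \<eta> = (\<Sum>k\<in>UNIV. a i k l * \<eta> k)" for i
        by (subst polar_commute) (rule a_sym, simp add: polar_def if_distrib cong: if_cong)
      then show ?thesis by (simp add: B_def sum_distrib_left mult.assoc)
    qed
    then show "(\<Sum>i\<in>UNIV. \<Sum>k\<in>UNIV. g i * a i k l * \<eta> k) = 0" by (simp add: B0)
  qed
  then obtain c where c: "\<And>k. \<eta> k = c * b $ k" by blast
  define x where "x r = (case r of None \<Rightarrow> - c * s0 | Some j \<Rightarrow> \<xi> $ j)" for r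
  have "x (Some l) = 0"
  proof (rule det_nonzero_kernel[OF det_fr, of x])
    fix j
    have "(\<Sum>r\<in>UNIV. (\<chi> j r. fr r j) $ j $ r * x r) = - (c * s0 * bh j) + \<eta> j"
      by (simp add: sum_option x_def fr_None \<eta>_def \<beta>_def mult_ac)
    then show "(\<Sum>r\<in>UNIV. (\<chi> j r. fr r j) $ j $ r * x r) = 0" using s0(2) by (simp add: c bh_def)
  qed
  then show False using \<xi>(2) by (simp add: x_def)
qed

lemma admissible_density_pair:
  assumes "c k \<noteq> 0"
  shows "admissible_pair ch.f (ch.density c)"
  unfolding admissible_pair_def
  using det_hessian density_nonzero[of c k, OF assms] ch.stat_phase_coeff_density[OF det_hessian] by blast

lemma density_linear: "(\<Sum>l\<in>S. mps_const (e l) * ch.density (c l)) = ch.density (\<lambda>j. \<Sum>l\<in>S. e l * c l j)"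
proof -
  have "(\<Sum>l\<in>S. mps_const (e l) * ch.density (c l)) * jac = (\<Sum>l\<in>S. \<Sum>j\<in>UNIV. mps_const (e l * c l j) * u j)"
    by (simp add: sum_distrib_right mult.assoc density_jac sum_distrib_left mps_const_mult)
  also have "\<dots> = ch.density (\<lambda>j. \<Sum>l\<in>S. e l * c l j) * jac"
    unfolding density_jac by (subst sum.swap) (simp add: mps_const_sum sum_distrib_right)
  finally show ?thesis
    using jac_frame_det by auto
qed

text \<open>The density depends linearly and injectively on its \<open>n + 1\<close> coefficients,
  so a basis of linear forms gives independent members of the admissible space.\<close>

lemma rank_ge: "enat (CARD('n) + 1) \<le> rank_of \<O> ch.f"
proof -
  interpret V: vector_space "mps_scale :: 'k \<Rightarrow> ('n, 'k) mps \<Rightarrow> _" by (rule vector_space_mps)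
  define \<gamma> where "\<gamma> l = ch.density (\<lambda>j. if j = l then 1 else 0)" for l
  have lin: "e k = 0" if "(\<Sum>l\<in>UNIV. mps_const (e l) * \<gamma> l) = 0" for e k
  proof (rule ccontr)
    assume "e k \<noteq> 0"
    have "(\<Sum>l\<in>UNIV. mps_const (e l) * \<gamma> l) = ch.density e"
      unfolding \<gamma>_def density_linear by (simp add: if_distrib cong: if_cong)
    then show False using density_nonzero[of e k] \<open>e k \<noteq> 0\<close> that by simp
  qed
  have inj: "inj \<gamma>"
  proof (rule injI, rule ccontr)
    fix l l' assume *: "\<gamma> l = \<gamma> l'" "l \<noteq> l'"
    define e :: "'n option \<Rightarrow> 'k" where "e k = (if k = l then 1 else if k = l' then - 1 else 0)" for k
    have "(\<Sum>k\<in>UNIV. mps_const (e k) * \<gamma> k) = (\<Sum>k\<in>UNIV. (if k = l then \<gamma> k else 0) - (if k = l' then \<gamma> k else 0))"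
      by (intro sum.cong refl) (use * in \<open>auto simp: e_def mps_const_uminus\<close>)
    also have "\<dots> = 0" using * by (simp add: sum_subtractf)
    finally have "e l = 0" by (rule lin)
    then show False by (simp add: e_def)
  qed
  have adm: "range \<gamma> \<subseteq> admissible_space \<O> ch.f"
    unfolding admissible_space_def \<gamma>_def
    using germ_density admissible_density_pair by (auto intro: admissible_density_pair)
  have indep: "\<not> V.dependent (range \<gamma>)"
  proof
    assume "V.dependent (range \<gamma>)"
    then obtain e where e: "\<exists>v\<in>range \<gamma>. e v \<noteq> 0" "(\<Sum>v\<in>range \<gamma>. mps_scale (e v) v) = 0"
      by (subst (asm) V.dependent_finite) auto
    have "(\<Sum>l\<in>UNIV. mps_const (e (\<gamma> l)) * \<gamma> l) = 0"
      using e(2) by (simp add: sum.reindex[OF inj] mps_scale_def)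
    then have "e (\<gamma> l) = 0" for l by (rule lin[of "\<lambda>l. e (\<gamma> l)"])
    then show False using e(1) by auto
  qed
  have "card (range \<gamma>) = CARD('n) + 1"
    using card_image[OF inj] by (simp add: card_UNIV_option)
  moreover have "enat (card (range \<gamma>)) \<le> rank_of \<O> ch.f"
    unfolding rank_of_def by (rule SUP_upper) (use adm indep in auto)
  ultimately show ?thesis by simp
qed


section \<open>Existence and uniqueness of the chart, and its densities\<close>

lemma x_section: "poly_eval mps_const u (x j) = mps_const (1 / 2) * polar mps_const (a j) u u"
  by (rule poly_eval_x[OF ring_map_mps_const])

text \<open>Replacing \<open>f\<close> by another function \<open>f'\<close> moves the section's
  image in the direction \<open>y\<^sub>n\<^sub>+\<^sub>1\<close> by the difference.\<close>

lemma chart_coordinates: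
  "(\<Sum>i\<in>UNIV. mps_const (Li $ j $ i) * graph_point (\<chi> i. \<tau> i) f' $ i)
    = poly_eval mps_const u (x j) + (f' - ch.f) * mps_const (Li $ j $ None)"
proof -
  have "graph_point (\<chi> i. \<tau> i) f' $ i = ch.y i + (if i = None then f' - ch.f else 0)" for i
    by (auto simp: graph_point_def ch.y_def split: option.splits)
  then have "(\<Sum>i\<in>UNIV. mps_const (Li $ j $ i) * graph_point (\<chi> i. \<tau> i) f' $ i)
    = (\<Sum>i\<in>UNIV. mps_const (Li $ j $ i) * ch.y i) + (\<Sum>i\<in>UNIV. mps_const (Li $ j $ i) * (if i = None then f' - ch.f else 0))"
    by (simp add: distrib_left sum.distrib)
  also have "(\<Sum>i\<in>UNIV. mps_const (Li $ j $ i) * ch.y i) = poly_eval mps_const u (x j)"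
    unfolding x_section polar_a[OF ring_map_mps_const, of j] ch.y_eq sum_distrib_left by (simp add: mult.left_commute)
  also have "(\<Sum>i\<in>UNIV. mps_const (Li $ j $ i) * (if i = None then f' - ch.f else 0)) = (f' - ch.f) * mps_const (Li $ j $ None)"
    by (simp add: if_distrib mult.commute cong: if_cong)
  finally show ?thesis .
qed

lemma equation_on_section:
  assumes "reduced_equation C F"
  shows "poly_eval mps_const (\<lambda>j. poly_eval mps_const u (x j)) F = 0"
  using poly_eval_poly_eval[where S = x and \<sigma> = u, OF ring_map_mps_const is_poly_x reduced_equation_poly[OF assms]]
    reduced_equation_pull[OF assms] by (simp add: pull_def poly_eval_0)

text \<open>By Taylor expansion in that direction, the equation on the displaced graph is the
  displacement times a series with non-zero constant term.\<close>

lemma chart_unique: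
  assumes F: "reduced_equation C F" and e: "(\<Sum>j\<in>UNIV. gradient_at F p $ j * Li $ j $ None) \<noteq> 0"
    and 0: "poly_eval mps_const (\<lambda>j. \<Sum>i\<in>UNIV. mps_const (Li $ j $ i) * graph_point (\<chi> i. \<tau> i) f' $ i) F = 0"
    and f': "mps_coeff f' {#} = mps_coeff ch.f {#}"
  shows "f' = ch.f"
proof -
  note P = reduced_equation_poly[OF F]
  define z where "z j = poly_eval mps_const u (x j)" for j
  define d where "d = f' - ch.f"
  \<comment> \<open>The section starts over the point \<open>c *s p\<close>, where
    \<open>y\<^sub>0 = 1\<close>, whereas transversality is known at \<open>p\<close>;
    \<open>gradient_scale\<close> bridges the two.\<close>
  define c where "c = 1 / yp (Some None)"
  obtain R where R: "poly_eval mps_const (\<lambda>j. z j + d * mps_const (Li $ j $ None)) F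
    = poly_eval mps_const z F + d * ((\<Sum>j\<in>UNIV. poly_eval mps_const z (mps_deriv j F) * mps_const (Li $ j $ None)) + d * R)"
    by (rule poly_eval_taylor[OF ring_map_mps_const P])
  have z0: "mps_coeff (z j) {#} = (c *s p) $ j" for j
  proof -
    have "mps_coeff (z j) {#} = 1 / 2 * polar id (a j) bh bh"
      using polar_ring_map[OF ring_map_const_term, of mps_const "a j" u u] by (simp add: z_def x_section u id_def)
    also have "polar id (a j) bh bh = 1 / s0 * (1 / s0 * polar id (a j) (($) b) (($) b))"
    proof -
      have bh: "bh = (\<lambda>j. 1 / s0 * b $ j)" by (simp add: bh_def fun_eq_iff)
      show ?thesis unfolding bh polar_mult_left polar_mult_right ..
    qed
    also have "1 / 2 * \<dots> = (c *s p) $ j"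
      using s0 by (simp add: c_def p_def quad_map_nth power2_eq_square[symmetric] field_simps)
    finally show ?thesis .
  qed
  have ev: "mps_coeff (poly_eval mps_const z (mps_deriv j F)) {#} = gradient_at F (c *s p) $ j" for j
    by (simp add: ring_map_poly_eval[OF ring_map_const_term] z0 gradient_at_def poly_at_def id_def)
  define V where "V = (\<Sum>j\<in>UNIV. poly_eval mps_const z (mps_deriv j F) * mps_const (Li $ j $ None)) + d * R"
  have "mps_coeff V {#}
    = (\<Sum>j\<in>UNIV. gradient_at F (c *s p) $ j * Li $ j $ None)"
    using f' ev by (simp add: V_def d_def)
  also have "\<dots> \<noteq> 0"
    by (rule gradient_scale[OF F _ _ e]) (use yp_0 quad_map_in_C in \<open>auto simp: c_def p_def\<close>)
  finally have "V \<noteq> 0" by (metis mps_coeff_0)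
  moreover have "poly_eval mps_const z F = 0" unfolding z_def by (rule equation_on_section[OF F])
  moreover have "poly_eval mps_const (\<lambda>j. z j + d * mps_const (Li $ j $ None)) F = 0"
    using 0 unfolding chart_coordinates z_def d_def .
  ultimately have "d = 0" using R by (simp add: V_def[symmetric])
  then show ?thesis by (simp add: d_def)
qed

lemma chart_exists:
  assumes F: "reduced_equation C F" and e: "(\<Sum>j\<in>UNIV. gradient_at F p $ j * Li $ j $ None) \<noteq> 0"
  shows "cone_chart \<O> C L (\<chi> i. \<tau> i) ch.f p"
proof -
  have "poly_eval mps_const (\<lambda>j. \<Sum>i\<in>UNIV. mps_const (Li $ j $ i) * graph_point (\<chi> i. \<tau> i) ch.f $ i) F = 0"
    unfolding chart_coordinates using equation_on_section[OF F] by simp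
  then have "\<exists>F. reduced_equation C F \<and>
      poly_eval mps_const (\<lambda>j. \<Sum>i\<in>UNIV. mps_const (Li $ j $ i) * graph_point (\<chi> i. \<tau> i) ch.f $ i) F = 0 \<and>
      (\<Sum>j\<in>UNIV. gradient_at F p $ j * Li $ j $ None) \<noteq> 0"
    using F e by blast
  moreover have "yp (Some (Some i)) = yp (Some None) * \<tau> i" for i using yp_0 by (simp add: \<tau>_def)
  moreover have "yp None = yp (Some None) * mps_coeff ch.f {#}" using yp_0 by (simp add: f_0)
  moreover have "p \<in> C" by (simp add: p_def quad_map_in_C)
  ultimately show ?thesis
    unfolding cone_chart_def Let_def using L germ_f yp_0 by (simp add: yp_def)
qed

text \<open>Near \<open>b\<close> the coordinates are \<open>s\<close> times the section at the
  projective coordinates. The Jacobian of the \<open>y\<^sub>i\<close> then scales by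
  \<open>s ^ (n + 1)\<close> and the linear form by \<open>s\<close>, leaving \<open>s ^ n\<close>,
  the power that the definition of densities prescribes.\<close>

lemma density_in_chart:
  assumes c: "c \<noteq> 0"
  shows "density_in_chart \<O> a L (\<chi> i. \<tau> i) ch.f b (linear_germ b c)"
proof -
  define B :: "'n option \<Rightarrow> ('n option, 'k) mps" where "B j = mps_const (b $ j) + mps_var j" for j
  define y where "y = (\<chi> i j. mps_const (L $ i $ j)) *v quad_map a mps_const (coord_germs b)"
  have B: "($) (coord_germs b) = B" by (simp add: coord_germs_def B_def fun_eq_iff)
  have y: "y $ i = mps_const (1 / 2) * polar mps_const (q i) B B" for i
    by (simp add: y_def matrix_vector_mult_def quad_map_nth B polar_q[OF ring_map_mps_const] sum_distrib_left mult.left_commute)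
  have ev: "mps_coeff (polar mps_const Q v w) {#} = polar id Q (\<lambda>j. mps_coeff (v j) {#}) (\<lambda>j. mps_coeff (w j) {#})"
    for Q and v w :: "'n option \<Rightarrow> ('n option, 'k) mps"
    using polar_ring_map[OF ring_map_const_term, of mps_const Q v w] by (simp add: id_def)
  have B0: "(\<lambda>j. mps_coeff (B j) {#}) = (\<lambda>j. s0 * bh j)" using s0 by (simp add: B_def bh_def)
  have y0: "mps_coeff (y $ i) {#} = yp i" for i
    unfolding y mps_coeff_mult_empty ev B0 polar_mult_left polar_mult_right bh_polar
    using s0 yp_0 by (simp add: power2_eq_square[symmetric] field_simps)
  obtain s where s: "s\<^sup>2 = y $ Some None" "mps_coeff s {#} = s0"
    by (rule mps_sqrt[of "y $ Some None" s0]) (use s0 y0 in auto)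
  obtain s' where s': "s * s' = 1" using s(2) s0(2) by (metis mps_unit)
  have s'0: "mps_coeff s' {#} = 1 / s0"
    using arg_cong[OF s', of "\<lambda>p. mps_coeff p {#}"] s(2) s0(2) by (simp add: field_simps)
  define T where "T i = s' * (s' * y $ Some (Some i)) - mps_const (\<tau> i)" for i
  have T0: "mps_coeff (T i) {#} = 0" for i
    using s0 by (simp add: T_def y0 s'0 \<tau>_def power2_eq_square[symmetric])
  have T_eq: "(mps_const (\<tau> i) + T i) * y $ Some None = y $ Some (Some i)" for i
  proof -
    have "(mps_const (\<tau> i) + T i) * y $ Some None = (s * s') * (s * s') * y $ Some (Some i)"
      by (simp add: T_def s(1)[symmetric] power2_eq_square mult_ac)
    then show ?thesis by (simp add: s')
  qed
  note subst = ring_map_mps_subst[of T, OF T0]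
  define v where "v j = mps_subst T (u j)" for j
  have v_polar: "mps_subst T (polar mps_const Q u u) = polar mps_const Q v v" for Q
    using polar_ring_map[OF subst, of mps_const Q u u] by (simp add: mps_subst_const[of T, OF T0] v_def[abs_def])
  \<comment> \<open>Both \<open>s' * B\<close> and the pulled back section solve the same quadratic
    system with the same value at the origin.\<close>
  have B_v: "B k = s * v k" for k
  proof -
    have "s' * B k = v k"
    proof (rule solution_unique)
      show "mps_coeff (s' * B j) {#} = bh j" for j
        using s0 fun_cong[OF B0, of j] by (simp add: s'0)
      show "mps_coeff (v j) {#} = bh j" for j by (simp add: v_def mps_subst_const_term[of T, OF T0] u)
      fix i
      have *: "mps_const (1 / 2) * polar mps_const (q (Some i)) (\<lambda>j. s' * B j) (\<lambda>j. s' * B j) = s' * (s' * y $ Some i)"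
        unfolding polar_mult_left polar_mult_right y by (simp add: mult_ac)
      also have "\<dots> = mps_subst T (ch.y (Some i))"
      proof (cases i)
        case None
        have "s' * (s' * y $ Some None) = (s * s') * (s * s')" by (simp add: s(1)[symmetric] power2_eq_square mult_ac)
        then show ?thesis using None mps_subst_const[of T, OF T0, of 1] by (simp add: s' ch.y_def)
      next
        case (Some l)
        then show ?thesis
          by (simp add: ch.y_def T_def mps_subst_add[of T, OF T0] mps_subst_const[of T, OF T0] mps_subst_var[of T, OF T0])
      qed
      also have "\<dots> = mps_const (1 / 2) * polar mps_const (q (Some i)) v v"
        by (simp add: ch.y_eq ring_map_mult[OF subst] mps_subst_const[of T, OF T0] v_polar)
      finally have "2 * (mps_const (1 / 2) * polar mps_const (q (Some i)) (\<lambda>j. s' * B j) (\<lambda>j. s' * B j))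
        = 2 * (mps_const (1 / 2) * polar mps_const (q (Some i)) v v)" by simp
      then show "polar mps_const (q (Some i)) (\<lambda>j. s' * B j) (\<lambda>j. s' * B j) = polar mps_const (q (Some i)) v v"
        by (simp add: mps_numeral mult.assoc[symmetric] mps_const_mult[symmetric])
    qed
    then have "s * v k = (s * s') * B k" by (simp add: mult_ac)
    then show ?thesis by (simp add: s')
  qed
  define N where "N = (\<chi> i k. \<Sum>j\<in>UNIV. mps_const (q (Some i) j k) * v j)"
  have det_y: "det (\<chi> j k. mps_deriv k (y $ Some j)) = s ^ Suc CARD('n) * det N"
  proof -
    have dB: "mps_deriv k (B j) = (if j = k then 1 else 0)" for j k by (auto simp: B_def mps_deriv_var)
    have "mps_deriv k (y $ Some i) = s * (\<Sum>j\<in>UNIV. mps_const (q (Some i) j k) * v j)" for i k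
    proof -
      have "mps_deriv k (polar mps_const (q (Some i)) B B) = 2 * polar mps_const (q (Some i)) B (\<lambda>j. mps_deriv k (B j))"
        by (subst polar_derivation[OF derivation_mps_deriv])
           (simp_all add: polar_commute[of "q (Some i)" mps_const "\<lambda>j. mps_deriv k (B j)" B, OF q_sym])
      also have "polar mps_const (q (Some i)) B (\<lambda>j. mps_deriv k (B j)) = (\<Sum>j\<in>UNIV. mps_const (q (Some i) j k) * B j)"
        by (simp add: polar_def dB if_distrib cong: if_cong)
      also have "\<dots> = s * (\<Sum>j\<in>UNIV. mps_const (q (Some i) j k) * v j)"
        by (simp add: B_v sum_distrib_left mult.left_commute)
      finally show ?thesis
        by (simp add: y mult.assoc[symmetric] mps_numeral mps_const_mult[symmetric])
    qed
    then have "(\<chi> j k. mps_deriv k (y $ Some j)) = (\<chi> i. s *s N $ i)" by (simp add: vec_eq_iff N_def)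
    then show ?thesis by (simp add: det_rows_mul card_UNIV_option)
  qed
  define \<gamma> where "\<gamma> = ch.density (($) c)"
  have "mps_subst T jac = det N"
    by (simp add: jac_def ring_map_det[OF subst] N_def ring_map_sum[OF subst] ring_map_mult[OF subst] mps_subst_const[of T, OF T0] v_def)
  then have \<gamma>_N: "mps_subst T \<gamma> * det N = (\<Sum>j\<in>UNIV. mps_const (c $ j) * v j)"
    using arg_cong[OF density_jac[of "($) c"], of "mps_subst T"]
    by (simp add: \<gamma>_def ring_map_sum[OF subst] ring_map_mult[OF subst] mps_subst_const[of T, OF T0] v_def)
  have "mps_subst T \<gamma> * det (\<chi> j k. mps_deriv k (y $ Some j)) = s ^ Suc CARD('n) * (mps_subst T \<gamma> * det N)"
    by (simp add: det_y mult_ac)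
  also have "\<dots> = (\<Sum>j\<in>UNIV. mps_const (c $ j) * (s * v j)) * s ^ CARD('n)"
    unfolding \<gamma>_N sum_distrib_left sum_distrib_right by (simp add: mult_ac)
  also have "\<dots> = linear_germ b c * s ^ CARD('n)"
    by (simp add: linear_germ_def coord_germs_def B_v[symmetric] B_def)
  finally have dens: "mps_subst T \<gamma> * det (\<chi> j k. mps_deriv k (y $ Some j)) = linear_germ b c * s ^ CARD('n)" .
  obtain k where "c $ k \<noteq> 0" using c by (auto simp: vec_eq_iff)
  then have "admissible_pair ch.f \<gamma>" unfolding \<gamma>_def by (rule admissible_density_pair)
  moreover have "\<gamma> \<in> \<O>" unfolding \<gamma>_def by (rule germ_density)
  ultimately show ?thesis
    unfolding density_in_chart_def Let_def y_def[symmetric]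
    using s(1) T0 T_eq dens by (intro exI[of _ s] exI[of _ T] exI[of _ \<gamma>]) auto
qed

end

context quadratic_cone
begin

lemma chart_at_I:
  assumes \<O>: "germ_space \<O>" and b: "immersive_at b" and gauss: "gauss_immersive C (quad_map a id b)"
  shows "\<exists>F. reduced_equation C F \<and> gradient_at F (quad_map a id b) \<noteq> 0 \<and>
    (\<forall>L. invertible L \<longrightarrow> (L *v quad_map a id b) $ Some None \<noteq> 0 \<longrightarrow>
      (\<Sum>j\<in>UNIV. gradient_at F (quad_map a id b) $ j * matrix_inv L $ j $ None) \<noteq> 0 \<longrightarrow>
      chart_at C a b L (\<lambda>i. gradient_at F (quad_map a id b) $ i) \<O>)"
proof -
  obtain F where F: "reduced_equation C F" "gradient_at F (quad_map a id b) \<noteq> 0"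
    and K: "\<forall>\<xi>. (\<forall>l. (\<Sum>i\<in>UNIV. \<Sum>k\<in>UNIV. gradient_at F (quad_map a id b) $ i * a i k l * \<xi> k) = 0) \<longrightarrow> (\<exists>c. \<forall>k. \<xi> k = c * b $ k)"
    using gauss_kernel[OF b gauss] by blast
  have "chart_at C a b L (\<lambda>i. gradient_at F (quad_map a id b) $ i) \<O>"
    if "invertible L" "(L *v quad_map a id b) $ Some None \<noteq> 0"
      "(\<Sum>j\<in>UNIV. gradient_at F (quad_map a id b) $ j * matrix_inv L $ j $ None) \<noteq> 0" for L
  proof unfold_locales
    show "\<exists>c. \<forall>k. \<xi> k = c * b $ k"
      if "\<And>l. (\<Sum>i\<in>UNIV. \<Sum>k\<in>UNIV. gradient_at F (quad_map a id b) $ i * a i k l * \<xi> k) = 0" for \<xi>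
      using K that by blast
  qed (fact b gradient_tangent[OF F(1)] that \<O>)+
  with F show ?thesis by blast
qed

text \<open>A chart comes with its own equation \<open>F1\<close>. Its gradient is a multiple of
  that of \<open>F\<close>, so transversality carries over to \<open>F\<close>, and uniqueness
  identifies \<open>\<tau>\<close> and \<open>f\<close> with the constructed ones.\<close>

lemma chart_of_cone_chart:
  assumes \<O>: "germ_space \<O>" and b: "immersive_at b" and gauss: "gauss_immersive C (quad_map a id b)"
    and chart: "cone_chart \<O> C L \<tau> f (quad_map a id b)"
  shows "enat (CARD('n) + 1) \<le> rank_of \<O> f" "c \<noteq> 0 \<Longrightarrow> density_in_chart \<O> a L \<tau> f b (linear_germ b c)"
proof -
  define p where "p = quad_map a id b"
  obtain F where F: "reduced_equation C F" "gradient_at F p \<noteq> 0"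
    and chart_at: "\<forall>L. invertible L \<longrightarrow> (L *v p) $ Some None \<noteq> 0 \<longrightarrow>
      (\<Sum>j\<in>UNIV. gradient_at F p $ j * matrix_inv L $ j $ None) \<noteq> 0 \<longrightarrow>
      chart_at C a b L (\<lambda>i. gradient_at F p $ i) \<O>"
    using chart_at_I[OF \<O> b gauss] unfolding p_def by blast
  have L: "invertible L" "(L *v p) $ Some None \<noteq> 0"
    and \<tau>: "\<And>i. (L *v p) $ Some (Some i) = (L *v p) $ Some None * \<tau> $ i"
    and f0: "(L *v p) $ None = (L *v p) $ Some None * mps_coeff f {#}"
    using chart by (auto simp: cone_chart_def Let_def p_def)
  obtain F1 where F1: "reduced_equation C F1"
      "poly_eval mps_const (\<lambda>j. \<Sum>i\<in>UNIV. mps_const (matrix_inv L $ j $ i) * graph_point \<tau> f $ i) F1 = 0"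
      "(\<Sum>j\<in>UNIV. gradient_at F1 p $ j * matrix_inv L $ j $ None) \<noteq> 0"
    using chart by (auto simp: cone_chart_def Let_def p_def)
  have "p \<in> C" by (simp add: p_def quad_map_in_C)
  have "is_poly F1" "\<And>y. y \<in> C \<Longrightarrow> poly_at F1 y = 0" using F1(1) by (auto simp: reduced_equation_def)
  then obtain r where "\<And>i. poly_at (mps_deriv i F1) p = r * gradient_at F p $ i"
    using gradient_proportional[OF F(1) _ _ \<open>p \<in> C\<close>] by metis
  then have "(\<Sum>j\<in>UNIV. gradient_at F1 p $ j * matrix_inv L $ j $ None)
    = r * (\<Sum>j\<in>UNIV. gradient_at F p $ j * matrix_inv L $ j $ None)"
    by (simp add: gradient_at_def[of F1] sum_distrib_left mult.assoc)
  then have e: "(\<Sum>j\<in>UNIV. gradient_at F p $ j * matrix_inv L $ j $ None) \<noteq> 0" using F1(3) by auto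
  interpret ca: chart_at C a b L "\<lambda>i. gradient_at F p $ i" \<O> using chart_at L e by blast
  have \<tau>_eq: "\<tau> = (\<chi> i. ca.\<tau> i)"
    using L(2) by (simp add: vec_eq_iff ca.\<tau>_def ca.yp_def ca.p_def p_def[symmetric] \<tau>)
  have f_eq: "f = ca.ch.f"
  proof (rule ca.chart_unique[OF F1(1)])
    show "(\<Sum>j\<in>UNIV. gradient_at F1 ca.p $ j * matrix_inv L $ j $ None) \<noteq> 0"
      using F1(3) by (simp add: ca.p_def p_def)
    show "poly_eval mps_const (\<lambda>j. \<Sum>i\<in>UNIV. mps_const (matrix_inv L $ j $ i) * graph_point (\<chi> i. ca.\<tau> i) f $ i) F1 = 0"
      using F1(2) by (simp only: \<tau>_eq)
    show "mps_coeff f {#} = mps_coeff ca.ch.f {#}"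
      using L(2) by (simp add: ca.f_0 ca.yp_def ca.p_def p_def[symmetric] f0)
  qed
  show "enat (CARD('n) + 1) \<le> rank_of \<O> f" unfolding f_eq by (rule ca.rank_ge)
  show "c \<noteq> 0 \<Longrightarrow> density_in_chart \<O> a L \<tau> f b (linear_germ b c)"
    unfolding f_eq \<tau>_eq by (rule ca.density_in_chart)
qed

text \<open>Some partial derivative \<open>j\<close> of \<open>F\<close> is non-zero at
  \<open>p\<close>. As the gradient is orthogonal to \<open>p \<noteq> 0\<close>, some other
  coordinate \<open>i\<close> of \<open>p\<close> is non-zero, so the \<open>j\<close>-th axis can
  serve as direction \<open>y\<^sub>n\<^sub>+\<^sub>1\<close> and \<open>p\<close> itself as
  direction \<open>y\<^sub>0\<close>.\<close>

lemma has_chart: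
  assumes \<O>: "germ_space \<O>" and b: "immersive_at b" and gauss: "gauss_immersive C (quad_map a id b)"
  shows "has_cone_chart \<O> C (quad_map a id b)"
proof -
  define p where "p = quad_map a id b"
  obtain F where F: "reduced_equation C F" "gradient_at F p \<noteq> 0"
    and chart_at: "\<forall>L. invertible L \<longrightarrow> (L *v p) $ Some None \<noteq> 0 \<longrightarrow>
      (\<Sum>j\<in>UNIV. gradient_at F p $ j * matrix_inv L $ j $ None) \<noteq> 0 \<longrightarrow>
      chart_at C a b L (\<lambda>i. gradient_at F p $ i) \<O>"
    using chart_at_I[OF \<O> b gauss] unfolding p_def by blast
  obtain j where j: "gradient_at F p $ j \<noteq> 0" using F(2) by (auto simp: vec_eq_iff)
  have "p \<noteq> 0" using gauss by (auto simp: gauss_immersive_def p_def)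
  have euler: "(\<Sum>i\<in>UNIV. gradient_at F p $ i * p $ i) = 0"
  proof -
    have "p $ i = 1 / 2 * (\<Sum>k\<in>UNIV. b $ k * tangent b k i)" for i
      by (simp add: p_def quad_map_nth polar_tangent)
    then have "(\<Sum>i\<in>UNIV. gradient_at F p $ i * p $ i) = 1 / 2 * (\<Sum>i\<in>UNIV. \<Sum>k\<in>UNIV. b $ k * (gradient_at F p $ i * tangent b k i))"
      by (simp add: sum_distrib_left mult_ac)
    also have "(\<Sum>i\<in>UNIV. \<Sum>k\<in>UNIV. b $ k * (gradient_at F p $ i * tangent b k i)) = 0"
      by (subst sum.swap) (simp add: sum_distrib_left[symmetric] p_def gradient_tangent[OF F(1)])
    finally show ?thesis by simp
  qed
  have "\<exists>i. i \<noteq> j \<and> p $ i \<noteq> 0"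
  proof (rule ccontr)
    assume "\<not> ?thesis"
    then have "\<And>i. i \<noteq> j \<Longrightarrow> p $ i = 0" by blast
    then have "(\<Sum>i\<in>UNIV. gradient_at F p $ i * p $ i) = gradient_at F p $ j * p $ j"
      by (subst sum.remove[of _ j]) auto
    then have "p $ j = 0" using euler j by simp
    then have "p = 0" using \<open>\<And>i. i \<noteq> j \<Longrightarrow> p $ i = 0\<close> by (metis vec_eq_iff zero_index)
    then show False using \<open>p \<noteq> 0\<close> by simp
  qed
  then obtain i where i: "i \<noteq> j" "p $ i \<noteq> 0" by blast
  \<comment> \<open>The place to which the first transposition sends \<open>Some None\<close>; the
    second one moves it to \<open>i\<close> without disturbing \<open>j\<close>.\<close>
  define m where "m = Transposition.transpose None j (Some None)"
  define \<pi> where "\<pi> = Transposition.transpose m i \<circ> Transposition.transpose None j"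
  have "m \<noteq> j" by (auto simp: m_def Transposition.transpose_def)
  then have "\<pi> None = j" using i(1) by (auto simp: \<pi>_def Transposition.transpose_def)
  moreover have "\<pi> (Some None) = i" by (simp add: \<pi>_def m_def[symmetric])
  moreover have "bij \<pi>" unfolding \<pi>_def by (intro bij_comp) simp_all
  ultimately have \<pi>: "bij \<pi>" "\<pi> None = j" "\<pi> (Some None) = i" by blast+
  \<comment> \<open>The inverse of the wanted \<open>L\<close>, by columns: \<open>p\<close> in
    place \<open>Some None\<close>, and in the other places the unit vectors permuted by
    \<open>\<pi>\<close>.\<close>
  define M where "M = (\<chi> r c. if c = Some None then p $ r else if r = \<pi> c then 1 else 0)"
  have inj: "\<pi> c = \<pi> c' \<longleftrightarrow> c = c'" for c c' using \<pi>(1) by (metis bij_is_inj inj_eq)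
  have Mz: "(M *v z) $ \<pi> c' = p $ \<pi> c' * z $ Some None + (if c' = Some None then 0 else z $ c')" for z c'
  proof -
    have "(M *v z) $ \<pi> c' = (\<Sum>c\<in>UNIV. (if c = Some None then p $ \<pi> c' * z $ Some None else 0)
        + (if c = c' then if c' = Some None then 0 else z $ c' else 0))"
      unfolding matrix_vector_mult_def vec_lambda_beta M_def by (intro sum.cong refl) (auto simp: inj)
    then show ?thesis by (simp add: sum.distrib)
  qed
  have "z = 0" if z: "M *v z = 0" for z
  proof -
    have 1: "p $ \<pi> c' * z $ Some None + (if c' = Some None then 0 else z $ c') = 0" for c'
      unfolding Mz[symmetric] by (simp add: z)
    have "z $ Some None = 0" using 1[of "Some None"] i(2) by (simp add: \<pi>)
    then have "z $ c' = 0" for c' using 1[of c'] by (cases "c' = Some None") auto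
    then show ?thesis by (simp add: vec_eq_iff)
  qed
  then have invM: "invertible M" unfolding invertible_left_inverse matrix_left_invertible_ker by blast
  define L where "L = matrix_inv M"
  have LM: "L ** M = mat 1" "M ** L = mat 1" using matrix_inv_mult[OF invM] by (simp_all add: L_def)
  have invL: "invertible L" unfolding invertible_def using LM by blast
  have "matrix_inv L = M"
    using matrix_inv_mult(2)[OF invL] LM by (metis matrix_mul_assoc matrix_mul_lid matrix_mul_rid)
  have "M *v axis (Some None) 1 = p"
  proof -
    have "(\<Sum>c\<in>UNIV. M $ r $ c * axis (Some None) 1 $ c) = p $ r" for r
      by (subst sum.remove[of _ "Some None"]) (auto simp: M_def axis_def)
    then show ?thesis by (simp add: vec_eq_iff matrix_vector_mult_def)
  qed
  then have "L *v p = axis (Some None) 1"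
    using LM(1) by (metis matrix_vector_mul_assoc matrix_vector_mul_lid)
  then have y0: "(L *v p) $ Some None \<noteq> 0" by simp
  have "(\<Sum>l\<in>UNIV. gradient_at F p $ l * M $ l $ None) = gradient_at F p $ j"
    by (subst sum.remove[of _ j]) (auto simp: M_def \<pi>)
  then have e: "(\<Sum>l\<in>UNIV. gradient_at F p $ l * matrix_inv L $ l $ None) \<noteq> 0"
    using j by (simp add: \<open>matrix_inv L = M\<close>)
  interpret ca: chart_at C a b L "\<lambda>i. gradient_at F p $ i" \<O> using chart_at invL y0 e by blast
  have "cone_chart \<O> C L (\<chi> i. ca.\<tau> i) ca.ch.f ca.p"
    by (rule ca.chart_exists[OF F(1)]) (use e in \<open>simp add: ca.p_def p_def\<close>)
  then show ?thesis unfolding has_cone_chart_def ca.p_def by blast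
qed

lemma generically_mono:
  "generically S P \<Longrightarrow> (\<And>x. P x \<Longrightarrow> Q x) \<Longrightarrow> generically S Q"
  unfolding generically_def by blast

end

theorem theorem5p2p1:
  fixes \<O> :: "('n :: finite, 'k :: {alg_closed_field, field_char_0}) mps set"
    and C :: "('k ^ 'n option option) set"
    and a :: "'n option option \<Rightarrow> 'n option \<Rightarrow> 'n option \<Rightarrow> 'k"
  assumes "germ_space \<O>"
    and "nondegenerate_cone C"
    and "quadratic_parametrization C a"
  shows "cone_admissible \<O> C \<and>
         enat (CARD('n) + 1) \<le> cone_rank \<O> C \<and>
         (\<forall>c. c \<noteq> 0 \<longrightarrow> generically UNIV (\<lambda>b. admissible_density \<O> C a b (linear_germ b c)))"
proof -
  interpret quadratic_cone C a by unfold_locales (fact assms)+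
  have rank: "generically C (\<lambda>p. has_cone_chart \<O> C p \<and>
      (\<forall>L \<tau> f. cone_chart \<O> C L \<tau> f p \<longrightarrow> enat (CARD('n) + 1) \<le> rank_of \<O> f))"
    using generic_point
    by (rule generically_mono) (use has_chart[OF assms(1)] chart_of_cone_chart(1)[OF assms(1)] in blast)
  then have "enat (CARD('n) + 1) \<le> cone_rank \<O> C"
    unfolding cone_rank_def by (intro Sup_upper) simp
  moreover have "cone_admissible \<O> C"
    unfolding cone_admissible_def
    using rank
  proof (rule generically_mono)
    fix p
    have "admissible \<O> f" if "enat (CARD('n) + 1) \<le> rank_of \<O> f" for f
      using order_less_le_trans[OF _ that, of 0] by (simp add: admissible_def enat_0_iff zero_enat_def)
    then show "has_cone_chart \<O> C p \<and> (\<forall>L \<tau> f. cone_chart \<O> C L \<tau> f p \<longrightarrow> enat (CARD('n) + 1) \<le> rank_of \<O> f) \<Longrightarrow>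
      has_cone_chart \<O> C p \<and> (\<forall>L \<tau> f. cone_chart \<O> C L \<tau> f p \<longrightarrow> admissible \<O> f)"
      by blast
  qed
  moreover have "generically UNIV (\<lambda>b. admissible_density \<O> C a b (linear_germ b c))" if "c \<noteq> 0" for c
    using generic_parameter
    by (rule generically_mono)
       (use has_chart[OF assms(1)] chart_of_cone_chart(2)[OF assms(1)] that in \<open>auto simp: admissible_density_def\<close>)
  ultimately show ?thesis by blast
qed

end
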